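(* (i) Suppose $f\in L^1([-1,1]^d,\mu^d_{\alpha,\beta})$ is such that $\int_{[-1,1]^d}f(y)\,\mu^d_{\alpha,\beta}(dy)=0$. Then $$f=\int_0^\infty Q_t^{\alpha,\beta}f\,\frac{dt}{t}.$$ (ii) Suppose $f$ is a polynomial such that $\int_{[-1,1]^d}f(y)\,\mu^d_{\alpha,\beta}(dy)=0$. Then $$f=C_\gamma\int_0^\infty\int_0^\infty t^{-\gamma}s^{\gamma}\,Q_t^{\alpha,\beta}\big(Q_s^{\alpha,\beta}f\big)\,\frac{ds}{s}\frac{dt}{t},\qquad 0<\gamma<1.$$ Also, $$\int_0^\infty\int_0^\infty t^{-\gamma}s^{\gamma}\,Q_t^{\alpha,\beta}\big(Q_s^{\alpha,\beta}f\big)\,\frac{ds}{s}\frac{dt}{t}=\int_0^\infty u\,\frac{\partial^2}{\partial u^2}P_u^{\alpha,\beta}f\,du.$$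
   Context: $\mathbb{N}=\{0,1,2,\dots\}$. Fix $d\ge 1$ and $\alpha=(\alpha_1,\dots,\alpha_d),\ \beta=(\beta_1,\dots,\beta_d)\in\mathbb{R}^d$ with $\alpha_i,\beta_i>-\frac12$ for all $i$. The normalized Jacobi measure on $[-1,1]^d$ is the probability measure $\mu^d_{\alpha,\beta}(dx)=\prod_{i=1}^d \frac{1}{2^{\alpha_i+\beta_i+1}B(\alpha_i+1,\beta_i+1)}(1-x_i)^{\alpha_i}(1+x_i)^{\beta_i}dx_i$, where $B$ is the Beta function. For $n\in\mathbb{N}$ and real $a,b>-1$, $p_n^{a,b}$ is the one-dimensional Jacobi polynomial of degree $n$, given by Rodrigues' formula $(1-x)^a(1+x)^b c_n p_n^{a,b}(x)=\frac{(-1)^n}{2^n n!}\frac{d^n}{dx^n}\{(1-x)^{a+n}(1+x)^{b+n}\}$, with constant $c_n>0$ chosen so that $p_n^{a,b}$ has $L^2$ norm $1$ with respect to the one-dimensional normalized Jacobi measure. For $\kappa=(\kappa_1,\dots,\kappa_d)\in\mathbb{N}^d$ put $\vec p_\kappa^{\,\alpha,\beta}(x)=\prod_{i=1}^d p_{\kappa_i}^{\alpha_i,\beta_i}(x_i)$; these form an orthonormal basis of $L^2([-1,1]^d,\mu^d_{\alpha,\beta})$. Put $\lambda_\kappa=\sum_{i=1}^d\kappa_i(\kappa_i+\alpha_i+\beta_i+1)$. The Jacobi semigroup is $T_t^{\alpha,\beta}f(x)=\int_{[-1,1]^d}f(y)\,p_d^{\alpha,\beta}(t,x,y)\,\mu^d_{\alpha,\beta}(dy)$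 with kernel $p_d^{\alpha,\beta}(t,x,y)=\sum_{\kappa\in\mathbb{N}^d}e^{-\lambda_\kappa t}\vec p_\kappa^{\,\alpha,\beta}(x)\vec p_\kappa^{\,\alpha,\beta}(y)$ for $t>0$, and $T_0^{\alpha,\beta}=I$. It is a strongly continuous semigroup of positive contractions on $L^p([-1,1]^d,\mu^d_{\alpha,\beta})$ with $T_t^{\alpha,\beta}\vec p_\kappa^{\,\alpha,\beta}=e^{-\lambda_\kappa t}\vec p_\kappa^{\,\alpha,\beta}$. The Poisson–Jacobi semigroup is $P_t^{\alpha,\beta}f(x)=\frac{1}{\sqrt\pi}\int_0^\infty\frac{e^{-u}}{\sqrt u}T^{\alpha,\beta}_{t^2/4u}f(x)\,du$, so that $P_t^{\alpha,\beta}\vec p_\kappa^{\,\alpha,\beta}=e^{-\lambda_\kappa^{1/2}t}\vec p_\kappa^{\,\alpha,\beta}$. For $t>0$, $Q_t^{\alpha,\beta}f(x)=-t\frac{\partial}{\partial t}P_t^{\alpha,\beta}f(x)$. For $0<\gamma<1$, $C_\gamma=-\frac{1}{\gamma^2c_\gamma\Gamma(\gamma)}$, where $c_\gamma=\int_0^\infty s^{-\gamma-1}(e^{-s}-1)\,ds$ and $\Gamma$ is the Gamma function.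
   Formalization: The last identity of (ii) is false as printed (for f a Jacobi polynomial of nonzero degree the left side is (πγ/sin πγ)f, the right side f); it is stated with the factor C_γ before the double integral. In (i) the identity holds almost everywhere with an improper integral. *)

theory Defs
  imports "HOL-Analysis.Analysis" "HOL-Computational_Algebra.Polynomial"
begin

text \<open>
  The dimension is the cardinality of the finite index type \<open>'n\<close>. The Jacobi measures live on the
  whole space and are concentrated on the cube, so an element of $L^1$ is represented by a Borel
  function on \<open>real ^ 'n\<close>, whose values off the cube are irrelevant.
\<close>

definition jacobi_cube :: "(real ^ 'n) set" where
  "jacobi_cube = {x. \<forall>i. x $ i \<in> {-1..1}}"

definition jacobi_density :: "real \<Rightarrow> real \<Rightarrow> real \<Rightarrow> real" where
  "jacobi_density a b x = indicator {-1..1} x *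
     ((1 - x) powr a * (1 + x) powr b / (2 powr (a + b + 1) * Beta (a + 1) (b + 1)))"

definition jacobi_measure1 :: "real \<Rightarrow> real \<Rightarrow> real measure" where
  "jacobi_measure1 a b = density lborel (\<lambda>x. ennreal (jacobi_density a b x))"

definition jacobi_measure :: "real ^ 'n \<Rightarrow> real ^ 'n \<Rightarrow> (real ^ 'n) measure" where
  "jacobi_measure \<alpha> \<beta> =
     density lborel (\<lambda>x. ennreal (\<Prod>i\<in>UNIV. jacobi_density (\<alpha> $ i) (\<beta> $ i) (x $ i)))"

text \<open>
  Rodrigues' formula is imposed on the open interval, where the differentiated function is smooth;
  being a polynomial identity up to the weight, it determines the polynomial up to the constant
  \<open>c\<close>, and \<open>c > 0\<close> is then fixed by the normalization.
\<close>

definition jacobi_poly :: "real \<Rightarrow> real \<Rightarrow> nat \<Rightarrow> real poly" where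
  "jacobi_poly a b n = (THE p.
     (\<exists>c>0. \<forall>x\<in>{-1<..<1}. (1 - x) powr a * (1 + x) powr b * c * poly p x =
        (-1) ^ n / (2 ^ n * fact n) *
        (deriv ^^ n) (\<lambda>z. (1 - z) powr (a + real n) * (1 + z) powr (b + real n)) x) \<and>
     (\<integral>x. (poly p x)\<^sup>2 \<partial>jacobi_measure1 a b) = 1)"

definition multi_jacobi :: "real ^ 'n \<Rightarrow> real ^ 'n \<Rightarrow> nat ^ 'n \<Rightarrow> real ^ 'n \<Rightarrow> real" where
  "multi_jacobi \<alpha> \<beta> \<kappa> x = (\<Prod>i\<in>UNIV. poly (jacobi_poly (\<alpha> $ i) (\<beta> $ i) (\<kappa> $ i)) (x $ i))"

definition jacobi_eigenvalue :: "real ^ 'n \<Rightarrow> real ^ 'n \<Rightarrow> nat ^ 'n \<Rightarrow> real" where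
  "jacobi_eigenvalue \<alpha> \<beta> \<kappa> = (\<Sum>i\<in>UNIV. real (\<kappa> $ i) * (real (\<kappa> $ i) + \<alpha> $ i + \<beta> $ i + 1))"

definition jacobi_kernel ::
    "real ^ 'n \<Rightarrow> real ^ 'n \<Rightarrow> real \<Rightarrow> real ^ 'n \<Rightarrow> real ^ 'n \<Rightarrow> real" where
  "jacobi_kernel \<alpha> \<beta> t x y = (\<Sum>\<^sub>\<infinity>\<kappa>\<in>UNIV.
     exp (- jacobi_eigenvalue \<alpha> \<beta> \<kappa> * t) * multi_jacobi \<alpha> \<beta> \<kappa> x * multi_jacobi \<alpha> \<beta> \<kappa> y)"

definition jacobi_semigroup ::
    "real ^ 'n \<Rightarrow> real ^ 'n \<Rightarrow> real \<Rightarrow> (real ^ 'n \<Rightarrow> real) \<Rightarrow> real ^ 'n \<Rightarrow> real" where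
  "jacobi_semigroup \<alpha> \<beta> t f x =
     (if t = 0 then f x else (\<integral>y. f y * jacobi_kernel \<alpha> \<beta> t x y \<partial>jacobi_measure \<alpha> \<beta>))"

definition poisson_jacobi ::
    "real ^ 'n \<Rightarrow> real ^ 'n \<Rightarrow> real \<Rightarrow> (real ^ 'n \<Rightarrow> real) \<Rightarrow> real ^ 'n \<Rightarrow> real" where
  "poisson_jacobi \<alpha> \<beta> t f x = 1 / sqrt pi *
     (LBINT u:{0<..}. exp (- u) / sqrt u * jacobi_semigroup \<alpha> \<beta> (t\<^sup>2 / (4 * u)) f x)"

definition Q_jacobi ::
    "real ^ 'n \<Rightarrow> real ^ 'n \<Rightarrow> real \<Rightarrow> (real ^ 'n \<Rightarrow> real) \<Rightarrow> real ^ 'n \<Rightarrow> real" where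
  "Q_jacobi \<alpha> \<beta> t f x = - t * deriv (\<lambda>s. poisson_jacobi \<alpha> \<beta> s f x) t"

definition c_const :: "real \<Rightarrow> real" where
  "c_const \<gamma> = (LBINT s:{0<..}. s powr (- \<gamma> - 1) * (exp (- s) - 1))"

definition C_const :: "real \<Rightarrow> real" where
  "C_const \<gamma> = - 1 / (\<gamma>\<^sup>2 * c_const \<gamma> * Gamma \<gamma>)"

definition reproducing_integrand ::
    "real ^ 'n \<Rightarrow> real ^ 'n \<Rightarrow> real \<Rightarrow> (real ^ 'n \<Rightarrow> real) \<Rightarrow> real ^ 'n \<Rightarrow> real \<Rightarrow> real \<Rightarrow> real" where
  "reproducing_integrand \<alpha> \<beta> \<gamma> f x t s =
     t powr (- \<gamma>) * s powr \<gamma> * Q_jacobi \<alpha> \<beta> t (Q_jacobi \<alpha> \<beta> s f) x / s / t"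

text \<open>
  For integrable \<open>f\<close> the function \<open>t \<mapsto> Q\<^sub>t f(x) / t\<close> need not be absolutely integrable near
  \<open>0\<close>, so its integral over the half-line is read as a limit of integrals over compact intervals.
\<close>

definition has_improper_integral :: "(real \<Rightarrow> real) \<Rightarrow> real \<Rightarrow> bool" where
  "has_improper_integral g I \<longleftrightarrow>
     (\<forall>a b. 0 < a \<longrightarrow> a < b \<longrightarrow> set_integrable lborel {a..b} g) \<and>
     ((\<lambda>(a, b). LBINT t:{a..b}. g t) \<longlongrightarrow> I) (at_right 0 \<times>\<^sub>F at_top)"

end

theory Submission
  imports Defs "HOL-Probability.Distributions" "HOL-Real_Asymp.Real_Asymp"
begin

text \<open>
  On a Jacobi polynomial with eigenvalue $\lambda = \nu^2$ the Poisson semigroup acts by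
  $e^{-\nu t}$, so both parts reduce mode by mode to elementary integrals: $-\partial_t P_t f$
  integrates to $P_0 f - P_\infty f$, and $\nu^2 t^{-\gamma} s^{\gamma} e^{-\nu (t + s)}$ integrates
  over the quadrant to $\Gamma(1-\gamma)\Gamma(1+\gamma) = 1 / C_\gamma$. For a mean-zero polynomial
  the sum over the modes is finite and $\nu > 0$ on all of them, which proves the second part
  (\<open>polynomial_reproducing_formula\<close>). For integrable \<open>f\<close> two things remain: the series must
  converge pointwise, and $P_t f$ must tend to \<open>f\<close> almost everywhere as $t \to 0$.

  Convergence. The kernel is an infinite sum of Jacobi polynomials, so their size matters. Sonin's
  function, a combination of $y^2$ and $y'^2$, is largest at an endpoint
  (\<open>sonin_endpoint_bound\<close>), and a polynomial that is large at an endpoint carries mass near it; the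
  \<open>L\<^sup>2\<close> normalization then bounds the sup norm polynomially in the degree
  (\<open>jacobi_poly_sup_bound\<close>). Off the interval the Taylor expansion at 1 gives at most exponential
  growth (\<open>jacobi_poly_growth\<close>), which the factor $e^{-\lambda t}$ still beats. Hence the heat
  semigroup acts on coefficients everywhere (\<open>jacobi_semigroup_series\<close>), and so does the Poisson
  semigroup on the cube, by the subordination identity (\<open>poisson_series\<close>).

  Almost everywhere convergence. The Jacobi operator satisfies a minimum principle
  (\<open>generator_at_minimum\<close>), so its resolvents, and with them the heat semigroup, preserve
  nonnegative functions (\<open>heat_nonneg\<close>). Substituting $u = t^2 v$ in the subordination integral
  shows that $P_t f / t$ decreases in \<open>t\<close> when $f \ge 0$ (\<open>pois_quotient_decreasing\<close>). Therefore
  $P_{nh} f$ is at most twice the average of $P_h f, \dots, P_{nh} f$, and the maximal ergodic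
  inequality of Hopf, applied to the single operator $P_h$, bounds
  $\sup_{0 < t \le 1} P_t f$ in weak \<open>L\<^sup>1\<close> (\<open>maximal_weak_type\<close>). Polynomials are dense in
  \<open>L\<^sup>1\<close> and for them convergence is clear, so it holds for every integrable function
  (\<open>pois_tendsto_AE\<close>).
\<close>

section \<open>Jacobi polynomials of one variable\<close>

text \<open>
  Differentiating $(1-x)^A (1+x)^B q$ lowers both exponents by one and replaces $q$ by
  \<open>raise_op A B q\<close>; see \<open>has_derivative_weight_times_poly\<close>.
\<close>

definition raise_op :: "real \<Rightarrow> real \<Rightarrow> real poly \<Rightarrow> real poly" where
  "raise_op A B q = [:1, 0, -1:] * pderiv q + [:B - A, - (A + B):] * q"

text \<open>
  The polynomial factor in Rodrigues' formula without its constant. Each of the \<open>n\<close> derivatives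
  is one application of \<open>raise_op\<close>; the recursion peels off the last derivative, before which both
  exponents are larger by one.
\<close>

fun rodrigues :: "real \<Rightarrow> real \<Rightarrow> nat \<Rightarrow> real poly" where
  "rodrigues a b 0 = 1"
| "rodrigues a b (Suc n) = raise_op (a + 1) (b + 1) (rodrigues (a + 1) (b + 1) n)"

text \<open>
  The Jacobi differential operator in divergence form: for the weight $w = (1-x)^a (1+x)^b$,
  $w$ times \<open>jacobi_op a b q\<close> is the derivative of $(1-x)^{a+1} (1+x)^{b+1} q'$.
\<close>

definition jacobi_op :: "real \<Rightarrow> real \<Rightarrow> real poly \<Rightarrow> real poly" where
  "jacobi_op a b q = raise_op (a + 1) (b + 1) (pderiv q)"

lemma poly_raise_op:
  "poly (raise_op A B q) x = (1 - x\<^sup>2) * poly (pderiv q) x + (B - A - (A + B) * x) * poly q x"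
  by (simp add: raise_op_def algebra_simps power2_eq_square)

lemma poly_jacobi_op:
  "poly (jacobi_op a b q) x =
     (1 - x\<^sup>2) * poly (pderiv (pderiv q)) x + (b - a - (a + b + 2) * x) * poly (pderiv q) x"
  by (simp add: jacobi_op_def poly_raise_op algebra_simps)

lemma real_poly_ext: "(\<And>x. poly p x = poly q x) \<Longrightarrow> p = (q :: real poly)"
  by (simp add: poly_eq_poly_eq_iff[symmetric] ext)

lemma raise_op_add: "raise_op A B (p + q) = raise_op A B p + raise_op A B q"
  by (rule real_poly_ext) (simp add: poly_raise_op pderiv_add algebra_simps)

lemma raise_op_smult: "raise_op A B (smult c q) = smult c (raise_op A B q)"
  by (simp add: raise_op_def pderiv_smult smult_add_right)

lemma jacobi_op_add: "jacobi_op a b (p + q) = jacobi_op a b p + jacobi_op a b q"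
  by (simp add: jacobi_op_def pderiv_add raise_op_add)

lemma jacobi_op_smult: "jacobi_op a b (smult c q) = smult c (jacobi_op a b q)"
  by (simp add: jacobi_op_def pderiv_smult raise_op_smult)

lemma jacobi_op_sum: "jacobi_op a b (\<Sum>i\<in>I. f i) = (\<Sum>i\<in>I. jacobi_op a b (f i))"
proof (induction I rule: infinite_finite_induct)
  case (insert x F)
  then show ?case by (simp add: jacobi_op_add)
qed (simp_all add: jacobi_op_def raise_op_def)

lemma has_derivative_weight_times_poly:
  assumes "x \<in> {-1<..<1}"
  shows "((\<lambda>z. (1 - z) powr A * (1 + z) powr B * poly q z) has_real_derivative
     (1 - x) powr (A - 1) * (1 + x) powr (B - 1) * poly (raise_op A B q) x) (at x)"
proof -
  have pos: "1 - x > 0" "1 + x > 0" using assms by auto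
  have jac1: "(1 - x) powr A = (1 - x) * (1 - x) powr (A - 1)"
    using pos by (simp add: powr_mult_base)
  have p2: "(1 + x) powr B = (1 + x) * (1 + x) powr (B - 1)"
    using pos by (simp add: powr_mult_base)
  have d1: "((\<lambda>z. (1 - z) powr A) has_real_derivative (A * (1 - x) powr (A - 1)) * (-1)) (at x)"
    by (rule DERIV_chain2[OF has_real_derivative_powr]) (use pos in \<open>auto intro!: derivative_eq_intros\<close>)
  have d2: "((\<lambda>z. (1 + z) powr B) has_real_derivative (B * (1 + x) powr (B - 1)) * 1) (at x)"
    by (rule DERIV_chain2[OF has_real_derivative_powr]) (use pos in \<open>auto intro!: derivative_eq_intros\<close>)
  have "((\<lambda>z. (1 - z) powr A * (1 + z) powr B * poly q z) has_real_derivative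
     ((A * (1 - x) powr (A - 1)) * (-1) * (1 + x) powr B + (B * (1 + x) powr (B - 1)) * 1 * (1 - x) powr A) * poly q x
       + poly (pderiv q) x * ((1 - x) powr A * (1 + x) powr B)) (at x)"
    by (intro DERIV_mult d1 d2 poly_DERIV)
  also have "((A * (1 - x) powr (A - 1)) * (-1) * (1 + x) powr B + (B * (1 + x) powr (B - 1)) * 1 * (1 - x) powr A) * poly q x
       + poly (pderiv q) x * ((1 - x) powr A * (1 + x) powr B)
     = (1 - x) powr (A - 1) * (1 + x) powr (B - 1) * poly (raise_op A B q) x"
    unfolding jac1 p2 poly_raise_op by (simp add: algebra_simps power2_eq_square)
  finally show ?thesis .
qed

lemma rodrigues_formula:
  assumes "x \<in> {-1<..<1}"
  shows "(deriv ^^ n) (\<lambda>z. (1 - z) powr (a + real n) * (1 + z) powr (b + real n)) x =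
     (1 - x) powr a * (1 + x) powr b * poly (rodrigues a b n) x"
  using assms
proof (induction n arbitrary: a b x)
  case (Suc n)
  let ?f = "\<lambda>z::real. (1 - z) powr (a + real (Suc n)) * (1 + z) powr (b + real (Suc n))"
  have "\<forall>\<^sub>F z in nhds x. z \<in> {-1<..<1}"
    using Suc.prems by (intro eventually_nhds_in_open) auto
  moreover have "(deriv ^^ n) ?f z =
      (1 - z) powr (a + 1) * (1 + z) powr (b + 1) * poly (rodrigues (a + 1) (b + 1) n) z"
    if "z \<in> {-1<..<1}" for z
    using Suc.IH[OF that, of "a + 1" "b + 1"] by (simp add: add.assoc)
  ultimately have "\<forall>\<^sub>F z in nhds x. (deriv ^^ n) ?f z =
      (1 - z) powr (a + 1) * (1 + z) powr (b + 1) * poly (rodrigues (a + 1) (b + 1) n) z"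
    by (auto elim: eventually_mono)
  then have "deriv ((deriv ^^ n) ?f) x =
     deriv (\<lambda>z. (1 - z) powr (a + 1) * (1 + z) powr (b + 1) * poly (rodrigues (a + 1) (b + 1) n) z) x"
    by (rule deriv_cong_ev) simp
  also have "\<dots> = (1 - x) powr a * (1 + x) powr b * poly (rodrigues a b (Suc n)) x"
    using DERIV_imp_deriv[OF has_derivative_weight_times_poly[OF Suc.prems,
        of "a + 1" "b + 1" "rodrigues (a + 1) (b + 1) n"]] by simp
  finally show ?case by simp
qed simp

lemma coeff_raise_op_Suc:
  "coeff (raise_op A B q) (Suc m) =
     (real m + 2) * coeff q (Suc (Suc m)) + (B - A) * coeff q (Suc m) - (real m + A + B) * coeff q m"
proof -
  have e: "raise_op A B q = pderiv q - pCons 0 (pCons 0 (pderiv q)) + smult (B - A) q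
      - smult (A + B) (pCons 0 q)"
    by (rule real_poly_ext) (simp add: poly_raise_op power2_eq_square algebra_simps)
  show ?thesis unfolding e
    by (cases m) (auto simp: coeff_pderiv algebra_simps)
qed

lemma degree_raise_op:
  assumes "degree q = n" "q \<noteq> 0" "A + B > 0"
  shows "degree (raise_op A B q) = Suc n" "raise_op A B q \<noteq> 0"
proof -
  have z: "coeff q m = 0" if "m > n" for m using assms(1) that by (simp add: coeff_eq_0)
  have "coeff (raise_op A B q) k = 0" if "k > Suc n" for k
    using that z by (cases k) (auto simp: coeff_raise_op_Suc)
  then have le: "degree (raise_op A B q) \<le> Suc n" by (simp add: degree_le)
  have "coeff q n \<noteq> 0" using assms by auto
  then have ne: "coeff (raise_op A B q) (Suc n) \<noteq> 0"
    using z[of "Suc n"] z[of "Suc (Suc n)"] assms(3) by (simp add: coeff_raise_op_Suc)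
  show "degree (raise_op A B q) = Suc n" using le le_degree[OF ne] by simp
  show "raise_op A B q \<noteq> 0" using ne by auto
qed

lemma degree_rodrigues:
  assumes "a + b > -2"
  shows "degree (rodrigues a b n) = n \<and> rodrigues a b n \<noteq> 0"
  using assms
proof (induction n arbitrary: a b)
  case (Suc n)
  then show ?case using Suc.IH[of "a + 1" "b + 1"]
    degree_raise_op[of "rodrigues (a + 1) (b + 1) n" n "a + 1" "b + 1"] by auto
qed simp

text \<open>
  The commutation relation behind the ladder of Jacobi polynomials: \<open>pderiv\<close> and \<open>raise_op\<close> behave
  like annihilation and creation operators.
\<close>

lemma pderiv_raise_op:
  "pderiv (raise_op A B q) = raise_op (A + 1) (B + 1) (pderiv q) + smult (- (A + B)) q"
  by (rule real_poly_ext)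
     (simp add: poly_raise_op, simp add: raise_op_def pderiv_add pderiv_mult pderiv_pCons
       pderiv_smult pderiv_minus power2_eq_square algebra_simps)

text \<open>
  By \<open>pderiv_raise_op\<close>, raising an eigenpolynomial for the parameters $(a+1, b+1)$ produces one for
  $(a, b)$ and lowers the eigenvalue by $a+b+2$. Starting from the constant polynomial, with
  eigenvalue 0, these decrements add up to $n(n+a+b+1)$.
\<close>

lemma rodrigues_eigen:
  "jacobi_op a b (rodrigues a b n) = smult (- (real n * (real n + a + b + 1))) (rodrigues a b n)"
proof (induction n arbitrary: a b)
  case 0
  show ?case by (simp add: jacobi_op_def raise_op_def)
next
  case (Suc n)
  let ?q = "rodrigues (a + 1) (b + 1) n"
  have "jacobi_op a b (rodrigues a b (Suc n)) =
      raise_op (a + 1) (b + 1) (jacobi_op (a + 1) (b + 1) ?q + smult (- (a + 1 + (b + 1))) ?q)"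
    by (simp add: jacobi_op_def pderiv_raise_op)
  also have "jacobi_op (a + 1) (b + 1) ?q + smult (- (a + 1 + (b + 1))) ?q
     = smult (- (real (Suc n) * (real (Suc n) + a + b + 1))) ?q"
    unfolding Suc.IH smult_add_left[symmetric] by (simp add: algebra_simps)
  finally show ?case by (simp only: raise_op_smult rodrigues.simps)
qed

section \<open>Orthonormality on the interval\<close>

lemma jacobi_density_measurable [measurable]: "jacobi_density a b \<in> borel_measurable borel"
  unfolding jacobi_density_def by measurable

lemma borel_measurable_poly [measurable]: "poly (q :: real poly) \<in> borel_measurable borel"
  by (intro borel_measurable_continuous_onI continuous_intros)

lemma jacobi_density_nonneg: "a > -1 \<Longrightarrow> b > -1 \<Longrightarrow> jacobi_density a b x \<ge> 0"
  unfolding jacobi_density_def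
  by (auto intro!: mult_nonneg_nonneg divide_nonneg_nonneg simp: Beta_def Gamma_real_nonneg indicator_def)

lemma Beta_pos: "x > 0 \<Longrightarrow> y > 0 \<Longrightarrow> Beta x (y::real) > 0"
  by (simp add: Beta_def Gamma_real_pos)

lemma integrable_jacobi_weight:
  fixes a b :: real
  assumes "a > -1" "b > -1"
  shows "integrable lborel (\<lambda>x. indicator {-1..1} x * ((1 - x) powr a * (1 + x) powr b))"
proof -
  have "((\<lambda>t. t powr (b + 1 - 1) * (1 - t) powr (a + 1 - 1)) has_integral Beta (b + 1) (a + 1)) {0..1}"
    by (rule has_integral_Beta_real) (use assms in auto)
  then have "(\<lambda>t. t powr b * (1 - t) powr a) absolutely_integrable_on {0..1::real}"
    by (intro nonnegative_absolutely_integrable_1) (auto simp: has_integral_integrable_integral)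
  then have i: "integrable lebesgue (\<lambda>t. indicator {0..1} t * (t powr b * (1 - t) powr a))"
    by (simp add: set_integrable_def)
  have "integrable lborel (\<lambda>t. indicator {0..1} t * (t powr b * (1 - t) powr a))"
    using i by (subst (asm) integrable_completion) auto
  from lborel_integrable_real_affine[OF this, of "1/2" "1/2"]
  have "integrable lborel (\<lambda>x. 2 powr (a + b) * (indicator {0..1} (1/2 + x/2) * ((1/2 + x/2) powr b * (1 - (1/2 + x/2)) powr a)))"
    by (simp add: mult.assoc)
  moreover have "2 powr (a + b) * (indicator {0..1} (1/2 + x/2) * ((1/2 + x/2) powr b * (1 - (1/2 + x/2)) powr a))
     = indicator {-1..1} x * ((1 - x) powr a * (1 + x) powr b)" for x :: real
  proof (cases "x \<in> {-1..1}")
    case True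
    have e: "1/2 + x/2 = (1 + x) / 2" "1 - (1 + x)/2 = (1 - x) / 2" by (simp_all add: field_simps)
    have "(1 - x) \<ge> 0" "1 + x \<ge> 0" using True by auto
    then have "((1 + x) / 2) powr b * ((1 - x) / 2) powr a = (1 + x) powr b * (1 - x) powr a / 2 powr (a + b)"
      by (simp add: powr_divide powr_add field_simps)
    then show ?thesis unfolding e using True by (simp add: indicator_def)
  qed (auto simp: indicator_def)
  ultimately show ?thesis by (simp only:)
qed

lemma integrable_jacobi_density:
  assumes "a > -1" "b > -1"
  shows "integrable lborel (jacobi_density a b)"
  using integrable_divide_zero[of "2 powr (a + b + 1) * Beta (a + 1) (b + 1)", OF integrable_jacobi_weight[OF assms]]
  unfolding jacobi_density_def by (simp add: mult.assoc)

lemma jacobi_normalization_pos: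
  assumes "a > -1" "b > -1"
  shows "2 powr (a + b + 1) * Beta (a + 1) (b + 1) > (0::real)"
  using assms by (simp add: Beta_pos)

lemma integrable_jacobi_density_times_poly:
  assumes "a > -1" "b > -1"
  shows "integrable lborel (\<lambda>x. jacobi_density a b x * poly q x)"
proof -
  have "bounded (poly q ` {-1..1})"
    by (intro compact_imp_bounded compact_continuous_image continuous_intros) auto
  then obtain C where C: "\<And>x. x \<in> {-1..1} \<Longrightarrow> \<bar>poly q x\<bar> \<le> C"
    unfolding bounded_real by (metis imageI)
  show ?thesis
  proof (rule Bochner_Integration.integrable_bound)
    show "integrable lborel (\<lambda>x. C * jacobi_density a b x)"
      using integrable_jacobi_density[OF assms] by simp
    have "\<bar>jacobi_density a b x * poly q x\<bar> \<le> \<bar>C * jacobi_density a b x\<bar>" for x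
    proof (cases "x \<in> {-1..1}")
      case True
      then have "jacobi_density a b x * \<bar>poly q x\<bar> \<le> jacobi_density a b x * C"
        using jacobi_density_nonneg[OF assms] C by (intro mult_left_mono) auto
      then show ?thesis using jacobi_density_nonneg[OF assms, of x]
        by (simp add: abs_mult mult.commute)
           (metis abs_ge_self mult_right_mono order_trans)
    qed (simp add: jacobi_density_def)
    then show "AE x in lborel. norm (jacobi_density a b x * poly q x) \<le> norm (C * jacobi_density a b x)"
      by simp
  qed measurable
qed

lemma integral_jacobi_measure1:
  assumes "a > -1" "b > -1" and [measurable]: "f \<in> borel_measurable borel"
  shows "(\<integral>x. f x \<partial>jacobi_measure1 a b) = (\<integral>x. jacobi_density a b x * f x \<partial>lborel)"
  unfolding jacobi_measure1_def
  using jacobi_density_nonneg[OF assms(1,2)] by (subst integral_density) auto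

lemma integrable_jacobi_measure1_poly:
  assumes "a > -1" "b > -1"
  shows "integrable (jacobi_measure1 a b) (poly q)"
  unfolding jacobi_measure1_def
  using jacobi_density_nonneg[OF assms] integrable_jacobi_density_times_poly[OF assms]
  by (subst integrable_density) auto

text \<open>
  Green's formula. Up to the normalizing constant, the density times $q\,Lp - p\,Lq$ is the
  derivative of $(1-x)^{a+1} (1+x)^{b+1} (p'q - q'p)$, and this function vanishes at both endpoints
  because its exponents are positive.
\<close>

lemma jacobi_op_symmetric:
  assumes "a > -1" "b > -1"
  shows "(\<integral>x. poly q x * poly (jacobi_op a b p) x \<partial>jacobi_measure1 a b) =
         (\<integral>x. poly p x * poly (jacobi_op a b q) x \<partial>jacobi_measure1 a b)"
proof -
  define r where "r = pderiv p * q - pderiv q * p"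
  have r: "raise_op (a + 1) (b + 1) r = q * jacobi_op a b p - p * jacobi_op a b q"
    by (rule real_poly_ext)
       (simp add: r_def poly_raise_op poly_jacobi_op pderiv_diff pderiv_mult algebra_simps)
  define H where "H = (\<lambda>x. (1 - x) powr (a + 1) * (1 + x) powr (b + 1) * poly r x)"
  let ?h = "\<lambda>x. (1 - x) powr a * (1 + x) powr b * poly (raise_op (a + 1) (b + 1) r) x"
  have "continuous_on {-1..1} H"
    unfolding H_def using assms by (auto intro!: continuous_intros continuous_on_powr')
  moreover have "(H has_vector_derivative ?h x) (at x)" if "x \<in> {-1<..<1}" for x
    using has_derivative_weight_times_poly[OF that, of "a + 1" "b + 1" r]
    by (simp add: H_def has_real_derivative_iff_has_vector_derivative)
  ultimately have "(?h has_integral (H 1 - H (-1))) {-1..1}"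
    by (intro fundamental_theorem_of_calculus_interior) auto
  then have hi: "(?h has_integral 0) {-1..1}" using assms by (simp add: H_def)
  define Z where "Z = 2 powr (a + b + 1) * Beta (a + 1) (b + 1)"
  have Z: "Z > 0" unfolding Z_def using jacobi_normalization_pos[OF assms] .
  have dens: "jacobi_density a b x * poly (raise_op (a + 1) (b + 1) r) x = indicator {-1..1} x *\<^sub>R ?h x / Z" for x
    by (simp add: jacobi_density_def Z_def)
  have "integrable lborel (\<lambda>x. indicator {-1..1} x *\<^sub>R ?h x / Z * Z)"
    using integrable_jacobi_density_times_poly[OF assms, of "raise_op (a + 1) (b + 1) r"]
    unfolding dens by (rule integrable_mult_left)
  then have "set_integrable lborel {-1..1} ?h"
    using Z unfolding set_integrable_def by simp
  from set_borel_integral_eq_integral(2)[OF this] hi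
  have "(\<integral>x. indicator {-1..1} x *\<^sub>R ?h x \<partial>lborel) = 0"
    unfolding set_lebesgue_integral_def by (simp add: integral_unique)
  then have "(\<integral>x. jacobi_density a b x * poly (raise_op (a + 1) (b + 1) r) x \<partial>lborel) = 0"
    unfolding dens by simp
  then have "(\<integral>x. poly (q * jacobi_op a b p - p * jacobi_op a b q) x \<partial>jacobi_measure1 a b) = 0"
    using assms r by (simp add: integral_jacobi_measure1)
  then have "(\<integral>x. poly (q * jacobi_op a b p) x \<partial>jacobi_measure1 a b) -
      (\<integral>x. poly (p * jacobi_op a b q) x \<partial>jacobi_measure1 a b) = 0"
    unfolding poly_diff
    by (subst (asm) Bochner_Integration.integral_diff)
       (rule integrable_jacobi_measure1_poly[OF assms])+
  then show ?thesis by simp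
qed

lemma integral_square_pos:
  assumes "a > -1" "b > -1" "q \<noteq> 0"
  shows "(\<integral>x. (poly q x)\<^sup>2 \<partial>jacobi_measure1 a b) > 0"
proof (rule ccontr)
  assume "\<not> ?thesis"
  moreover have ge: "(\<integral>x. (poly q x)\<^sup>2 \<partial>jacobi_measure1 a b) \<ge> 0" by simp
  ultimately have "(\<integral>x. jacobi_density a b x * poly (q\<^sup>2) x \<partial>lborel) = 0"
    using assms by (simp add: integral_jacobi_measure1)
  then have "AE x in lborel. jacobi_density a b x * poly (q\<^sup>2) x = 0"
    using integral_nonneg_eq_0_iff_AE[OF integrable_jacobi_density_times_poly[OF assms(1,2)], of "q\<^sup>2"]
      jacobi_density_nonneg[OF assms(1,2)] by simp
  moreover have "AE x in lborel. x \<notin> {x. poly q x = 0}"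
    using poly_roots_finite[OF assms(3)] by (intro AE_not_in finite_imp_null_set_lborel)
  ultimately have "AE x in lborel. x \<notin> {-1<..<1::real}"
  proof eventually_elim
    case (elim x)
    then have "jacobi_density a b x = 0" by simp
    then show ?case using jacobi_normalization_pos[OF assms(1,2)]
      by (auto simp: jacobi_density_def)
  qed
  then have "emeasure lborel {-1<..<1::real} = 0"
    by (subst (asm) AE_iff_measurable[of "{-1<..<1}"]) auto
  then show False by simp
qed

lemma rodrigues_orthogonal:
  assumes "a > -1" "b > -1" "a + b > -1" "m \<noteq> n"
  shows "(\<integral>x. poly (rodrigues a b m) x * poly (rodrigues a b n) x \<partial>jacobi_measure1 a b) = 0"
proof -
  let ?l = "\<lambda>n. real n * (real n + a + b + 1)"
  let ?I = "\<integral>x. poly (rodrigues a b m) x * poly (rodrigues a b n) x \<partial>jacobi_measure1 a b"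
  have "- ?l n * ?I = - ?l m * ?I"
    using jacobi_op_symmetric[OF assms(1,2), of "rodrigues a b m" "rodrigues a b n"]
    by (simp add: rodrigues_eigen mult.left_commute mult.assoc mult.commute
          flip: integral_mult_right_zero)
  moreover have "?l m \<noteq> ?l n"
  proof -
    have "?l m - ?l n = (real m - real n) * (real m + real n + a + b + 1)" by (simp add: algebra_simps)
    moreover have "real m + real n + a + b + 1 > 0" using assms by linarith
    ultimately show ?thesis using assms(4) by auto
  qed
  ultimately show ?thesis by auto
qed

definition rodrigues_norm :: "real \<Rightarrow> real \<Rightarrow> nat \<Rightarrow> real" where
  "rodrigues_norm a b n = sqrt (\<integral>x. (poly (rodrigues a b n) x)\<^sup>2 \<partial>jacobi_measure1 a b)"

lemma rodrigues_norm_pos: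
  assumes "a > -1" "b > -1" "a + b > -1"
  shows "rodrigues_norm a b n > 0"
  using integral_square_pos[OF assms(1,2)] degree_rodrigues[of a b n] assms(3)
  by (simp add: rodrigues_norm_def)

lemma rodrigues_norm_square:
  "(rodrigues_norm a b n)\<^sup>2 = (\<integral>x. (poly (rodrigues a b n) x)\<^sup>2 \<partial>jacobi_measure1 a b)"
  by (simp add: rodrigues_norm_def)

lemma real_poly_eq_on_interval:
  assumes "\<And>x. x \<in> {-1<..<1} \<Longrightarrow> poly p x = poly (q :: real poly) x"
  shows "p = q"
proof (rule ccontr)
  assume "p \<noteq> q"
  then have "finite {x. poly (p - q) x = 0}" by (intro poly_roots_finite) simp
  moreover have "{-1<..<1} \<subseteq> {x. poly (p - q) x = 0}" using assms by auto
  ultimately have "finite {-1<..<1::real}" by (rule finite_subset[rotated])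
  then show False using infinite_Ioo[of "-1" "1::real"] by simp
qed

text \<open>
  Clearing the weight on the open interval turns the Rodrigues condition into proportionality to
  \<open>rodrigues a b n\<close>. Norm one fixes the modulus of the factor, and $c > 0$ fixes its sign to be
  the $(-1)^n$ of Rodrigues' formula, so the definite description is determined.
\<close>

lemma jacobi_poly_eq:
  assumes "a > -1" "b > -1" "a + b > -1"
  shows "jacobi_poly a b n = smult ((-1) ^ n / rodrigues_norm a b n) (rodrigues a b n)"
proof -
  define s :: real where "s = (-1) ^ n"
  define R N where "R = rodrigues a b n" and "N = rodrigues_norm a b n"
  define k :: real where "k = s / (2 ^ n * fact n)"
  have N: "N > 0" unfolding N_def by (rule rodrigues_norm_pos[OF assms(1-3)])
  have N2: "N\<^sup>2 = (\<integral>x. (poly R x)\<^sup>2 \<partial>jacobi_measure1 a b)"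
    unfolding N_def R_def by (rule rodrigues_norm_square)
  have s2: "s * s = 1" unfolding s_def by (simp flip: power_mult_distrib)
  define w where "w = (\<lambda>x::real. (1 - x) powr a * (1 + x) powr b)"
  have w: "w x > 0" if "x \<in> {-1<..<1}" for x using that by (simp add: w_def)
  have rod: "(-1) ^ n / (2 ^ n * fact n) *
        (deriv ^^ n) (\<lambda>z. (1 - z) powr (a + real n) * (1 + z) powr (b + real n)) x = k * (w x * poly R x)"
    if "x \<in> {-1<..<1}" for x
    unfolding rodrigues_formula[OF that] by (simp add: k_def w_def R_def s_def)
  have norm_smult: "(\<integral>x. (poly (smult c R) x)\<^sup>2 \<partial>jacobi_measure1 a b) = c\<^sup>2 * N\<^sup>2" for c
    unfolding N2 by (simp add: power_mult_distrib)
  have key: "(\<forall>x\<in>{-1<..<1}. w x * c * poly p x = k * (w x * poly R x)) \<longleftrightarrow> smult c p = smult k R" for c p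
  proof
    assume *: "\<forall>x\<in>{-1<..<1}. w x * c * poly p x = k * (w x * poly R x)"
    show "smult c p = smult k R"
    proof (rule real_poly_eq_on_interval)
      fix x :: real assume x: "x \<in> {-1<..<1}"
      then have "w x * (c * poly p x) = w x * (k * poly R x)" using * by (simp add: algebra_simps)
      then show "poly (smult c p) x = poly (smult k R) x" using w[OF x] by simp
    qed
  next
    assume "smult c p = smult k R"
    then have "c * poly p x = k * poly R x" for x by (metis poly_smult)
    then show "\<forall>x\<in>{-1<..<1}. w x * c * poly p x = k * (w x * poly R x)"
      by (simp add: algebra_simps)
  qed
  have eq: "(\<forall>x\<in>{-1<..<1}. (1 - x) powr a * (1 + x) powr b * c * poly p x =
        (-1) ^ n / (2 ^ n * fact n) *
        (deriv ^^ n) (\<lambda>z. (1 - z) powr (a + real n) * (1 + z) powr (b + real n)) x)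
      \<longleftrightarrow> smult c p = smult k R" for c p
    unfolding key[symmetric]
  proof (intro ball_cong refl)
    fix x :: real assume x: "x \<in> {-1<..<1}"
    show "((1 - x) powr a * (1 + x) powr b * c * poly p x = (-1) ^ n / (2 ^ n * fact n) *
        (deriv ^^ n) (\<lambda>z. (1 - z) powr (a + real n) * (1 + z) powr (b + real n)) x) =
        (w x * c * poly p x = k * (w x * poly R x))"
      unfolding rod[OF x] by (simp only: w_def)
  qed
  have "jacobi_poly a b n = (THE p. (\<exists>c>0. smult c p = smult k R) \<and>
      (\<integral>x. (poly p x)\<^sup>2 \<partial>jacobi_measure1 a b) = 1)"
    unfolding jacobi_poly_def eq by (rule refl)
  also have "\<dots> = smult (s / N) R"
  proof (rule the_equality, intro conjI exI)
    show "N / (2 ^ n * fact n) > 0" using N by simp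
    show "smult (N / (2 ^ n * fact n)) (smult (s / N) R) = smult k R"
      using N by (simp add: k_def)
    show "(\<integral>x. (poly (smult (s / N) R) x)\<^sup>2 \<partial>jacobi_measure1 a b) = 1"
      unfolding norm_smult using N s2 by (simp add: power_divide power2_eq_square)
  next
    fix p assume p: "(\<exists>c>0. smult c p = smult k R) \<and> (\<integral>x. (poly p x)\<^sup>2 \<partial>jacobi_measure1 a b) = 1"
    then obtain c where c: "c > 0" "smult c p = smult k R" by auto
    have pe: "p = smult (k / c) R"
      using arg_cong[OF c(2), of "smult (1 / c)"] c(1) by simp
    have "(k / c)\<^sup>2 * N\<^sup>2 = 1" using p pe norm_smult by metis
    moreover have "(k / c)\<^sup>2 = (1 / (2 ^ n * fact n * c))\<^sup>2"
      using s2 by (simp add: k_def power_divide power_mult_distrib power2_eq_square)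
    ultimately have "(1 / (2 ^ n * fact n * c) * N)\<^sup>2 = 1\<^sup>2"
      by (simp only: power_mult_distrib one_power2)
    then have "1 / (2 ^ n * fact n * c) * N = 1"
      using N c by (subst (asm) power2_eq_iff_nonneg) auto
    then have "k / c = s / N" using N c by (simp add: k_def field_simps)
    then show "p = smult (s / N) R" using pe by simp
  qed
  finally show ?thesis unfolding N_def R_def s_def .
qed

lemma degree_jacobi_poly:
  assumes "a > -1" "b > -1" "a + b > -1"
  shows "degree (jacobi_poly a b n) = n" "jacobi_poly a b n \<noteq> 0"
  using jacobi_poly_eq[OF assms] rodrigues_norm_pos[OF assms, of n] degree_rodrigues[of a b n] assms(3)
  by auto

lemma jacobi_poly_eigen:
  assumes "a > -1" "b > -1" "a + b > -1"
  shows "jacobi_op a b (jacobi_poly a b n) = smult (- (real n * (real n + a + b + 1))) (jacobi_poly a b n)"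
  using jacobi_poly_eq[OF assms] by (simp add: jacobi_op_smult rodrigues_eigen mult.commute)

lemma jacobi_poly_orthonormal:
  assumes "a > -1" "b > -1" "a + b > -1"
  shows "(\<integral>x. poly (jacobi_poly a b m) x * poly (jacobi_poly a b n) x \<partial>jacobi_measure1 a b)
     = (if m = n then 1 else 0)"
proof -
  let ?c = "\<lambda>k. (- 1) ^ k / rodrigues_norm a b k :: real"
  have "(\<integral>x. poly (jacobi_poly a b m) x * poly (jacobi_poly a b n) x \<partial>jacobi_measure1 a b)
     = (\<integral>x. (?c m * ?c n) * (poly (rodrigues a b m) x * poly (rodrigues a b n) x) \<partial>jacobi_measure1 a b)"
    unfolding jacobi_poly_eq[OF assms] by (simp add: mult_ac)
  also have "\<dots> = (?c m * ?c n) * (\<integral>x. poly (rodrigues a b m) x * poly (rodrigues a b n) x \<partial>jacobi_measure1 a b)"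
    by (rule integral_mult_right_zero)
  also have "\<dots> = (if m = n then 1 else 0)"
  proof (cases "m = n")
    case True
    have "((- 1) ^ n)\<^sup>2 = (1::real)" by (simp flip: power_mult)
    moreover have "(\<integral>x. poly (rodrigues a b n) x * poly (rodrigues a b n) x \<partial>jacobi_measure1 a b)
        = rodrigues_norm a b n * rodrigues_norm a b n"
      using rodrigues_norm_square[of a b n] by (simp only: power2_eq_square)
    ultimately show ?thesis
      using True rodrigues_norm_pos[OF assms, of n] by (simp add: power2_eq_square)
  qed (simp add: rodrigues_orthogonal[OF assms])
  finally show ?thesis .
qed

section \<open>Polynomial growth of the sup norm\<close>

text \<open>
  At distance between $\delta/2$ and $\delta$ from an endpoint, the factor of the weight that
  degenerates there is at least $(\delta/2)^k$, whatever the sign of its exponent; the other factor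
  has a base in $[1, 2]$ and an exponent above $-1/2$, so it is at least $1/2$.
\<close>

lemma jacobi_density_lower_bound:
  fixes \<delta> :: real
  assumes "a > -1/2" "b > -1/2" "a \<le> real k" "b \<le> real k" "0 < \<delta>" "\<delta> \<le> 1"
    and "\<delta> / 2 \<le> 1 - \<bar>x\<bar>" "1 - \<bar>x\<bar> \<le> \<delta>"
  shows "jacobi_density a b x \<ge> (\<delta> / 2) ^ k / (2 * (2 powr (a + b + 1) * Beta (a + 1) (b + 1)))"
proof -
  have one: "(\<delta> / 2) ^ k \<le> y powr c" if y: "\<delta> / 2 \<le> y" "y \<le> 1" and c: "c \<le> real k" for y c
  proof -
    have "(\<delta> / 2) ^ k \<le> y ^ k" using y assms(5) by (intro power_mono) auto
    also have "\<dots> = y powr real k" using y assms(5) by (simp add: powr_realpow)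
    also have "\<dots> \<le> y powr c" using y c assms(5) by (intro powr_mono') auto
    finally show ?thesis .
  qed
  have half: "1 / 2 \<le> y powr c" if y: "1 \<le> y" "y \<le> 2" and c: "c > -1/2" for y c :: real
  proof (cases "c \<ge> 0")
    case True
    then show ?thesis using y ge_one_powr_ge_zero[of y c] by simp
  next
    case False
    have "1 / 2 = 2 powr (-1 :: real)" by (simp add: powr_minus)
    also have "\<dots> \<le> 2 powr c" using c by (intro powr_mono) auto
    also have "\<dots> \<le> y powr c" using False y by (intro powr_mono2') auto
    finally show ?thesis .
  qed
  have main: "(\<delta> / 2) ^ k / 2 \<le> (1 - x) powr a * (1 + x) powr b"
  proof (cases "x \<ge> 0")
    case True
    have "(\<delta> / 2) ^ k * (1 / 2) \<le> (1 - x) powr a * (1 + x) powr b"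
      using True assms by (intro mult_mono one half) auto
    then show ?thesis by simp
  next
    case False
    have "(1 / 2) * (\<delta> / 2) ^ k \<le> (1 - x) powr a * (1 + x) powr b"
      using False assms by (intro mult_mono one half) auto
    then show ?thesis by simp
  qed
  have Z: "2 powr (a + b + 1) * Beta (a + 1) (b + 1) > 0"
    using assms by (intro jacobi_normalization_pos) auto
  have "x \<in> {-1..1}" using assms by auto
  then show ?thesis
    using divide_right_mono[OF main less_imp_le[OF Z]] unfolding jacobi_density_def
    by (simp add: field_simps)
qed

text \<open>
  The left-hand side is Sonin's function. By the differential equation its derivative is
  $2 y'^2 ((a-b) + (a+b+1)x)$, which changes sign at most once and then from negative to positive,
  so it is largest at an endpoint, where the term with $y'$ vanishes.
\<close>

lemma sonin_endpoint_bound: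
  fixes y :: "real poly"
  assumes ode: "jacobi_op a b y = smult (- l) y" and "l > 0" "\<bar>a - b\<bar> < a + b + 1"
    and x: "x \<in> {-1..1}"
  shows "l * (poly y x)\<^sup>2 + (1 - x\<^sup>2) * (poly (pderiv y) x)\<^sup>2
      \<le> l * (max \<bar>poly y 1\<bar> \<bar>poly y (-1)\<bar>)\<^sup>2"
proof -
  define F where "F = smult l (y\<^sup>2) + [:1, 0, -1:] * (pderiv y)\<^sup>2"
  have F: "poly F z = l * (poly y z)\<^sup>2 + (1 - z\<^sup>2) * (poly (pderiv y) z)\<^sup>2" for z
    by (simp add: F_def algebra_simps power2_eq_square)
  have F': "poly (pderiv F) z = 2 * (poly (pderiv y) z)\<^sup>2 * ((a - b) + (a + b + 1) * z)" for z
  proof -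
    have o: "(1 - z\<^sup>2) * poly (pderiv (pderiv y)) z + (b - a - (a + b + 2) * z) * poly (pderiv y) z = - l * poly y z"
      using arg_cong[OF ode, of "\<lambda>p. poly p z"] by (simp add: poly_jacobi_op)
    have "poly (pderiv F) z = 2 * poly (pderiv y) z *
        (l * poly y z + ((1 - z\<^sup>2) * poly (pderiv (pderiv y)) z) - z * poly (pderiv y) z)"
      by (simp add: F_def power2_eq_square pderiv_add pderiv_smult pderiv_mult pderiv_pCons pderiv_minus algebra_simps)
    also have "(1 - z\<^sup>2) * poly (pderiv (pderiv y)) z =
        - l * poly y z - (b - a - (a + b + 2) * z) * poly (pderiv y) z"
      using o by (simp add: algebra_simps)
    finally show ?thesis by (simp add: algebra_simps power2_eq_square)
  qed
  have pos: "a + b + 1 > 0" using assms(3) by linarith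
  have "poly F x \<le> max (poly F 1) (poly F (-1))"
  proof (cases "(a - b) + (a + b + 1) * x \<ge> 0")
    case True
    have "poly F x \<le> poly F 1"
    proof (rule DERIV_nonneg_imp_nondecreasing[where f = "poly F"])
      show "x \<le> 1" using x by simp
      fix t assume t: "x \<le> t" "t \<le> 1"
      have "(a - b) + (a + b + 1) * t \<ge> 0" using True t pos
        by (smt (verit) mult_left_mono)
      then show "\<exists>d. (poly F has_real_derivative d) (at t) \<and> 0 \<le> d"
        by (intro exI[of _ "poly (pderiv F) t"] conjI poly_DERIV) (simp add: F')
    qed
    then show ?thesis by simp
  next
    case False
    have "poly F (-1) \<ge> poly F x"
    proof (rule DERIV_nonpos_imp_nonincreasing[where f = "poly F"])
      show "-1 \<le> x" using x by simp
      fix t assume t: "-1 \<le> t" "t \<le> x"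
      have "(a - b) + (a + b + 1) * t \<le> 0" using False t pos
        by (smt (verit) mult_left_mono)
      then show "\<exists>d. (poly F has_real_derivative d) (at t) \<and> d \<le> 0"
        by (intro exI[of _ "poly (pderiv F) t"] conjI poly_DERIV) (simp add: F' mult_nonneg_nonpos)
    qed
    then show ?thesis by simp
  qed
  also have "\<dots> \<le> l * (max \<bar>poly y 1\<bar> \<bar>poly y (-1)\<bar>)\<^sup>2"
  proof (rule max.boundedI)
    show "poly F 1 \<le> l * (max \<bar>poly y 1\<bar> \<bar>poly y (-1)\<bar>)\<^sup>2"
      using power_mono[of "\<bar>poly y 1\<bar>" "max \<bar>poly y 1\<bar> \<bar>poly y (-1)\<bar>" 2] assms(2) by (simp add: F)
    show "poly F (-1) \<le> l * (max \<bar>poly y 1\<bar> \<bar>poly y (-1)\<bar>)\<^sup>2"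
      using power_mono[of "\<bar>poly y (-1)\<bar>" "max \<bar>poly y 1\<bar> \<bar>poly y (-1)\<bar>" 2] assms(2) by (simp add: F)
  qed
  finally show ?thesis by (simp add: F)
qed

text \<open>
  The parametrization $x = e(1-s^2)$ removes the singularity of the bound for $y'$ at the endpoint:
  since $1-x^2 \ge s^2$, the derivative in \<open>s\<close> is at most $2 \sqrt l\, M$. So \<open>y\<close> keeps half of
  its endpoint value for $s \le 1/(4\sqrt l)$.
\<close>

lemma large_near_maximal_endpoint:
  fixes y :: "real poly"
  assumes l: "l > 0" and e: "\<bar>e\<bar> = 1" and M: "M = \<bar>poly y e\<bar>"
    and F: "\<And>x. x \<in> {-1..1} \<Longrightarrow> l * (poly y x)\<^sup>2 + (1 - x\<^sup>2) * (poly (pderiv y) x)\<^sup>2 \<le> l * M\<^sup>2"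
    and s: "0 \<le> s" "s \<le> 1" "4 * sqrt l * s \<le> 1"
  shows "M / 2 \<le> \<bar>poly y (e * (1 - s\<^sup>2))\<bar>"
proof -
  define h where "h = (\<lambda>s. poly y (e * (1 - s\<^sup>2)))"
  have e2: "e\<^sup>2 = 1" using e by (metis one_power2 power2_abs)
  have M0: "M \<ge> 0" using M by simp
  have der: "(h has_field_derivative - 2 * e * (t * poly (pderiv y) (e * (1 - t\<^sup>2)))) (at t within {0..1})" for t
    unfolding h_def
    by (rule DERIV_subset, rule DERIV_cong, rule DERIV_chain2[OF poly_DERIV])
       (auto intro!: derivative_eq_intros)
  have ubound: "norm (- 2 * e * (t * poly (pderiv y) (e * (1 - t\<^sup>2)))) \<le> 2 * sqrt l * M" if t: "t \<in> {0..1}" for t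
  proof -
    let ?x = "e * (1 - t\<^sup>2)" and ?d = "poly (pderiv y) (e * (1 - t\<^sup>2))"
    have t2: "0 \<le> t\<^sup>2" "t\<^sup>2 \<le> 1" using t by (auto simp: power_le_one)
    have "\<bar>?x\<bar> \<le> 1" using t2 e by (simp add: abs_mult)
    then have x: "?x \<in> {-1..1}" by (simp add: abs_le_iff)
    have "?x\<^sup>2 = (1 - t\<^sup>2)\<^sup>2" using e2 by (simp add: power_mult_distrib)
    then have "1 - ?x\<^sup>2 = t\<^sup>2 * (2 - t\<^sup>2)" by (simp add: power2_eq_square algebra_simps)
    also have "\<dots> \<ge> t\<^sup>2" using mult_left_mono[of 1 "2 - t\<^sup>2" "t\<^sup>2"] t2 by simp
    finally have "t\<^sup>2 * ?d\<^sup>2 \<le> (1 - ?x\<^sup>2) * ?d\<^sup>2" by (intro mult_right_mono) auto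
    also have "\<dots> \<le> l * M\<^sup>2" using F[OF x] l mult_nonneg_nonneg[OF less_imp_le[OF l] zero_le_power2[of "poly y ?x"]] by linarith
    finally have "(t * ?d)\<^sup>2 \<le> (sqrt l * M)\<^sup>2" using l by (simp add: power_mult_distrib)
    then have "\<bar>t * ?d\<bar> \<le> sqrt l * M" using M0 l by (simp add: abs_le_square_iff[symmetric] abs_mult)
    moreover have "\<bar>- 2 * e * (t * ?d)\<bar> = 2 * \<bar>t * ?d\<bar>" using e by (simp add: abs_mult)
    ultimately show ?thesis by simp
  qed
  have "norm (h s - h 0) \<le> 2 * sqrt l * M * norm (s - 0)"
    using s by (intro field_differentiable_bound[OF _ der ubound]) auto
  then have "\<bar>h s - h 0\<bar> \<le> (4 * sqrt l * s) * (M / 2)" using s by (simp add: mult_ac)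
  also have "\<dots> \<le> 1 * (M / 2)" using s M0 by (intro mult_right_mono) auto
  finally have "\<bar>h s - h 0\<bar> \<le> M / 2" by simp
  moreover have "\<bar>h 0\<bar> = M" by (simp add: h_def M)
  ultimately have "M / 2 \<le> \<bar>h s\<bar>" by linarith
  then show ?thesis by (simp add: h_def)
qed

text \<open>
  Normalization turns largeness near an endpoint into an upper bound for the endpoint value: the
  points where $|y| \ge M/2$ include an interval of length of order $1/l$ that carries at least a
  fixed power of $1/l$ of the mass, while $y^2$ integrates to one.
\<close>

lemma jacobi_poly_endpoint_bound:
  assumes ab: "a > -1/2" "b > -1/2" "a \<le> real k" "b \<le> real k" and n: "n \<ge> 1"
  defines "l \<equiv> real n * (real n + a + b + 1)"
    and "M \<equiv> max \<bar>poly (jacobi_poly a b n) 1\<bar> \<bar>poly (jacobi_poly a b n) (-1)\<bar>"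
  shows "x \<in> {-1..1} \<Longrightarrow> \<bar>poly (jacobi_poly a b n) x\<bar> \<le> M"
    and "M\<^sup>2 \<le> 8 * (2 powr (a + b + 1) * Beta (a + 1) (b + 1)) * (32 * l) ^ Suc k"
proof -
  let ?y = "jacobi_poly a b n"
  have ab': "a > -1" "b > -1" "a + b > -1" using ab by auto
  have "1 * 1 \<le> l" unfolding l_def using ab n by (intro mult_mono) auto
  then have l: "l \<ge> 1" by simp
  have F: "l * (poly ?y x)\<^sup>2 + (1 - x\<^sup>2) * (poly (pderiv ?y) x)\<^sup>2 \<le> l * M\<^sup>2" if "x \<in> {-1..1}" for x
    unfolding M_def using that l ab
    by (intro sonin_endpoint_bound[OF jacobi_poly_eigen[OF ab', of n, folded l_def]]) auto
  show "\<bar>poly ?y x\<bar> \<le> M" if x: "x \<in> {-1..1}" for x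
  proof -
    have x2: "0 \<le> 1 - x\<^sup>2" using x by (auto simp: abs_square_le_1)
    have "l * (poly ?y x)\<^sup>2 \<le> l * M\<^sup>2"
      using F[OF x] mult_nonneg_nonneg[OF x2 zero_le_power2[of "poly (pderiv ?y) x"]] by linarith
    then have "(poly ?y x)\<^sup>2 \<le> M\<^sup>2" using l by simp
    moreover have "M \<ge> 0" unfolding M_def by (simp add: max_def)
    ultimately show ?thesis by (simp add: abs_le_square_iff[symmetric])
  qed
  define Z where "Z = 2 powr (a + b + 1) * Beta (a + 1) (b + 1)"
  have Z: "Z > 0" unfolding Z_def by (rule jacobi_normalization_pos[OF ab'(1,2)])
  \<comment> \<open>so that $s = \sqrt{1-|x|} \le \sqrt\delta$ satisfies $4 \sqrt l\, s \le 1$\<close>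
  define \<delta> where "\<delta> = 1 / (16 * l)"
  have d: "0 < \<delta>" "\<delta> \<le> 1" using l by (auto simp: \<delta>_def field_simps)
  define e :: real where "e = (if \<bar>poly ?y 1\<bar> = M then 1 else -1)"
  have e: "\<bar>e\<bar> = 1" "M = \<bar>poly ?y e\<bar>" by (auto simp: e_def M_def max_def split: if_splits)
  have M0: "M \<ge> 0" using e by simp
  define J where "J = (if e = 1 then {1 - \<delta> .. 1 - \<delta> / 2} else {- (1 - \<delta> / 2) .. - (1 - \<delta>)})"
  have J: "J \<in> sets lborel" "emeasure lborel J = ennreal (\<delta> / 2)"
    using d by (auto simp: J_def)
  have Jint: "integrable lborel (\<lambda>x. indicator J x * c :: real)" for c
    using J by (intro integrable_mult_left integrable_real_indicator) auto
  have Jmeas: "(\<integral>x. indicator J x * c \<partial>lborel) = \<delta> / 2 * c" for c :: real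
    using J d by (simp add: measure_def)
  have pt: "indicator J x * ((\<delta> / 2) ^ k / (2 * Z) * (M / 2)\<^sup>2) \<le> jacobi_density a b x * poly (?y * ?y) x" for x
  proof (cases "x \<in> J")
    case True
    have ex: "e * x = \<bar>x\<bar>" "\<delta> / 2 \<le> 1 - \<bar>x\<bar>" "1 - \<bar>x\<bar> \<le> \<delta>"
      using True d e(1) by (auto simp: J_def e_def split: if_splits)
    define s where "s = sqrt (1 - \<bar>x\<bar>)"
    have s2: "s\<^sup>2 = 1 - \<bar>x\<bar>" using ex d by (simp add: s_def)
    have xe: "x = e * (1 - s\<^sup>2)" using ex(1) e(1) unfolding s2 by (auto simp: abs_if split: if_splits)
    have "s \<le> sqrt \<delta>" using ex by (simp add: s_def)
    also have "sqrt \<delta> = 1 / (4 * sqrt l)" by (simp add: \<delta>_def real_sqrt_divide real_sqrt_mult)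
    finally have "4 * sqrt l * s \<le> 1" using l by (simp add: field_simps)
    moreover have "s \<ge> 0" "s \<le> 1" using ex d by (auto simp: s_def)
    ultimately have "M / 2 \<le> \<bar>poly ?y x\<bar>"
      unfolding xe using large_near_maximal_endpoint[OF _ e F] l by auto
    then have "(M / 2)\<^sup>2 \<le> poly (?y * ?y) x"
      using power_mono[of "M / 2" "\<bar>poly ?y x\<bar>" 2] M0 by (simp add: power2_eq_square)
    then have "(\<delta> / 2) ^ k / (2 * Z) * (M / 2)\<^sup>2 \<le> jacobi_density a b x * poly (?y * ?y) x"
      using jacobi_density_lower_bound[OF ab d ex(2,3), folded Z_def] d Z
        jacobi_density_nonneg[OF ab'(1,2)] by (intro mult_mono) auto
    then show ?thesis using True by simp
  qed (simp add: jacobi_density_nonneg[OF ab'(1,2)])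
  have "\<delta> / 2 * ((\<delta> / 2) ^ k / (2 * Z) * (M / 2)\<^sup>2) \<le> (\<integral>x. jacobi_density a b x * poly (?y * ?y) x \<partial>lborel)"
    unfolding Jmeas[symmetric]
    by (intro integral_mono Jint integrable_jacobi_density_times_poly ab' pt)
  also have "\<dots> = 1"
    using jacobi_poly_orthonormal[OF ab', of n n] ab' by (simp add: integral_jacobi_measure1)
  finally have "(\<delta> / 2) ^ Suc k * M\<^sup>2 \<le> 8 * Z" using Z by (simp add: field_simps power2_eq_square)
  moreover have "(\<delta> / 2) ^ Suc k = 1 / (32 * l) ^ Suc k"
    unfolding \<delta>_def by (simp add: power_divide power_mult_distrib)
  ultimately have "1 / (32 * l) ^ Suc k * M\<^sup>2 \<le> 8 * Z" by (simp only:)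
  moreover have "(32 * l) ^ Suc k > 0" using l by (intro zero_less_power) auto
  ultimately show "M\<^sup>2 \<le> 8 * (2 powr (a + b + 1) * Beta (a + 1) (b + 1)) * (32 * l) ^ Suc k"
    unfolding Z_def[symmetric] by (simp only: divide_le_eq mult_1_left times_divide_eq_left if_True)
qed

text \<open>
  The eigenvalue grows quadratically in \<open>n\<close>, so the endpoint bound is polynomial in \<open>n\<close>. Degree 0,
  where the eigenvalue vanishes and Sonin's argument is empty, is a single constant.
\<close>

lemma jacobi_poly_sup_bound:
  assumes ab: "a > -1/2" "b > -1/2"
  shows "\<exists>K>0. \<exists>m. \<forall>n. \<forall>x\<in>{-1..1}. \<bar>poly (jacobi_poly a b n) x\<bar> \<le> K * (real n + 1) ^ m"
proof -
  obtain k :: nat where k: "a \<le> real k" "b \<le> real k"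
    using real_arch_simple[of "max a b"] by auto
  have ab': "a > -1" "b > -1" "a + b > -1" using ab by auto
  define Z where "Z = 2 powr (a + b + 1) * Beta (a + 1) (b + 1)"
  have Z: "Z > 0" unfolding Z_def by (rule jacobi_normalization_pos[OF ab'(1,2)])
  \<comment> \<open>the squared endpoint bound without its power of \<open>n + 1\<close>; the eigenvalue is at most $(a+b+2)(n+1)^2$\<close>
  define K2 where "K2 = 8 * Z * (32 * (a + b + 2)) ^ Suc k"
  have K2: "K2 > 0" using Z ab by (simp add: K2_def)
  define K where "K = max (sqrt K2) \<bar>poly (jacobi_poly a b 0) 0\<bar>"
  have K: "K > 0" "K \<ge> sqrt K2" "K \<ge> \<bar>poly (jacobi_poly a b 0) 0\<bar>" using K2 by (auto simp: K_def less_max_iff_disj)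
  have "\<bar>poly (jacobi_poly a b n) x\<bar> \<le> K * (real n + 1) ^ Suc k" if x: "x \<in> {-1..1}" for n x
  proof (cases "n = 0")
    case True
    have "degree (jacobi_poly a b 0) = 0" by (rule degree_jacobi_poly[OF ab'])
    then obtain c where "jacobi_poly a b 0 = [:c:]" by (rule degree_eq_zeroE)
    then show ?thesis using True K by simp
  next
    case False
    define l where "l = real n * (real n + a + b + 1)"
    define M where "M = max \<bar>poly (jacobi_poly a b n) 1\<bar> \<bar>poly (jacobi_poly a b n) (-1)\<bar>"
    have n: "n \<ge> 1" using False by simp
    have "l \<le> (real n + 1) * ((real n + 1) * (a + b + 2))"
      unfolding l_def
    proof (intro mult_mono)
      have "real n * (a + b + 1) \<ge> 0" using ab by simp
      then show "real n + a + b + 1 \<le> (real n + 1) * (a + b + 2)" using ab by (simp add: algebra_simps)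
    qed (use ab in auto)
    then have l: "l \<le> (a + b + 2) * (real n + 1)\<^sup>2" by (simp add: power2_eq_square algebra_simps)
    have l0: "l \<ge> 0" using ab by (simp add: l_def)
    have "M\<^sup>2 \<le> 8 * Z * (32 * l) ^ Suc k"
      unfolding M_def Z_def l_def by (rule jacobi_poly_endpoint_bound(2)[OF ab k n])
    also have "\<dots> \<le> 8 * Z * (32 * ((a + b + 2) * (real n + 1)\<^sup>2)) ^ Suc k"
      using l l0 Z by (intro mult_left_mono power_mono) auto
    also have "\<dots> = (sqrt K2 * (real n + 1) ^ Suc k)\<^sup>2"
    proof -
      have "8 * Z * (32 * ((a + b + 2) * (real n + 1)\<^sup>2)) ^ Suc k = K2 * ((real n + 1)\<^sup>2) ^ Suc k"
        unfolding K2_def by (simp only: mult.assoc power_mult_distrib)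
      also have "\<dots> = (sqrt K2)\<^sup>2 * ((real n + 1) ^ Suc k)\<^sup>2"
        using K2 by (simp only: real_sqrt_pow2[OF less_imp_le] power_mult[symmetric] mult.commute)
      finally show ?thesis by (simp only: power_mult_distrib)
    qed
    finally have "M \<le> sqrt K2 * (real n + 1) ^ Suc k"
      by (rule power2_le_imp_le) (use K2 in auto)
    also have "\<dots> \<le> K * (real n + 1) ^ Suc k" using K by (intro mult_right_mono) auto
    finally show ?thesis
      using jacobi_poly_endpoint_bound(1)[OF ab k n x] unfolding M_def by linarith
  qed
  then show ?thesis using K(1) by blast
qed

section \<open>Growth off the interval\<close>

text \<open>
  Differentiating is the other direction of the ladder. The equations for all derivatives are
  wanted at 1, where the second-order term drops out and a recursion for the Taylor coefficients
  is left.
\<close>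

lemma jacobi_poly_higher_derivative_eigen:
  assumes "a > -1" "b > -1" "a + b > -1"
  shows "jacobi_op (a + real k) (b + real k) ((pderiv ^^ k) (jacobi_poly a b n)) =
     smult (- (real n * (real n + a + b + 1) - real k * (real k + a + b + 1))) ((pderiv ^^ k) (jacobi_poly a b n))"
proof (induction k)
  case 0
  show ?case using jacobi_poly_eigen[OF assms] by simp
next
  case (Suc k)
  let ?z = "(pderiv ^^ k) (jacobi_poly a b n)" and ?A = "a + real k + 1" and ?B = "b + real k + 1"
  have "jacobi_op (a + real (Suc k)) (b + real (Suc k)) (pderiv ?z) =
      pderiv (jacobi_op (a + real k) (b + real k) ?z) + smult (?A + ?B) (pderiv ?z)"
  proof -
    have "pderiv (jacobi_op (a + real k) (b + real k) ?z) =
        raise_op (?A + 1) (?B + 1) (pderiv (pderiv ?z)) + smult (- (?A + ?B)) (pderiv ?z)"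
      unfolding jacobi_op_def by (rule pderiv_raise_op)
    moreover have "jacobi_op (a + real (Suc k)) (b + real (Suc k)) (pderiv ?z) =
        raise_op (?A + 1) (?B + 1) (pderiv (pderiv ?z))"
      by (simp add: jacobi_op_def add_ac)
    moreover have "smult (- (?A + ?B)) (pderiv ?z) + smult (?A + ?B) (pderiv ?z) = 0"
      by (simp flip: smult_add_left)
    ultimately show ?thesis by (simp only: add.assoc add_0_right)
  qed
  also have "\<dots> = smult (- (real n * (real n + a + b + 1) - real (Suc k) * (real (Suc k) + a + b + 1))) (pderiv ?z)"
    unfolding Suc.IH pderiv_smult smult_add_left[symmetric] by (simp add: algebra_simps)
  finally show ?case by simp
qed

text \<open>
  At 1 the differential equation expresses each derivative through the preceding one. The quotient
  is at most $l/(k+1)$, because $2(a+k+1) \ge k+1$, and it is 0 for $k = n$.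
\<close>

lemma jacobi_poly_derivatives_at_one:
  fixes n :: nat
  assumes "a > -1/2" "b > -1/2"
  defines "l \<equiv> real n * (real n + a + b + 1)"
  shows "\<bar>poly ((pderiv ^^ k) (jacobi_poly a b n)) 1\<bar> \<le> l ^ k / fact k * \<bar>poly (jacobi_poly a b n) 1\<bar>"
    and "k > n \<Longrightarrow> poly ((pderiv ^^ k) (jacobi_poly a b n)) 1 = 0"
proof -
  let ?y = "\<lambda>k. poly ((pderiv ^^ k) (jacobi_poly a b n)) 1"
  have ab: "a > -1" "b > -1" "a + b > -1" using assms by auto
  have rec: "2 * (a + real k + 1) * ?y (Suc k) = (l - real k * (real k + a + b + 1)) * ?y k" for k
    using arg_cong[OF jacobi_poly_higher_derivative_eigen[OF ab, of k n], of "\<lambda>p. poly p 1"]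
    by (simp add: poly_jacobi_op l_def algebra_simps)
  have dpos: "real k + 1 \<le> 2 * (a + real k + 1)" for k using assms(1) by simp
  have van: "?y k = 0" if "k > n" for k
    using that
  proof (induction k)
    case (Suc k)
    have "(l - real k * (real k + a + b + 1)) * ?y k = 0"
      using Suc by (cases "k = n") (auto simp: l_def)
    then have "2 * (a + real k + 1) * ?y (Suc k) = 0" using rec by simp
    then show ?case using dpos[of k] by (simp only: mult_eq_0_iff) auto
  qed simp
  then show "k > n \<Longrightarrow> ?y k = 0" .
  have l0: "l \<ge> 0" using ab by (simp add: l_def)
  show "\<bar>?y k\<bar> \<le> l ^ k / fact k * \<bar>poly (jacobi_poly a b n) 1\<bar>"
  proof (induction k)
    case (Suc k)
    show ?case
    proof (cases "k \<le> n")
      case True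
      have "real k * (real k + a + b + 1) \<le> l"
        unfolding l_def using True ab by (intro mult_mono) auto
      moreover have "real k * (real k + a + b + 1) \<ge> 0" using ab by (cases k) auto
      ultimately have le: "\<bar>l - real k * (real k + a + b + 1)\<bar> \<le> l" by simp
      have "(real k + 1) * \<bar>?y (Suc k)\<bar> \<le> (2 * (a + real k + 1)) * \<bar>?y (Suc k)\<bar>"
        using dpos[of k] by (intro mult_right_mono) auto
      also have "\<dots> = \<bar>2 * (a + real k + 1) * ?y (Suc k)\<bar>"
        using dpos[of k] by (simp add: abs_mult)
      also have "\<dots> \<le> l * (l ^ k / fact k * \<bar>poly (jacobi_poly a b n) 1\<bar>)"
        unfolding rec abs_mult using le l0 Suc.IH by (intro mult_mono) auto
      finally have "\<bar>?y (Suc k)\<bar> \<le> l * (l ^ k / fact k * \<bar>poly (jacobi_poly a b n) 1\<bar>) / (real k + 1)"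
        by (intro mult_imp_le_div_pos) (simp, simp only: mult.commute)
      also have "\<dots> = l ^ Suc k / fact (Suc k) * \<bar>poly (jacobi_poly a b n) 1\<bar>"
        by (simp add: field_simps)
      finally show ?thesis .
    next
      case False
      then have "?y (Suc k) = 0" by (intro van) simp
      then show ?thesis using l0 by simp
    qed
  qed simp
qed

lemma higher_pderiv_vanishes: "degree (p :: real poly) < k \<Longrightarrow> (pderiv ^^ k) p = 0"
  by (rule poly_eqI) (simp add: coeff_higher_pderiv coeff_eq_0)

lemma poly_taylor_at_one:
  fixes p :: "real poly"
  shows "poly p (1 + h) = (\<Sum>k\<le>degree p. poly ((pderiv ^^ k) p) 1 / fact k * h ^ k)"
proof -
  let ?d = "\<lambda>k h. poly ((pderiv ^^ k) p) (1 + h)"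
  have "DERIV (?d k) x :> ?d (Suc k) x" for k x
    using DERIV_chain2[OF poly_DERIV[of "(pderiv ^^ k) p"], of "\<lambda>h. 1 + h" x 1 UNIV]
    by (auto intro!: derivative_eq_intros)
  then obtain t where "?d 0 h = (\<Sum>m<Suc (degree p). ?d m 0 / fact m * h ^ m) + ?d (Suc (degree p)) t / fact (Suc (degree p)) * h ^ Suc (degree p)"
    using Maclaurin_all_le[of ?d "?d 0" h "Suc (degree p)"] by blast
  then show ?thesis
    using higher_pderiv_vanishes[of p "Suc (degree p)"] by (simp add: lessThan_Suc_atMost)
qed

text \<open>
  The Taylor terms at 1 are bounded by $(z^k/k!)^2$ with $z^2 = l\,|x-1|$, and a sum of squares of
  nonnegative numbers is at most the square of their sum, here a partial sum of $e^z$. Thus the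
  growth in \<open>n\<close> at a fixed point is at most exponential and is beaten by $e^{-ls}$ for every
  $s > 0$.
\<close>

lemma jacobi_poly_growth:
  assumes "a > -1/2" "b > -1/2"
  shows "\<bar>poly (jacobi_poly a b n) x\<bar> \<le>
     \<bar>poly (jacobi_poly a b n) 1\<bar> * exp (2 * sqrt (real n * (real n + a + b + 1) * \<bar>x - 1\<bar>))"
proof -
  define l where "l = real n * (real n + a + b + 1)"
  define z where "z = sqrt (l * \<bar>x - 1\<bar>)"
  have l0: "l \<ge> 0" using assms by (simp add: l_def)
  have z0: "z \<ge> 0" and z2: "z\<^sup>2 = l * \<bar>x - 1\<bar>" using l0 by (auto simp: z_def)
  have ab: "a > -1" "b > -1" "a + b > -1" using assms by auto
  let ?y = "\<lambda>k. poly ((pderiv ^^ k) (jacobi_poly a b n)) 1" and ?y1 = "\<bar>poly (jacobi_poly a b n) 1\<bar>"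
  have "poly (jacobi_poly a b n) x = (\<Sum>k\<le>n. ?y k / fact k * (x - 1) ^ k)"
    using poly_taylor_at_one[of "jacobi_poly a b n" "x - 1"] degree_jacobi_poly[OF ab] by simp
  also have "\<bar>\<dots>\<bar> \<le> (\<Sum>k\<le>n. \<bar>?y k / fact k * (x - 1) ^ k\<bar>)" by (rule sum_abs)
  also have "\<dots> \<le> (\<Sum>k\<le>n. ?y1 * (z ^ k / fact k)\<^sup>2)"
  proof (rule sum_mono)
    fix k
    have "\<bar>?y k / fact k * (x - 1) ^ k\<bar> = \<bar>?y k\<bar> * (\<bar>x - 1\<bar> ^ k / fact k)"
      by (simp add: abs_mult power_abs)
    also have "\<dots> \<le> (l ^ k / fact k * ?y1) * (\<bar>x - 1\<bar> ^ k / fact k)"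
      unfolding l_def by (intro mult_right_mono jacobi_poly_derivatives_at_one(1) assms) simp
    also have "\<dots> = ?y1 * ((z\<^sup>2) ^ k / (fact k * fact k))"
      unfolding z2 by (simp add: power_mult_distrib)
    also have "\<dots> = ?y1 * (z ^ k / fact k)\<^sup>2"
      by (simp add: power_divide power2_eq_square power_mult_distrib)
    finally show "\<bar>?y k / fact k * (x - 1) ^ k\<bar> \<le> ?y1 * (z ^ k / fact k)\<^sup>2" .
  qed
  also have "\<dots> \<le> ?y1 * (\<Sum>k\<le>n. z ^ k / fact k)\<^sup>2"
  proof -
    have "(\<Sum>k\<le>m. (z ^ k / fact k)\<^sup>2) \<le> (\<Sum>k\<le>m. z ^ k / fact k)\<^sup>2" for m
    proof (induction m)
      case (Suc m)
      have "0 \<le> (\<Sum>k\<le>m. z ^ k / fact k) * (z ^ Suc m / fact (Suc m))"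
        using z0 by (intro mult_nonneg_nonneg sum_nonneg) auto
      then show ?case using Suc unfolding sum.atMost_Suc power2_sum by linarith
    qed simp
    then show ?thesis unfolding sum_distrib_left[symmetric] by (intro mult_left_mono) auto
  qed
  also have "\<dots> \<le> ?y1 * (exp z)\<^sup>2"
  proof -
    have "(\<Sum>k\<le>n. z ^ k / fact k) \<le> (\<Sum>k. z ^ k / fact k)"
      using z0 summable_exp[of z] by (intro sum_le_suminf) (auto simp: field_simps inverse_eq_divide)
    also have "\<dots> = exp z" by (simp add: exp_def inverse_eq_divide field_simps)
    finally show ?thesis using z0 by (intro mult_left_mono power_mono sum_nonneg) auto
  qed
  also have "(exp z)\<^sup>2 = exp (2 * z)" by (simp add: exp_double)
  finally show ?thesis unfolding z_def l_def .
qed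

text \<open>
  At an interior minimum the first derivative vanishes and the second one is nonnegative. At the
  endpoints the second-order coefficient vanishes, and the first-order coefficient, $-2(a+1)$ at 1
  and $2(b+1)$ at $-1$, has the same sign as the derivative at a boundary minimum.
\<close>

lemma jacobi_op_at_minimum:
  assumes a: "a > -1" "b > -1" and r: "r \<in> {-1..1}"
    and min: "\<And>s. s \<in> {-1..1} \<Longrightarrow> poly q r \<le> poly q s"
  shows "poly (jacobi_op a b q) r \<ge> 0"
proof -
  have right: "poly (pderiv q) r \<ge> 0" if "r < 1"
  proof (rule ccontr)
    assume "\<not> ?thesis"
    then obtain d where d: "d > 0" "\<And>h. h > 0 \<Longrightarrow> h < d \<Longrightarrow> poly q (r + h) < poly q r"
      using DERIV_neg_dec_right[OF poly_DERIV, of q r] by auto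
    define h where "h = min (d / 2) (1 - r)"
    have "h > 0" "h < d" "r + h \<in> {-1..1}" using d that r by (auto simp: h_def min_def)
    then show False using d(2)[of h] min[of "r + h"] by auto
  qed
  have left: "poly (pderiv q) r \<le> 0" if "r > -1"
  proof (rule ccontr)
    assume "\<not> ?thesis"
    then obtain d where d: "d > 0" "\<And>h. h > 0 \<Longrightarrow> h < d \<Longrightarrow> poly q (r - h) < poly q r"
      using DERIV_pos_inc_left[OF poly_DERIV, of q r] by auto
    define h where "h = min (d / 2) (r + 1)"
    have "h > 0" "h < d" "r - h \<in> {-1..1}" using d that r by (auto simp: h_def min_def)
    then show False using d(2)[of h] min[of "r - h"] by auto
  qed
  consider "r = 1" | "r = -1" | "-1 < r" "r < 1" using r by fastforce
  then show ?thesis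
  proof cases
    case 1
    have "- 2 * (a + 1) * poly (pderiv q) 1 \<ge> 0" using left a 1 by (intro mult_nonpos_nonpos) auto
    also have "- 2 * (a + 1) * poly (pderiv q) 1 = poly (jacobi_op a b q) 1"
      by (simp add: poly_jacobi_op algebra_simps)
    finally show ?thesis unfolding 1 .
  next
    case 2
    have "2 * (b + 1) * poly (pderiv q) (-1) \<ge> 0" using right a 2 by (intro mult_nonneg_nonneg) auto
    also have "2 * (b + 1) * poly (pderiv q) (-1) = poly (jacobi_op a b q) (-1)"
      by (simp add: poly_jacobi_op algebra_simps)
    finally show ?thesis unfolding 2 .
  next
    case 3
    then have z: "poly (pderiv q) r = 0" using left right by auto
    have "poly (pderiv (pderiv q)) r \<ge> 0"
    proof (rule ccontr)
      assume "\<not> ?thesis"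
      then obtain d where d: "d > 0" "\<And>h. h > 0 \<Longrightarrow> h < d \<Longrightarrow> poly (pderiv q) (r + h) < poly (pderiv q) r"
        using DERIV_neg_dec_right[OF poly_DERIV, of "pderiv q" r] by auto
      define h where "h = min (d / 2) (1 - r)"
      have h: "h > 0" "h < d" "r + h \<in> {-1..1}" using d 3 by (auto simp: h_def min_def)
      obtain z' where z': "r < z'" "z' < r + h" "poly q (r + h) - poly q r = (r + h - r) * poly (pderiv q) z'"
        using MVT2[of r "r + h" "poly q" "poly (pderiv q)"] poly_DERIV h(1) by auto
      have "poly (pderiv q) (r + (z' - r)) < poly (pderiv q) r" using z' h by (intro d(2)) auto
      then have "h * poly (pderiv q) z' < 0" using z h(1) by (intro mult_pos_neg) auto
      then show False using z'(3) min[OF h(3)] by simp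
    qed
    moreover have "1 - r\<^sup>2 \<ge> 0" using r by (auto simp: abs_square_le_1)
    ultimately show ?thesis using z by (simp add: poly_jacobi_op)
  qed
qed

section \<open>Integrals over the half-line\<close>

lemma halfline_FTC:
  fixes f F :: "real \<Rightarrow> real"
  assumes F: "\<And>x. x > 0 \<Longrightarrow> (F has_real_derivative f x) (at x)"
    and f: "\<And>x. x > 0 \<Longrightarrow> isCont f x"
    and A: "(F \<longlongrightarrow> A) (at_right 0)" and B: "(F \<longlongrightarrow> B) at_top"
  shows halfline_FTC_nonneg_integrable: "(\<And>x. x > 0 \<Longrightarrow> f x \<ge> 0) \<Longrightarrow> set_integrable lborel {0<..} f"
    and halfline_FTC_nonneg: "(\<And>x. x > 0 \<Longrightarrow> f x \<ge> 0) \<Longrightarrow> (LBINT x:{0<..}. f x) = B - A"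
    and halfline_FTC_integrable: "set_integrable lborel {0<..} f \<Longrightarrow> (LBINT x:{0<..}. f x) = B - A"
proof -
  have A': "((F \<circ> real_of_ereal) \<longlongrightarrow> A) (at_right 0)"
    using A unfolding zero_ereal_def ereal_tendsto_simps .
  have B': "((F \<circ> real_of_ereal) \<longlongrightarrow> B) (at_left \<infinity>)"
    using B unfolding ereal_tendsto_simps .
  have ei: "einterval 0 \<infinity> = {0<..}" by (simp add: zero_ereal_def)
  have eq: "(LBINT x=0..\<infinity>. f x) = (LBINT x:{0<..}. f x)"
    by (simp add: interval_lebesgue_integral_def ei)
  have F': "(F has_real_derivative f x) (at x)" if "0 < ereal x" "ereal x < \<infinity>" for x
    using that F by simp
  have f': "isCont f x" if "0 < ereal x" "ereal x < \<infinity>" for x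
    using that f by simp
  have nn: "AE x in lborel. 0 < ereal x \<longrightarrow> ereal x < \<infinity> \<longrightarrow> 0 \<le> f x" if "\<And>x. x > 0 \<Longrightarrow> f x \<ge> 0"
    using that by simp
  have z: "(0::ereal) < \<infinity>" by simp
  show "set_integrable lborel {0<..} f" if "\<And>x. x > 0 \<Longrightarrow> f x \<ge> 0"
    using interval_integral_FTC_nonneg(1)[OF z F' f' nn[OF that] A' B'] unfolding ei .
  show "(LBINT x:{0<..}. f x) = B - A" if "\<And>x. x > 0 \<Longrightarrow> f x \<ge> 0"
    using interval_integral_FTC_nonneg(2)[OF z F' f' nn[OF that] A' B'] unfolding eq .
  show "(LBINT x:{0<..}. f x) = B - A" if "set_integrable lborel {0<..} f"
    using interval_integral_FTC_integrable[OF z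
        F'[unfolded has_real_derivative_iff_has_vector_derivative] f' that[folded ei] A' B']
    unfolding eq .
qed

lemma gaussian_antiderivative:
  obtains \<Phi> :: "real \<Rightarrow> real" where
    "\<And>z. (\<Phi> has_real_derivative exp (- z\<^sup>2)) (at z)" "(\<Phi> \<longlongrightarrow> 0) at_bot" "(\<Phi> \<longlongrightarrow> sqrt pi) at_top"
proof -
  have "\<exists>F. \<forall>x::real. -\<infinity> < ereal x \<longrightarrow> ereal x < \<infinity> \<longrightarrow> (F has_vector_derivative exp (- x\<^sup>2)) (at x)"
    by (rule einterval_antiderivative) (auto intro!: continuous_intros)
  then obtain F where F: "\<And>x::real. (F has_real_derivative exp (- x\<^sup>2)) (at x)"
    by (auto simp: has_real_derivative_iff_has_vector_derivative)
  have int: "(\<integral>x. indicator {..y} x *\<^sub>R (indicator {0..} x *\<^sub>R exp (- x\<^sup>2)) \<partial>lborel) = F y - F 0"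
    if "y \<ge> 0" for y
  proof -
    have "(\<integral>x. indicator {0..y} x *\<^sub>R exp (- x\<^sup>2) \<partial>lborel) = F y - F 0"
      using that F by (intro integral_FTC_Icc)
        (auto intro!: continuous_intros intro: DERIV_subset
          simp: has_real_derivative_iff_has_vector_derivative[symmetric])
    moreover have "indicator {..y} x *\<^sub>R (indicator {0..} x *\<^sub>R exp (- x\<^sup>2)) = indicator {0..y} x *\<^sub>R exp (- x\<^sup>2)" for x :: real
      by (auto simp: indicator_def)
    ultimately show ?thesis by (simp only:)
  qed
  have "((\<lambda>y. \<integral>x. indicator {..y} x *\<^sub>R (indicator {0::real..} x *\<^sub>R exp (- x\<^sup>2)) \<partial>lborel)
      \<longlongrightarrow> (\<integral>x. indicator {0::real..} x *\<^sub>R exp (- x\<^sup>2) \<partial>lborel)) at_top"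
    using gaussian_moment_0
    by (intro tendsto_integral_at_top[of lborel "\<lambda>x. indicator {0::real..} x *\<^sub>R exp (- x\<^sup>2)"])
       (auto simp: has_bochner_integral_iff)
  moreover have "(\<integral>x. indicator {0::real..} x *\<^sub>R exp (- x\<^sup>2) \<partial>lborel) = sqrt pi / 2"
    using gaussian_moment_0 by (simp add: has_bochner_integral_iff)
  ultimately have "((\<lambda>y. \<integral>x. indicator {..y} x *\<^sub>R (indicator {0::real..} x *\<^sub>R exp (- x\<^sup>2)) \<partial>lborel)
      \<longlongrightarrow> sqrt pi / 2) at_top" by (simp only:)
  moreover have "\<forall>\<^sub>F y in at_top. (\<integral>x. indicator {..y} x *\<^sub>R (indicator {0::real..} x *\<^sub>R exp (- x\<^sup>2)) \<partial>lborel) = F y - F 0"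
    using int by (intro eventually_mono[OF eventually_ge_at_top[of 0]]) simp
  ultimately have "((\<lambda>y. F y - F 0) \<longlongrightarrow> sqrt pi / 2) at_top"
    by (rule Lim_transform_eventually)
  define \<Phi> where "\<Phi> = (\<lambda>z. F z - F 0 + sqrt pi / 2)"
  have top: "(\<Phi> \<longlongrightarrow> sqrt pi) at_top"
    using tendsto_add[OF \<open>((\<lambda>y. F y - F 0) \<longlongrightarrow> sqrt pi / 2) at_top\<close> tendsto_const[of "sqrt pi / 2"]]
    by (simp add: \<Phi>_def)
  have D: "(\<Phi> has_real_derivative exp (- z\<^sup>2)) (at z)" for z
    unfolding \<Phi>_def by (auto intro!: derivative_eq_intros F)
  have "((\<lambda>z. \<Phi> z + \<Phi> (- z)) has_real_derivative 0) (at z)" for z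
  proof -
    have "((\<lambda>z. \<Phi> (- z)) has_real_derivative exp (- (- z)\<^sup>2) * (-1)) (at z)"
      by (rule DERIV_chain2[OF D]) (auto intro!: derivative_eq_intros)
    from DERIV_add[OF D[of z] this] show ?thesis by simp
  qed
  then have sym: "\<Phi> z + \<Phi> (- z) = \<Phi> 0 + \<Phi> 0" for z
    using DERIV_isconst_all[of "\<lambda>z. \<Phi> z + \<Phi> (- z)" z 0] by simp
  have "\<Phi> (- z) = sqrt pi - \<Phi> z" for z using sym[of z] by (simp add: \<Phi>_def)
  then have "((\<lambda>z. \<Phi> (- z)) \<longlongrightarrow> sqrt pi - sqrt pi) at_top"
    using tendsto_diff[OF tendsto_const[of "sqrt pi"] top] by simp
  then have "(\<Phi> \<longlongrightarrow> 0) at_bot"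
    by (simp add: filterlim_at_bot_mirror)
  then show thesis using that D top by blast
qed

text \<open>
  For $v = \sqrt u$ and $c = b/2$ the integrand is a multiple of $e^{-(v-c/v)^2}/v$. If \<open>\<Phi>\<close> is an
  antiderivative of the Gaussian, then $\Phi(v-c/v)$ and $e^{4c}\,\Phi(-v-c/v)$ have as derivatives
  in \<open>v\<close> that same exponential times $1+c/v^2$ and $c/v^2-1$. Their difference is therefore an
  explicit antiderivative.
\<close>

lemma subordination:
  assumes b: "b \<ge> 0"
  shows subordination_integrable: "set_integrable lborel {0<..} (\<lambda>u. exp (- u) / sqrt u * exp (- (b\<^sup>2 / (4 * u))))"
    and subordination_identity: "(LBINT u:{0<..}. exp (- u) / sqrt u * exp (- (b\<^sup>2 / (4 * u)))) = sqrt pi * exp (- b)"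
proof -
  obtain \<Phi> :: "real \<Rightarrow> real" where D: "\<And>z. (\<Phi> has_real_derivative exp (- z\<^sup>2)) (at z)"
    and bot: "(\<Phi> \<longlongrightarrow> 0) at_bot" and top: "(\<Phi> \<longlongrightarrow> sqrt pi) at_top"
    using gaussian_antiderivative by metis
  define c where "c = b / 2"
  have c: "c \<ge> 0" using b by (simp add: c_def)
  let ?f = "\<lambda>u. exp (- u) / sqrt u * exp (- (b\<^sup>2 / (4 * u)))"
  define G where "G = (\<lambda>u. exp (- 2 * c) * \<Phi> (sqrt u - c / sqrt u) - exp (2 * c) * \<Phi> (- sqrt u - c / sqrt u))"
  have G: "(G has_real_derivative ?f u) (at u)" if u: "u > 0" for u
  proof -
    let ?v = "sqrt u"
    have v: "?v > 0" "?v\<^sup>2 = u" using u by auto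
    have d1: "((\<lambda>u. \<Phi> (sqrt u - c / sqrt u)) has_real_derivative
       exp (- (?v - c / ?v)\<^sup>2) * (1 / (2 * ?v) + c / (2 * ?v ^ 3))) (at u)"
      by (rule DERIV_chain2[OF D])
         (use v in \<open>auto intro!: derivative_eq_intros simp: field_simps power2_eq_square power3_eq_cube\<close>)
    have d2: "((\<lambda>u. \<Phi> (- sqrt u - c / sqrt u)) has_real_derivative
       exp (- (- ?v - c / ?v)\<^sup>2) * (- 1 / (2 * ?v) + c / (2 * ?v ^ 3))) (at u)"
      by (rule DERIV_chain2[OF D])
         (use v in \<open>auto intro!: derivative_eq_intros simp: field_simps power2_eq_square power3_eq_cube\<close>)
    have e1: "exp (- 2 * c) * exp (- (?v - c / ?v)\<^sup>2) = exp (- u) * exp (- (b\<^sup>2 / (4 * u)))"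
    proof -
      have "- 2 * c + - (?v - c / ?v)\<^sup>2 = - ?v\<^sup>2 + - (c\<^sup>2 / ?v\<^sup>2)"
        using v(1) by (simp add: power2_diff power_divide)
      then show ?thesis unfolding exp_add[symmetric] using v(2) by (simp add: c_def power_divide)
    qed
    have e2: "exp (2 * c) * exp (- (- ?v - c / ?v)\<^sup>2) = exp (- u) * exp (- (b\<^sup>2 / (4 * u)))"
    proof -
      have "2 * c + - (- ?v - c / ?v)\<^sup>2 = - ?v\<^sup>2 + - (c\<^sup>2 / ?v\<^sup>2)"
        using v(1) by (simp add: power2_diff power_divide)
      then show ?thesis unfolding exp_add[symmetric] using v(2) by (simp add: c_def power_divide)
    qed
    have "(G has_real_derivative exp (- 2 * c) * (exp (- (?v - c / ?v)\<^sup>2) * (1 / (2 * ?v) + c / (2 * ?v ^ 3)))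
        - exp (2 * c) * (exp (- (- ?v - c / ?v)\<^sup>2) * (- 1 / (2 * ?v) + c / (2 * ?v ^ 3)))) (at u)"
      unfolding G_def by (intro DERIV_diff DERIV_cmult d1 d2)
    moreover have "exp (- 2 * c) * (exp (- (?v - c / ?v)\<^sup>2) * (1 / (2 * ?v) + c / (2 * ?v ^ 3)))
        - exp (2 * c) * (exp (- (- ?v - c / ?v)\<^sup>2) * (- 1 / (2 * ?v) + c / (2 * ?v ^ 3))) = ?f u"
      unfolding mult.assoc[symmetric] e1 e2 by (simp add: field_simps)
    ultimately show ?thesis by (simp only:)
  qed
  have cont: "isCont ?f u" if "u > 0" for u
    using that by (auto intro!: continuous_intros)
  have "(G \<longlongrightarrow> exp (- 2 * c) * sqrt pi - exp (2 * c) * 0) at_top"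
    unfolding G_def
    by (intro tendsto_diff tendsto_mult tendsto_const filterlim_compose[OF top] filterlim_compose[OF bot])
       real_asymp+
  then have Gtop: "(G \<longlongrightarrow> exp (- b) * sqrt pi) at_top" by (simp add: c_def)
  have Gbot: "(G \<longlongrightarrow> 0) (at_right 0)"
  proof (cases "c = 0")
    case True
    have "isCont \<Phi> 0" using D by (rule DERIV_isCont)
    then have t: "(\<Phi> \<longlongrightarrow> \<Phi> 0) (nhds 0)" by (simp add: continuous_at_imp_continuous_on isCont_def tendsto_at_iff_tendsto_nhds)
    have "((\<lambda>u. \<Phi> (sqrt u) - \<Phi> (- sqrt u)) \<longlongrightarrow> \<Phi> 0 - \<Phi> 0) (at_right 0)"
      by (intro tendsto_diff filterlim_compose[OF t]) real_asymp+
    then show ?thesis using True by (simp add: G_def)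
  next
    case False
    then have c: "c > 0" using c by simp
    have "(G \<longlongrightarrow> exp (- 2 * c) * 0 - exp (2 * c) * 0) (at_right 0)"
      unfolding G_def
      by (intro tendsto_diff tendsto_mult tendsto_const filterlim_compose[OF bot])
         (use c in real_asymp)+
    then show ?thesis by simp
  qed
  have nn: "?f u \<ge> 0" if "u > 0" for u using that by simp
  show "set_integrable lborel {0<..} ?f"
    by (rule halfline_FTC_nonneg_integrable[OF G cont Gbot Gtop nn])
  show "(LBINT u:{0<..}. ?f u) = sqrt pi * exp (- b)"
    using halfline_FTC_nonneg[OF G cont Gbot Gtop nn] by simp
qed

lemma gamma_integral_scaled:
  fixes p \<nu> :: real
  assumes p: "p > -1" and nu: "\<nu> > 0"
  shows gamma_integrable_scaled: "set_integrable lborel {0<..} (\<lambda>s. s powr p * exp (- \<nu> * s))"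
    and gamma_integral_scaled_eq: "(LBINT s:{0<..}. s powr p * exp (- \<nu> * s)) = Gamma (p + 1) / \<nu> powr (p + 1)"
proof -
  let ?g = "\<lambda>s::real. indicator {0..} s * (s powr p * exp (- s))"
  have hi: "((\<lambda>t. t powr p * exp (- t)) has_integral Gamma (p + 1)) {0..}"
    using Gamma_integral_real[of "p + 1"] p by (simp add: exp_minus field_simps)
  have "(\<lambda>t. t powr p * exp (- t)) absolutely_integrable_on {0::real..}"
    using hi by (intro nonnegative_absolutely_integrable_1) (auto simp: has_integral_integrable_integral)
  then have "integrable lebesgue ?g" by (simp add: set_integrable_def)
  then have I: "integrable lborel ?g" by (subst (asm) integrable_completion) auto
  then have "set_integrable lborel {0..} (\<lambda>t. t powr p * exp (- t))" by (simp add: set_integrable_def)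
  from set_borel_integral_eq_integral(2)[OF this] hi
  have IG: "(\<integral>s. ?g s \<partial>lborel) = Gamma (p + 1)"
    by (simp add: set_lebesgue_integral_def integral_unique)
  have e: "indicator {0<..} s *\<^sub>R (s powr p * exp (- \<nu> * s)) = ?g (0 + \<nu> * s) / \<nu> powr p" for s
  proof (cases "s > 0")
    case True
    then show ?thesis using nu by (simp add: powr_mult)
  next
    case False
    then show ?thesis using nu by (cases "s = 0") (auto simp: indicator_def zero_le_mult_iff)
  qed
  show "set_integrable lborel {0<..} (\<lambda>s. s powr p * exp (- \<nu> * s))"
    unfolding set_integrable_def e
    using lborel_integrable_real_affine[OF I, of \<nu> 0] nu by simp
  have "(\<integral>s. ?g s \<partial>lborel) = \<bar>\<nu>\<bar> *\<^sub>R (\<integral>s. ?g (0 + \<nu> * s) \<partial>lborel)"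
    by (rule lborel_integral_real_affine) (use nu in auto)
  then have "(\<integral>s. ?g (0 + \<nu> * s) \<partial>lborel) = Gamma (p + 1) / \<nu>" using IG nu by (simp add: field_simps)
  then show "(LBINT s:{0<..}. s powr p * exp (- \<nu> * s)) = Gamma (p + 1) / \<nu> powr (p + 1)"
    unfolding set_lebesgue_integral_def e using nu by (simp add: powr_add)
qed

text \<open>
  Integration by parts: $s^{-\gamma}(1-e^{-s})/\gamma$ vanishes at 0 and at infinity, and its
  derivative is the integrand plus $s^{-\gamma} e^{-s}/\gamma$, a Gamma integrand. Integrability
  comes from $1-e^{-s} \le s$ near 0 and $1-e^{-s} \le 1$ near infinity.
\<close>

lemma c_const_eq:
  assumes g: "0 < \<gamma>" "\<gamma> < 1"
  shows "c_const \<gamma> = - Gamma (1 - \<gamma>) / \<gamma>"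
proof -
  let ?h = "\<lambda>s::real. s powr (- \<gamma> - 1) * (exp (- s) - 1)"
  let ?k = "\<lambda>s::real. s powr (- \<gamma>) * exp (- 1 * s)"
  have k: "set_integrable lborel {0<..} ?k" "(LBINT s:{0<..}. ?k s) = Gamma (1 - \<gamma>)"
    using gamma_integral_scaled[of "- \<gamma>" 1] g by (simp_all add: add.commute)
  have "set_integrable lborel {0<..1} ?h"
  proof (rule set_integrable_bound)
    have "set_integrable lborel {0<..1} ?k" using k(1) by (rule set_integrable_subset) auto
    then show "set_integrable lborel {0<..1} (\<lambda>s. exp 1 * ?k s)" by (rule set_integrable_mult_right)
    show "set_borel_measurable lborel {0<..1} ?h" unfolding set_borel_measurable_def by measurable
    have "norm (?h s) \<le> norm (exp 1 * ?k s)" if s: "s \<in> {0<..1}" for s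
    proof -
      have "1 - exp (- s) \<le> s" using exp_ge_add_one_self[of "- s"] by simp
      then have "norm (?h s) \<le> s powr (- \<gamma> - 1) * s"
        using s by (simp add: abs_mult mult_left_mono)
      also have "\<dots> = s powr (- \<gamma>)" using s by (simp add: powr_diff)
      also have "\<dots> \<le> exp 1 * ?k s"
      proof -
        have "1 \<le> exp 1 * exp (- 1 * s)" using s by (simp flip: exp_add)
        then show ?thesis using mult_left_mono[of 1 "exp 1 * exp (- 1 * s)" "s powr (- \<gamma>)"] by (simp add: mult_ac)
      qed
      finally show ?thesis by simp
    qed
    then show "AE x\<in>{0<..1} in lborel. norm (?h x) \<le> norm (exp 1 * ?k x)" by simp
  qed
  moreover have "set_integrable lborel {1<..} ?h"
  proof (rule set_integrable_bound)
    let ?F = "\<lambda>s::real. - ((1 + s) powr (- \<gamma>) / \<gamma>)"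
    let ?j = "\<lambda>s::real. (1 + s) powr (- \<gamma> - 1)"
    have D: "(?F has_real_derivative ?j s) (at s)" if "s > 0" for s
      using that g by (auto intro!: derivative_eq_intros simp: powr_diff)
    have "set_integrable lborel {0<..} ?j"
    proof (rule halfline_FTC_nonneg_integrable[OF D])
      show "isCont ?j x" if "x > 0" for x using that by (auto intro!: continuous_intros)
      show "(?F \<longlongrightarrow> - inverse \<gamma>) (at_right 0)" using g by real_asymp
      show "(?F \<longlongrightarrow> 0) at_top" using g by real_asymp
    qed auto
    then have "set_integrable lborel {1<..} ?j" by (rule set_integrable_subset) auto
    then show "set_integrable lborel {1<..} (\<lambda>s. 2 powr (\<gamma> + 1) * ?j s)" by (rule set_integrable_mult_right)
    show "set_borel_measurable lborel {1<..} ?h" unfolding set_borel_measurable_def by measurable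
    have "norm (?h s) \<le> norm (2 powr (\<gamma> + 1) * ?j s)" if s: "s \<in> {1<..}" for s
    proof -
      have "norm (?h s) \<le> s powr (- \<gamma> - 1) * 1"
        using s unfolding norm_mult by (intro mult_mono) auto
      also have "\<dots> \<le> ((1 + s) / 2) powr (- \<gamma> - 1)" using s g by (simp add: powr_mono2')
      also have "\<dots> = 2 powr (\<gamma> + 1) * ?j s" using s by (simp add: powr_divide powr_minus powr_diff field_simps powr_add)
      finally show ?thesis by simp
    qed
    then show "AE x\<in>{1<..} in lborel. norm (?h x) \<le> norm (2 powr (\<gamma> + 1) * ?j x)" by simp
  qed
  ultimately have "set_integrable lborel ({0<..1} \<union> {1<..}) ?h"
    by (rule set_integrable_Un) auto
  moreover have "{0<..1} \<union> {1<..} = {0::real<..}" by auto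
  ultimately have h: "set_integrable lborel {0<..} ?h" by simp
  define H where "H = (\<lambda>s::real. s powr (- \<gamma>) * (1 - exp (- s)) / \<gamma>)"
  have "(LBINT s:{0<..}. ?h s + ?k s / \<gamma>) = 0 - 0"
  proof (rule halfline_FTC_integrable)
    show "(H has_real_derivative ?h s + ?k s / \<gamma>) (at s)" if "s > 0" for s
      unfolding H_def using that g
      by (auto intro!: derivative_eq_intros simp: field_simps)
    show "isCont (\<lambda>s. ?h s + ?k s / \<gamma>) s" if "s > 0" for s
      using that g by (auto intro!: continuous_intros)
    show "(H \<longlongrightarrow> 0) (at_right 0)" unfolding H_def using g by real_asymp
    show "(H \<longlongrightarrow> 0) at_top" unfolding H_def using g by real_asymp
    show "set_integrable lborel {0<..} (\<lambda>s. ?h s + ?k s / \<gamma>)"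
      using h k(1) by (intro set_integral_add) auto
  qed
  then have "(LBINT s:{0<..}. ?h s) + (LBINT s:{0<..}. ?k s / \<gamma>) = 0"
    using h k(1) by (subst (asm) set_integral_add) auto
  then show ?thesis unfolding c_const_def using k(2) by (simp add: field_simps)
qed

lemma C_const_eq:
  assumes g: "0 < \<gamma>" "\<gamma> < 1"
  shows "C_const \<gamma> * (Gamma (1 - \<gamma>) * Gamma (1 + \<gamma>)) = 1"
proof -
  have "Gamma (1 - \<gamma>) > 0" "Gamma \<gamma> > 0" using g by (auto intro: Gamma_real_pos)
  then have "Gamma (1 - \<gamma>) \<noteq> 0" "Gamma \<gamma> \<noteq> 0" by simp_all
  moreover have "Gamma (1 + \<gamma>) = \<gamma> * Gamma \<gamma>"
    using Gamma_plus1[of \<gamma>] g nonpos_Ints_nonpos[of \<gamma>] by (auto simp: add.commute)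
  ultimately show ?thesis using g
    by (simp add: C_const_def c_const_eq field_simps power2_eq_square)
qed

lemma set_integral_finite_sum:
  fixes g :: "'k \<Rightarrow> real \<Rightarrow> real"
  assumes L: "finite L" and g: "\<And>\<kappa>. \<kappa> \<in> L \<Longrightarrow> set_integrable lborel A (g \<kappa>)"
  shows "set_integrable lborel A (\<lambda>s. \<Sum>\<kappa>\<in>L. b \<kappa> * g \<kappa> s)"
    and "(LBINT s:A. (\<Sum>\<kappa>\<in>L. b \<kappa> * g \<kappa> s)) = (\<Sum>\<kappa>\<in>L. b \<kappa> * (LBINT s:A. g \<kappa> s))"
proof -
  have e: "indicator A s *\<^sub>R (\<Sum>\<kappa>\<in>L. b \<kappa> * g \<kappa> s) = (\<Sum>\<kappa>\<in>L. b \<kappa> * (indicator A s *\<^sub>R g \<kappa> s))" for s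
    by (simp add: sum_distrib_left mult_ac)
  have i: "integrable lborel (\<lambda>s. b \<kappa> * (indicator A s *\<^sub>R g \<kappa> s))" if "\<kappa> \<in> L" for \<kappa>
    using g[OF that] unfolding set_integrable_def by (rule integrable_mult_right)
  show "set_integrable lborel A (\<lambda>s. \<Sum>\<kappa>\<in>L. b \<kappa> * g \<kappa> s)"
    unfolding set_integrable_def e using i by (rule Bochner_Integration.integrable_sum)
  show "(LBINT s:A. (\<Sum>\<kappa>\<in>L. b \<kappa> * g \<kappa> s)) = (\<Sum>\<kappa>\<in>L. b \<kappa> * (LBINT s:A. g \<kappa> s))"
    unfolding set_lebesgue_integral_def e using i
    by (subst Bochner_Integration.integral_sum) auto
qed

section \<open>Sums over a countable index set\<close>

lemma infsum_enum:
  fixes f :: "'k \<Rightarrow> real" and e :: "nat \<Rightarrow> 'k"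
  assumes e: "bij e"
  shows summable_on_enum_iff: "f summable_on UNIV \<longleftrightarrow> summable (\<lambda>n. norm (f (e n)))"
    and infsum_enum_eq: "f summable_on UNIV \<Longrightarrow> infsum f UNIV = (\<Sum>n. f (e n))"
proof -
  have "f summable_on UNIV \<longleftrightarrow> (\<lambda>n. f (e n)) summable_on UNIV"
    using summable_on_reindex_bij_betw[OF e, of f] by simp
  also have "\<dots> \<longleftrightarrow> (\<lambda>n. norm (f (e n))) summable_on UNIV"
    by (rule summable_on_iff_abs_summable_on_real)
  also have "\<dots> \<longleftrightarrow> summable (\<lambda>n. norm (f (e n)))"
    using norm_summable_imp_summable_on[of "\<lambda>n. norm (f (e n))"] summable_on_imp_summable by auto
  finally show iff: "f summable_on UNIV \<longleftrightarrow> summable (\<lambda>n. norm (f (e n)))" .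
  assume "f summable_on UNIV"
  then have s: "summable (\<lambda>n. norm (f (e n)))" using iff by simp
  have "((\<lambda>n. f (e n)) has_sum (\<Sum>n. f (e n))) UNIV"
    using s by (intro norm_summable_imp_has_sum summable_sums summable_norm_cancel[OF s])
  then show "infsum f UNIV = (\<Sum>n. f (e n))"
    using infsum_reindex_bij_betw[OF e, of f] by (simp add: infsumI)
qed

text \<open>
  An unordered sum has the value 0 where it diverges, so the set of convergence has to be
  measurable as well. It is the set where the sum of the absolute values, taken in \<open>ennreal\<close>, is
  finite.
\<close>

lemma borel_measurable_infsum:
  fixes f :: "'k \<Rightarrow> 'a \<Rightarrow> real" and e :: "nat \<Rightarrow> 'k"
  assumes e: "bij e" and [measurable]: "\<And>k. f k \<in> borel_measurable M"
  shows "(\<lambda>x. \<Sum>\<^sub>\<infinity>k\<in>UNIV. f k x) \<in> borel_measurable M"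
proof -
  have eq: "(\<Sum>\<^sub>\<infinity>k\<in>UNIV. f k x) = (if (\<Sum>n. ennreal (norm (f (e n) x))) \<noteq> top then (\<Sum>n. f (e n) x) else 0)" for x
  proof (cases "(\<lambda>k. f k x) summable_on UNIV")
    case True
    then have "(\<Sum>n. ennreal (norm (f (e n) x))) \<noteq> top"
      using summable_on_enum_iff[OF e, of "\<lambda>k. f k x"] by (intro ennreal_suminf_neq_top) auto
    then show ?thesis using infsum_enum_eq[OF e True] by simp
  next
    case False
    then have "\<not> summable (\<lambda>n. norm (f (e n) x))"
      by (simp add: summable_on_enum_iff[OF e])
    then have "(\<Sum>n. ennreal (norm (f (e n) x))) = top"
      using summable_suminf_not_top[of "\<lambda>n. norm (f (e n) x)"] norm_ge_zero by blast
    then show ?thesis using False by (simp add: infsum_not_exists)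
  qed
  show ?thesis unfolding eq by measurable
qed

lemma integral_infsum:
  fixes f :: "'k \<Rightarrow> 'a \<Rightarrow> real" and e :: "nat \<Rightarrow> 'k"
  assumes e: "bij e" and int: "\<And>k. integrable M (f k)"
    and ae: "AE x in M. (\<lambda>k. f k x) summable_on UNIV"
    and s: "(\<lambda>k. \<integral>x. \<bar>f k x\<bar> \<partial>M) summable_on UNIV"
  shows "integrable M (\<lambda>x. \<Sum>\<^sub>\<infinity>k\<in>UNIV. f k x)"
    and "(\<integral>x. (\<Sum>\<^sub>\<infinity>k\<in>UNIV. f k x) \<partial>M) = (\<Sum>\<^sub>\<infinity>k\<in>UNIV. \<integral>x. f k x \<partial>M)"
proof -
  have [measurable]: "\<And>k. f k \<in> borel_measurable M" using int by auto
  have m: "(\<lambda>x. \<Sum>\<^sub>\<infinity>k\<in>UNIV. f k x) \<in> borel_measurable M" by (rule borel_measurable_infsum[OF e]) simp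
  have m': "(\<lambda>x. \<Sum>n. f (e n) x) \<in> borel_measurable M" by measurable
  have ae': "AE x in M. summable (\<lambda>n. norm (f (e n) x))"
    using ae by eventually_elim (use summable_on_enum_iff[OF e] in simp)
  have eq: "AE x in M. (\<Sum>\<^sub>\<infinity>k\<in>UNIV. f k x) = (\<Sum>n. f (e n) x)"
    using ae by eventually_elim (rule infsum_enum_eq[OF e])
  have s': "summable (\<lambda>n. \<integral>x. norm (f (e n) x) \<partial>M)"
    using s unfolding summable_on_enum_iff[OF e] by simp
  have "integrable M (\<lambda>x. \<Sum>n. f (e n) x)"
    by (rule integrable_suminf[OF int ae' s'])
  then show "integrable M (\<lambda>x. \<Sum>\<^sub>\<infinity>k\<in>UNIV. f k x)"
    using integrable_cong_AE[OF m m' eq] by simp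
  have sm: "(\<lambda>k. \<integral>x. f k x \<partial>M) summable_on UNIV"
  proof -
    have "norm (\<integral>x. f k x \<partial>M) \<le> (\<integral>x. \<bar>f k x\<bar> \<partial>M)" for k
      using integral_norm_bound[of M "f k"] by simp
    then show ?thesis
      unfolding summable_on_iff_abs_summable_on_real[of "\<lambda>k. \<integral>x. f k x \<partial>M"]
      by (intro summable_on_comparison_test[OF s]) auto
  qed
  show "(\<integral>x. (\<Sum>\<^sub>\<infinity>k\<in>UNIV. f k x) \<partial>M) = (\<Sum>\<^sub>\<infinity>k\<in>UNIV. \<integral>x. f k x \<partial>M)"
    using integral_cong_AE[OF m m' eq] integral_suminf[OF int ae' s'] infsum_enum_eq[OF e sm] by simp
qed

text \<open>
  The factor $\nu$ that differentiation brings down is absorbed by half of the exponential, since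
  $x e^{-x} \le 1$ for $x = \nu\epsilon/2$.
\<close>

lemma dirichlet_series_coeff_derivative:
  fixes a \<nu> :: "'k \<Rightarrow> real"
  assumes nu: "\<And>k. \<nu> k \<ge> 0"
    and s: "\<And>\<epsilon>. \<epsilon> > 0 \<Longrightarrow> (\<lambda>k. a k * exp (- \<nu> k * \<epsilon>)) summable_on UNIV" and eps: "\<epsilon> > 0"
  shows "(\<lambda>k. - \<nu> k * a k * exp (- \<nu> k * \<epsilon>)) summable_on UNIV"
proof -
  have "(\<lambda>k. norm (a k * exp (- \<nu> k * (\<epsilon> / 2)))) summable_on UNIV"
    using s[of "\<epsilon> / 2"] eps by (subst summable_on_iff_abs_summable_on_real[symmetric]) auto
  then have S: "(\<lambda>k. 2 / \<epsilon> * norm (a k * exp (- \<nu> k * (\<epsilon> / 2)))) summable_on UNIV"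
    by (rule summable_on_cmult_right)
  have "norm (- \<nu> k * a k * exp (- \<nu> k * \<epsilon>)) \<le> 2 / \<epsilon> * norm (a k * exp (- \<nu> k * (\<epsilon> / 2)))" for k
  proof -
    let ?x = "\<nu> k * (\<epsilon> / 2)"
    have "?x \<le> exp ?x" using exp_ge_add_one_self[of ?x] by linarith
    then have "?x * exp (- ?x) \<le> exp ?x * exp (- ?x)" by (rule mult_right_mono) simp
    then have *: "?x * exp (- ?x) \<le> 1" by (simp add: exp_minus_inverse)
    have "exp (- \<nu> k * \<epsilon>) = exp (- ?x) * exp (- ?x)" by (simp flip: exp_add)
    then have "norm (- \<nu> k * a k * exp (- \<nu> k * \<epsilon>)) = 2 / \<epsilon> * (\<bar>a k\<bar> * exp (- ?x)) * (?x * exp (- ?x))"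
      using nu[of k] eps by (simp add: abs_mult field_simps)
    also have "\<dots> \<le> 2 / \<epsilon> * (\<bar>a k\<bar> * exp (- ?x)) * 1"
      using * eps by (intro mult_left_mono) auto
    finally show ?thesis by (simp add: abs_mult)
  qed
  then show ?thesis
    unfolding summable_on_iff_abs_summable_on_real[of "\<lambda>k. - \<nu> k * a k * exp (- \<nu> k * \<epsilon>)"]
    by (intro summable_on_comparison_test[OF S]) auto
qed

lemma dirichlet_series_has_derivative:
  fixes a \<nu> :: "'k \<Rightarrow> real" and e :: "nat \<Rightarrow> 'k"
  assumes e: "bij e" and nu: "\<And>k. \<nu> k \<ge> 0"
    and s: "\<And>\<epsilon>. \<epsilon> > 0 \<Longrightarrow> (\<lambda>k. a k * exp (- \<nu> k * \<epsilon>)) summable_on UNIV" and t: "t > 0"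
  shows "((\<lambda>t. \<Sum>\<^sub>\<infinity>k\<in>UNIV. a k * exp (- \<nu> k * t)) has_real_derivative
     (\<Sum>\<^sub>\<infinity>k\<in>UNIV. - \<nu> k * a k * exp (- \<nu> k * t))) (at t)"
proof -
  let ?a = "\<lambda>n. a (e n)" and ?n = "\<lambda>n. \<nu> (e n)"
  note s' = dirichlet_series_coeff_derivative[of \<nu> a, OF nu s]
  have u: "uniformly_convergent_on {t / 2..} (\<lambda>n x. \<Sum>i<n. - ?n i * ?a i * exp (- ?n i * x))"
  proof (rule Weierstrass_m_test')
    show "summable (\<lambda>n. norm (- ?n n * ?a n * exp (- ?n n * (t / 2))))"
      using s'[of "t / 2"] t unfolding summable_on_enum_iff[OF e] by simp
    show "norm (- ?n n * ?a n * exp (- ?n n * x)) \<le> norm (- ?n n * ?a n * exp (- ?n n * (t / 2)))"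
      if "x \<in> {t / 2..}" for n x
    proof -
      have "?n n * (t / 2) \<le> ?n n * x" using that nu by (intro mult_left_mono) auto
      then show ?thesis unfolding norm_mult by (intro mult_left_mono) auto
    qed
  qed
  have "((\<lambda>x. \<Sum>n. ?a n * exp (- ?n n * x)) has_field_derivative (\<Sum>n. - ?n n * ?a n * exp (- ?n n * t))) (at t)"
  proof (rule has_field_derivative_series'(2)[OF _ _ u])
    show "((\<lambda>x. ?a n * exp (- ?n n * x)) has_field_derivative - ?n n * ?a n * exp (- ?n n * x)) (at x within {t / 2..})" for n x
      by (auto intro!: derivative_eq_intros)
    show "t \<in> {t / 2..}" using t by simp
    show "summable (\<lambda>n. ?a n * exp (- ?n n * t))"
      using s[OF t] unfolding summable_on_enum_iff[OF e] by (rule summable_norm_cancel)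
    show "t \<in> interior {t / 2..}" using t by simp
  qed simp
  then have "((\<lambda>x. \<Sum>n. ?a n * exp (- ?n n * x)) has_field_derivative (\<Sum>\<^sub>\<infinity>k\<in>UNIV. - \<nu> k * a k * exp (- \<nu> k * t))) (at t)"
    using infsum_enum_eq[OF e s'[OF _ t]] s by simp
  then show ?thesis
  proof (rule has_field_derivative_transform_within_open)
    show "open {0::real<..}" "t \<in> {0<..}" using t by auto
    show "(\<Sum>n. ?a n * exp (- ?n n * x)) = (\<Sum>\<^sub>\<infinity>k\<in>UNIV. a k * exp (- \<nu> k * x))" if "x \<in> {0<..}" for x
      using infsum_enum_eq[OF e s[of x]] that by simp
  qed
qed

lemma summable_on_bounded:
  fixes f g :: "'k \<Rightarrow> real"
  assumes "g summable_on UNIV" "\<And>k. \<bar>f k\<bar> \<le> g k"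
  shows "f summable_on UNIV"
  unfolding summable_on_iff_abs_summable_on_real[of f]
  by (rule summable_on_comparison_test[OF assms(1)]) (use assms(2) in auto)

lemma deriv_exp_sum:
  fixes b \<nu> :: "'k \<Rightarrow> real"
  assumes h: "\<And>v. v > 0 \<Longrightarrow> h v = (\<Sum>\<kappa>\<in>L. b \<kappa> * exp (- \<nu> \<kappa> * v))" and u: "u > 0"
  shows "deriv h u = (\<Sum>\<kappa>\<in>L. (- \<nu> \<kappa> * b \<kappa>) * exp (- \<nu> \<kappa> * u))"
proof -
  have "\<forall>\<^sub>F v in nhds u. v \<in> {0<..}" using u by (intro eventually_nhds_in_open) auto
  then have "\<forall>\<^sub>F v in nhds u. h v = (\<Sum>\<kappa>\<in>L. b \<kappa> * exp (- \<nu> \<kappa> * v))"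
    by eventually_elim (simp add: h)
  then have "deriv h u = deriv (\<lambda>v. \<Sum>\<kappa>\<in>L. b \<kappa> * exp (- \<nu> \<kappa> * v)) u" by (rule deriv_cong_ev) simp
  also have "\<dots> = (\<Sum>\<kappa>\<in>L. (- \<nu> \<kappa> * b \<kappa>) * exp (- \<nu> \<kappa> * u))"
    by (intro DERIV_imp_deriv DERIV_sum) (auto intro!: derivative_eq_intros)
  finally show ?thesis .
qed

section \<open>Products over the coordinates\<close>

lemma lborel_vec_prod:
  fixes g :: "'n::finite \<Rightarrow> real \<Rightarrow> real"
  assumes g: "\<And>i. integrable lborel (g i)"
  shows integrable_lborel_vec_prod: "integrable lborel (\<lambda>x::real^'n. \<Prod>i\<in>UNIV. g i (x $ i))"
    and integral_lborel_vec_prod: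
      "(\<integral>x. (\<Prod>i\<in>UNIV. g i (x $ i)) \<partial>(lborel :: (real^'n) measure)) = (\<Prod>i\<in>UNIV. \<integral>t. g i t \<partial>lborel)"
proof -
  interpret product_sigma_finite "\<lambda>_::real^'n. lborel :: real measure" ..
  define idx :: "real^'n \<Rightarrow> 'n" where "idx = inv (\<lambda>i. axis i 1)"
  have inj: "inj (\<lambda>i::'n. axis i (1::real))" by (auto simp: inj_on_def axis_eq_axis)
  have idx: "idx (axis i 1) = i" for i unfolding idx_def by (rule inv_f_f[OF inj])
  have B: "(Basis :: (real^'n) set) = range (\<lambda>i. axis i 1)" by (auto simp: Basis_vec_def)
  let ?h = "\<lambda>f::real^'n \<Rightarrow> real. \<Sum>b\<in>Basis. f b *\<^sub>R b"
  have comp: "?h f $ i = f (axis i 1)" for f i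
  proof -
    have "?h f $ i = ?h f \<bullet> axis i 1" by (simp add: inner_axis)
    also have "\<dots> = f (axis i 1)" by (rule inner_sum_left_Basis) (simp add: B)
    finally show ?thesis .
  qed
  have [measurable]: "\<And>i. g i \<in> borel_measurable borel" using g by auto
  have pr: "(\<Prod>i\<in>UNIV. G i (axis i (1::real))) = (\<Prod>b\<in>Basis. G (idx b) b)" for G :: "'n \<Rightarrow> real^'n \<Rightarrow> real"
    unfolding B by (subst prod.reindex[OF inj]) (simp add: idx)
  have eq: "(\<Prod>i\<in>UNIV. g i (?h f $ i)) = (\<Prod>b\<in>Basis. g (idx b) (f b))" for f
    unfolding comp using pr[of "\<lambda>i b. g i (f b)"] .
  obtain M where M: "M = (\<Pi>\<^sub>M b\<in>(Basis::(real^'n) set). (lborel :: real measure))" by simp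
  have L: "(lborel :: (real^'n) measure) = distr M borel ?h" unfolding M by (rule lborel_eq)
  have hm: "?h \<in> M \<rightarrow>\<^sub>M borel" unfolding M by measurable
  have gm: "(\<lambda>x::real^'n. \<Prod>i\<in>UNIV. g i (x $ i)) \<in> borel_measurable borel" by measurable
  have i: "integrable M (\<lambda>f. \<Prod>b\<in>Basis. g (idx b) (f b))"
    unfolding M by (rule product_integrable_prod) (auto simp: g)
  show "integrable lborel (\<lambda>x::real^'n. \<Prod>i\<in>UNIV. g i (x $ i))"
    unfolding L using i by (subst integrable_distr_eq[OF hm gm]) (simp only: eq)
  have "(\<integral>x. (\<Prod>i\<in>UNIV. g i (x $ i)) \<partial>(lborel :: (real^'n) measure))
      = (\<integral>f. (\<Prod>b\<in>Basis. g (idx b) (f b)) \<partial>M)"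
    unfolding L by (subst integral_distr[OF hm gm]) (simp only: eq)
  also have "\<dots> = (\<Prod>b\<in>Basis. \<integral>t. g (idx b) t \<partial>lborel)"
    unfolding M by (rule product_integral_prod) (auto simp: g)
  also have "\<dots> = (\<Prod>i\<in>UNIV. \<integral>t. g i t \<partial>lborel)"
    using pr[of "\<lambda>i b. \<integral>t. g i t \<partial>lborel"] by simp
  finally show "(\<integral>x. (\<Prod>i\<in>UNIV. g i (x $ i)) \<partial>(lborel :: (real^'n) measure)) = (\<Prod>i\<in>UNIV. \<integral>t. g i t \<partial>lborel)" .
qed

lemma sum_vec_box:
  fixes G :: "'n::finite \<Rightarrow> nat \<Rightarrow> real"
  shows "(\<Sum>\<kappa>\<in>{\<kappa>::nat^'n. \<forall>i. \<kappa> $ i \<le> N}. \<Prod>i\<in>UNIV. G i (\<kappa> $ i)) = (\<Prod>i\<in>UNIV. \<Sum>n\<le>N. G i n)"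
proof -
  have "(\<Prod>i\<in>UNIV. \<Sum>n\<le>N. G i n) = (\<Sum>\<phi>\<in>PiE UNIV (\<lambda>_. {..N}). \<Prod>i\<in>UNIV. G i (\<phi> i))"
    by (rule prod_sum_PiE) auto
  also have "\<dots> = (\<Sum>\<kappa>\<in>{\<kappa>::nat^'n. \<forall>i. \<kappa> $ i \<le> N}. \<Prod>i\<in>UNIV. G i (\<kappa> $ i))"
    by (rule sum.reindex_bij_witness[where i = vec_nth and j = vec_lambda]) auto
  finally show ?thesis by simp
qed

lemma finite_vec_box: "finite {\<kappa>::nat^'n::finite. \<forall>i. \<kappa> $ i \<le> N}"
proof -
  have "{\<kappa>::nat^'n. \<forall>i. \<kappa> $ i \<le> N} = vec_lambda ` PiE UNIV (\<lambda>_. {..N})"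
    by (auto simp: image_iff intro!: bexI[of _ "vec_nth _"])
  then show ?thesis by (simp add: finite_PiE)
qed

lemma summable_on_vec_prod:
  fixes G :: "'n::finite \<Rightarrow> nat \<Rightarrow> real"
  assumes "\<And>i. summable (G i)" and nn: "\<And>i n. G i n \<ge> 0"
  shows "(\<lambda>\<kappa>::nat^'n. \<Prod>i\<in>UNIV. G i (\<kappa> $ i)) summable_on UNIV"
proof (rule nonneg_bdd_above_summable_on)
  show "bdd_above (sum (\<lambda>\<kappa>::nat^'n. \<Prod>i\<in>UNIV. G i (\<kappa> $ i)) ` {F. F \<subseteq> UNIV \<and> finite F})"
  proof (rule bdd_aboveI2)
    fix F :: "(nat^'n) set" assume "F \<in> {F. F \<subseteq> UNIV \<and> finite F}"
    then have F: "finite F" by simp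
    define N where "N = Max (insert 0 ((\<lambda>(\<kappa>, i). \<kappa> $ i) ` (F \<times> UNIV)))"
    have "\<kappa> $ i \<le> N" if "\<kappa> \<in> F" for \<kappa> i
      unfolding N_def using F that by (intro Max_ge) force+
    then have sub: "F \<subseteq> {\<kappa>. \<forall>i. \<kappa> $ i \<le> N}" by auto
    have "(\<Sum>\<kappa>\<in>F. \<Prod>i\<in>UNIV. G i (\<kappa> $ i)) \<le> (\<Sum>\<kappa>\<in>{\<kappa>. \<forall>i. \<kappa> $ i \<le> N}. \<Prod>i\<in>UNIV. G i (\<kappa> $ i))"
      by (intro sum_mono2 finite_vec_box sub prod_nonneg) (simp add: nn)
    also have "\<dots> = (\<Prod>i\<in>UNIV. \<Sum>n\<le>N. G i n)" by (rule sum_vec_box)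
    also have "\<dots> \<le> (\<Prod>i\<in>UNIV. \<Sum>n. G i n)"
      using assms by (intro prod_mono conjI sum_nonneg sum_le_suminf) auto
    finally show "sum (\<lambda>\<kappa>. \<Prod>i\<in>UNIV. G i (\<kappa> $ i)) F \<le> (\<Prod>i\<in>UNIV. \<Sum>n. G i n)" .
  qed
qed (simp add: nn prod_nonneg)

text \<open>
  A factor $n+1$ is, up to sign, a derivative of the Dirichlet series with frequencies $n+1$, so all
  powers follow from the geometric series.
\<close>

lemma summable_poly_exp:
  "\<epsilon> > 0 \<Longrightarrow> (\<lambda>n. (real n + 1) ^ m * exp (- (real n + 1) * \<epsilon>)) summable_on UNIV"
proof (induction m arbitrary: \<epsilon>)
  case 0
  have "summable (\<lambda>n. exp (- \<epsilon>) * exp (- \<epsilon>) ^ n)" using 0 by (intro summable_mult summable_geometric) auto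
  moreover have "exp (- \<epsilon>) * exp (- \<epsilon>) ^ n = (real n + 1) ^ 0 * exp (- (real n + 1) * \<epsilon>)" for n
    by (simp add: exp_of_nat_mult[symmetric] algebra_simps flip: exp_add)
  ultimately show ?case by (intro norm_summable_imp_summable_on) simp
next
  case (Suc m)
  have "(\<lambda>n. - (real n + 1) * (real n + 1) ^ m * exp (- (real n + 1) * \<epsilon>)) summable_on UNIV"
    using Suc by (intro dirichlet_series_coeff_derivative) auto
  from summable_on_cmult_right[OF this, of "- 1"] show ?case
    by (simp add: mult.assoc del: minus_add_distrib)
qed

lemma bij_nat_vec: "\<exists>e. bij (e :: nat \<Rightarrow> nat^'n::finite)"
proof -
  have "inj (\<lambda>n::nat. (\<chi> i. n) :: nat^'n)" by (auto simp: inj_on_def vec_eq_iff)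
  then have "infinite (range (\<lambda>n::nat. (\<chi> i. n) :: nat^'n))" by (rule range_inj_infinite)
  then have "infinite (UNIV :: (nat^'n) set)" using finite_subset[OF subset_UNIV] by blast
  then show ?thesis using countableE_infinite[of "UNIV :: (nat^'n) set"] bij_betw_inv by blast
qed

section \<open>Density of continuous functions\<close>

text \<open>
  The indicator of a compact set is the limit of $\max(0, 1 - n d)$, with \<open>d\<close> the distance from the
  set. Inner regularity passes to all measurable sets, and linearity and dominated convergence to
  all integrable functions.
\<close>

lemma continuous_L1_dense:
  fixes f :: "'a::{second_countable_topology, complete_space} \<Rightarrow> real"
  assumes fin: "finite_measure M" and sets: "sets M = sets borel" and f: "integrable M f" and e: "\<epsilon> > 0"
  shows "\<exists>g. continuous_on UNIV g \<and> integrable M g \<and> (\<integral>x. \<bar>f x - g x\<bar> \<partial>M) < \<epsilon>"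
proof -
  interpret finite_measure M by (rule fin)
  note [measurable_cong] = sets
  have sp: "space M = UNIV" using sets_eq_imp_space_eq[OF sets] by simp
  have step: "(\<integral>x. \<bar>f x - h x\<bar> \<partial>M) \<le> (\<integral>x. \<bar>f x - g x\<bar> \<partial>M) + (\<integral>x. \<bar>g x - h x\<bar> \<partial>M)"
    if "integrable M f" "integrable M g" "integrable M h" for f g h :: "'a \<Rightarrow> real"
  proof -
    have "(\<integral>x. \<bar>f x - h x\<bar> \<partial>M) \<le> (\<integral>x. \<bar>f x - g x\<bar> + \<bar>g x - h x\<bar> \<partial>M)"
      using that by (intro integral_mono) auto
    then show ?thesis using that by simp
  qed
  have "\<forall>\<epsilon>>0. \<exists>g. continuous_on UNIV g \<and> integrable M g \<and> (\<integral>x. \<bar>f x - g x\<bar> \<partial>M) < \<epsilon>"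
    using f
  proof (induction rule: integrable_induct)
    case (base A c)
    show ?case
    proof (intro allI impI)
      fix \<epsilon> :: real assume e: "\<epsilon> > 0"
      define \<delta> where "\<delta> = \<epsilon> / (2 * (\<bar>c\<bar> + 1))"
      have d: "\<delta> > 0" using e by (simp add: \<delta>_def add_nonneg_pos)
      have A: "A \<in> sets borel" using base sets by simp
      have "\<exists>K. K \<subseteq> A \<and> compact K \<and> measure M A < measure M K + \<delta>"
      proof (rule ccontr)
        assume "\<not> ?thesis"
        then have no: "measure M K + \<delta> \<le> measure M A" if "K \<subseteq> A" "compact K" for K using that by force
        then have "emeasure M K \<le> ennreal (measure M A - \<delta>)" if "K \<subseteq> A" "compact K" for K
          using no[OF that] by (simp add: emeasure_eq_measure ennreal_leI)
        then have "emeasure M A \<le> ennreal (measure M A - \<delta>)"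
          using inner_regular[OF sets _ A] by (simp add: SUP_le_iff)
        then have "ennreal (measure M A) \<le> ennreal (measure M A - \<delta>)"
          unfolding emeasure_eq_measure .
        moreover have "measure M A - \<delta> \<ge> 0" using no[of "{}"] by simp
        ultimately show False using d by (subst (asm) ennreal_le_iff) auto
      qed
      then obtain K where K: "K \<subseteq> A" "compact K" "measure M A < measure M K + \<delta>" by blast
      have Kb [measurable]: "K \<in> sets M" using K(2) sets by (simp add: compact_imp_closed)
      have AK: "(\<integral>x. \<bar>indicator A x - indicator K x :: real\<bar> \<partial>M) < \<delta>"
      proof -
        have "\<bar>indicator A x - indicator K x :: real\<bar> = indicator (A - K) x" for x
          using K(1) by (auto simp: indicator_def)
        then have "(\<integral>x. \<bar>indicator A x - indicator K x :: real\<bar> \<partial>M) = measure M (A - K)"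
          by (simp add: sp)
        also have "\<dots> = measure M A - measure M K"
          using base Kb K(1) by (intro finite_measure_Diff) auto
        finally show ?thesis using K(3) by simp
      qed
      have "\<exists>g. continuous_on UNIV g \<and> integrable M g \<and> (\<integral>x. \<bar>indicator K x - g x\<bar> \<partial>M) < \<delta>"
      proof (cases "K = {}")
        case True
        then show ?thesis using d by (intro exI[of _ "\<lambda>_. 0"]) simp
      next
        case False
        define G where "G = (\<lambda>n x. max 0 (1 - real n * infdist x K))"
        have Gc: "continuous_on UNIV (G n)" for n unfolding G_def by (intro continuous_intros)
        have [measurable]: "G n \<in> borel_measurable M" for n
          using borel_measurable_continuous_onI[OF Gc[of n]] by simp
        have Gb: "\<bar>G n x\<bar> \<le> 1" for n x using infdist_nonneg[of x K] by (auto simp: G_def max_def)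
        have Gi: "integrable M (G n)" for n
          using Gb by (intro integrable_const_bound[of _ 1]) auto
        have "(\<lambda>n. \<bar>indicator K x - G n x\<bar>) \<longlonglongrightarrow> 0" for x
        proof (cases "x \<in> K")
          case True
          then show ?thesis by (simp add: G_def)
        next
          case f: False
          then have p: "infdist x K > 0"
            using infdist_pos_not_in_closed[of K x] False compact_imp_closed[OF K(2)] by simp
          then obtain N where N: "real N * infdist x K > 1"
            using reals_Archimedean3 by blast
          have "G n x = 0" if "n \<ge> N" for n
          proof -
            have "real N * infdist x K \<le> real n * infdist x K" using p that by (intro mult_right_mono) auto
            then show ?thesis using N unfolding G_def by linarith
          qed
          then have "\<forall>\<^sub>F n in sequentially. \<bar>indicator K x - G n x\<bar> = 0"
            using f by (auto intro: eventually_sequentiallyI[of N])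
          then show ?thesis by (rule tendsto_eventually)
        qed
        then have "(\<lambda>n. \<integral>x. \<bar>indicator K x - G n x\<bar> \<partial>M) \<longlonglongrightarrow> (\<integral>x. 0 \<partial>M)"
        proof (intro integral_dominated_convergence[where w = "\<lambda>_. 2"])
          have "norm \<bar>indicator K x - G n x\<bar> \<le> 2" for n x
          proof -
            have "\<bar>indicator K x - G n x\<bar> \<le> \<bar>indicator K x\<bar> + \<bar>G n x\<bar>" by (rule abs_triangle_ineq4)
            also have "\<dots> \<le> 1 + 1" by (intro add_mono Gb) (simp add: indicator_def)
            finally show ?thesis by simp
          qed
          then show "AE x in M. norm \<bar>indicator K x - G n x\<bar> \<le> 2" for n by simp
        qed auto
        then have "(\<lambda>n. \<integral>x. \<bar>indicator K x - G n x\<bar> \<partial>M) \<longlonglongrightarrow> 0" by simp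
        from order_tendstoD(2)[OF this d] obtain n where "(\<integral>x. \<bar>indicator K x - G n x\<bar> \<partial>M) < \<delta>"
          by (auto simp: eventually_sequentially)
        then show ?thesis using Gc Gi by blast
      qed
      then obtain g where g: "continuous_on UNIV g" "integrable M g" "(\<integral>x. \<bar>indicator K x - g x\<bar> \<partial>M) < \<delta>" by blast
      have ind: "integrable M (indicator A :: 'a \<Rightarrow> real)" "integrable M (indicator K :: 'a \<Rightarrow> real)"
        using base by (auto simp: emeasure_eq_measure)
      have "(\<integral>x. \<bar>indicator A x - g x\<bar> \<partial>M) < 2 * \<delta>"
        using step[OF ind g(2)] AK g(3) by simp
      moreover have "(\<integral>x. \<bar>indicator A x *\<^sub>R c - c * g x\<bar> \<partial>M) = \<bar>c\<bar> * (\<integral>x. \<bar>indicator A x - g x\<bar> \<partial>M)"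
      proof -
        have "\<bar>indicator A x *\<^sub>R c - c * g x\<bar> = \<bar>c\<bar> * \<bar>indicator A x - g x\<bar>" for x
          by (simp flip: abs_mult add: algebra_simps)
        then show ?thesis by simp
      qed
      ultimately have "(\<integral>x. \<bar>indicator A x *\<^sub>R c - c * g x\<bar> \<partial>M) \<le> \<bar>c\<bar> * (2 * \<delta>)"
        by (simp add: mult_left_mono)
      also have "\<dots> < \<epsilon>" using e by (simp add: \<delta>_def field_simps add_nonneg_pos)
      finally show "\<exists>g. continuous_on UNIV g \<and> integrable M g \<and> (\<integral>x. \<bar>indicator A x *\<^sub>R c - g x\<bar> \<partial>M) < \<epsilon>"
        using g by (intro exI[of _ "\<lambda>x. c * g x"]) (auto intro!: continuous_intros)
    qed
  next
    case (add f1 f2)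
    show ?case
    proof (intro allI impI)
      fix \<epsilon> :: real assume "\<epsilon> > 0"
      then have "\<epsilon> / 2 > 0" by simp
      with add.IH obtain g1 g2 where g:
        "continuous_on UNIV g1" "integrable M g1" "(\<integral>x. \<bar>f1 x - g1 x\<bar> \<partial>M) < \<epsilon> / 2"
        "continuous_on UNIV g2" "integrable M g2" "(\<integral>x. \<bar>f2 x - g2 x\<bar> \<partial>M) < \<epsilon> / 2" by meson
      have "(\<integral>x. \<bar>(f1 x + f2 x) - (g1 x + g2 x)\<bar> \<partial>M) \<le> (\<integral>x. \<bar>f1 x - g1 x\<bar> + \<bar>f2 x - g2 x\<bar> \<partial>M)"
        using add.hyps g by (intro integral_mono) auto
      also have "\<dots> < \<epsilon>" using add.hyps g by simp
      finally show "\<exists>g. continuous_on UNIV g \<and> integrable M g \<and> (\<integral>x. \<bar>f1 x + f2 x - g x\<bar> \<partial>M) < \<epsilon>"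
        using g by (intro exI[of _ "\<lambda>x. g1 x + g2 x"]) (auto intro!: continuous_intros)
    qed
  next
    case (lim f s)
    show ?case
    proof (intro allI impI)
      fix \<epsilon> :: real assume "\<epsilon> > 0"
      then have e2: "\<epsilon> / 2 > 0" by simp
      have [measurable]: "\<And>i. s i \<in> borel_measurable M" "f \<in> borel_measurable M" using lim by auto
      have "(\<lambda>i. \<integral>x. \<bar>f x - s i x\<bar> \<partial>M) \<longlonglongrightarrow> (\<integral>x. 0 \<partial>M)"
      proof (rule integral_dominated_convergence[where w = "\<lambda>x. 3 * \<bar>f x\<bar>"])
        show "integrable M (\<lambda>x. 3 * \<bar>f x\<bar>)" using lim by simp
        have "(\<lambda>i. \<bar>f x - s i x\<bar>) \<longlonglongrightarrow> 0" for x
          using tendsto_rabs[OF tendsto_diff[OF tendsto_const[of "f x"] lim.hyps(2)[of x]]] sp by simp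
        then show "AE x in M. (\<lambda>i. \<bar>f x - s i x\<bar>) \<longlonglongrightarrow> 0" by simp
        have "norm \<bar>f x - s i x\<bar> \<le> 3 * \<bar>f x\<bar>" for i x
          using lim.hyps(3)[of x i] sp by simp
        then show "AE x in M. norm \<bar>f x - s i x\<bar> \<le> 3 * \<bar>f x\<bar>" for i by simp
      qed auto
      then have "(\<lambda>i. \<integral>x. \<bar>f x - s i x\<bar> \<partial>M) \<longlonglongrightarrow> 0" by simp
      from order_tendstoD(2)[OF this e2] obtain i where i: "(\<integral>x. \<bar>f x - s i x\<bar> \<partial>M) < \<epsilon> / 2"
        by (auto simp: eventually_sequentially)
      obtain g where g: "continuous_on UNIV g" "integrable M g" "(\<integral>x. \<bar>s i x - g x\<bar> \<partial>M) < \<epsilon> / 2"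
        using lim.IH e2 by meson
      have "(\<integral>x. \<bar>f x - g x\<bar> \<partial>M) < \<epsilon>"
        using step[OF lim.hyps(4) lim.hyps(1)[of i] g(2)] i g(3) by linarith
      then show "\<exists>g. continuous_on UNIV g \<and> integrable M g \<and> (\<integral>x. \<bar>f x - g x\<bar> \<partial>M) < \<epsilon>"
        using g by blast
    qed
  qed
  then show ?thesis using e by blast
qed

section \<open>The maximal ergodic inequality\<close>

text \<open>
  Hopf's inequality, by Garsia's argument. Let \<open>m N\<close> be the maximum of \<open>S 0\<close>, ..., \<open>S N\<close>, so
  that \<open>m N\<close> is nonnegative. Where it is positive it equals some
  \<open>S (Suc n) = g + E (S n)\<close> with $n < N$, which is at most \<open>g + E (m N)\<close>; elsewhere it is 0, which
  is at most \<open>E (m N)\<close>. So the integral of \<open>g\<close> over the set where \<open>m N\<close> is positive is at least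
  $\int m_N - \int E\,m_N$, and \<open>E\<close> does not increase integrals of nonnegative functions.
\<close>

lemma maximal_ergodic:
  fixes E :: "('a \<Rightarrow> real) \<Rightarrow> 'a \<Rightarrow> real" and S :: "nat \<Rightarrow> 'a \<Rightarrow> real"
  assumes Eint: "\<And>f. integrable M f \<Longrightarrow> integrable M (E f)"
    and Ediff: "\<And>f g. integrable M f \<Longrightarrow> integrable M g \<Longrightarrow> AE x in M. E (\<lambda>x. f x - g x) x = E f x - E g x"
    and Epos: "\<And>f. integrable M f \<Longrightarrow> AE x in M. f x \<ge> 0 \<Longrightarrow> AE x in M. E f x \<ge> 0"
    and Econtr: "\<And>f. integrable M f \<Longrightarrow> AE x in M. f x \<ge> 0 \<Longrightarrow> (\<integral>x. E f x \<partial>M) \<le> (\<integral>x. f x \<partial>M)"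
    and g: "integrable M g" and S: "\<And>n. integrable M (S n)" "\<And>x. S 0 x = 0"
    and step: "\<And>n. AE x in M. S (Suc n) x = g x + E (S n) x"
  shows "0 \<le> (\<integral>x. indicator {x. \<exists>n\<le>N. 0 < S n x} x * g x \<partial>M)"
proof -
  define m where "m = rec_nat (\<lambda>x::'a. 0::real) (\<lambda>n r x. max (r x) (S (Suc n) x))"
  have m0: "m 0 x = 0" and mS: "m (Suc n) x = max (m n x) (S (Suc n) x)" for n x
    by (simp_all add: m_def)
  have mi: "integrable M (m n)" for n
  proof (induction n)
    case (Suc n)
    have "m (Suc n) = (\<lambda>x. max (m n x) (S (Suc n) x))" by (simp add: mS fun_eq_iff)
    then show ?case using Suc S(1) by simp
  qed (simp add: m_def)
  have mpos: "m n x \<ge> 0" for n x by (induction n) (auto simp: m0 mS)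
  have mge: "n \<le> k \<Longrightarrow> S n x \<le> m k x" for n k x
  proof (induction k)
    case (Suc k)
    then show ?case by (cases "n = Suc k") (auto simp: mS)
  qed (simp add: m0 S(2))
  have mex: "m k x = 0 \<or> (\<exists>n<k. m k x = S (Suc n) x)" for k x
  proof (induction k)
    case (Suc k)
    show ?case
    proof (cases "S (Suc k) x \<le> m k x")
      case True
      then have "m (Suc k) x = m k x" by (simp add: mS max_def)
      then show ?thesis using Suc by (metis less_SucI)
    next
      case False
      then have "m (Suc k) x = S (Suc k) x" by (simp add: mS max_def)
      then show ?thesis by blast
    qed
  qed (simp add: m0)
  define A where "A = {x. \<exists>n\<le>N. 0 < S n x}"
  have A: "x \<in> A \<longleftrightarrow> m N x > 0" for x
  proof
    assume "x \<in> A"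
    then obtain n where "n \<le> N" "0 < S n x" by (auto simp: A_def)
    with mge[of n N x] show "m N x > 0" by linarith
  next
    assume "m N x > 0"
    then obtain n where "n < N" "m N x = S (Suc n) x" using mex[of N x] by auto
    then show "x \<in> A" using \<open>m N x > 0\<close> unfolding A_def by (auto intro!: exI[of _ "Suc n"])
  qed
  have [measurable]: "m N \<in> borel_measurable M" "g \<in> borel_measurable M" using mi g by auto
  have mono: "AE x in M. E (S n) x \<le> E (m N) x" if "n \<le> N" for n
  proof -
    have "AE x in M. E (\<lambda>x. m N x - S n x) x \<ge> 0"
      using mge[OF that] mi S(1) by (intro Epos) auto
    with Ediff[OF mi S(1), of N n] show ?thesis by eventually_elim simp
  qed
  have all: "AE x in M. \<forall>n\<in>{..<N}. S (Suc n) x = g x + E (S n) x \<and> E (S n) x \<le> E (m N) x"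
  proof (intro AE_finite_allI)
    fix n assume "n \<in> {..<N}"
    then have "AE x in M. E (S n) x \<le> E (m N) x" by (intro mono) simp
    with step[of n] show "AE x in M. S (Suc n) x = g x + E (S n) x \<and> E (S n) x \<le> E (m N) x"
      by eventually_elim simp
  qed simp
  have Em: "AE x in M. E (m N) x \<ge> 0" using mi mpos by (intro Epos) auto
  have key: "AE x in M. m N x - E (m N) x \<le> indicator A x * g x"
    using all Em
  proof eventually_elim
    case (elim x)
    show ?case
    proof (cases "x \<in> A")
      case True
      then obtain n where n: "n < N" "m N x = S (Suc n) x" using mex[of N x] A by auto
      then have "S (Suc n) x = g x + E (S n) x" "E (S n) x \<le> E (m N) x" using elim(1) by auto
      then show ?thesis using True n(2) by simp
    next
      case False
      then have "m N x = 0" using A mpos[of N x] by force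
      then show ?thesis using False elim(2) by simp
    qed
  qed
  have ai: "integrable M (\<lambda>x. indicator A x * g x)"
  proof (rule Bochner_Integration.integrable_bound[OF g])
    have "(\<lambda>x. indicator A x * g x) = (\<lambda>x. if m N x > 0 then g x else 0)"
      using A by (auto simp: indicator_def fun_eq_iff)
    then show "(\<lambda>x. indicator A x * g x) \<in> borel_measurable M" by simp
  qed (simp add: indicator_def)
  have "0 \<le> (\<integral>x. m N x \<partial>M) - (\<integral>x. E (m N) x \<partial>M)"
    using Econtr[OF mi[of N]] mpos by simp
  also have "\<dots> = (\<integral>x. m N x - E (m N) x \<partial>M)"
    using mi Eint[OF mi] by simp
  also have "\<dots> \<le> (\<integral>x. indicator A x * g x \<partial>M)"
    using mi Eint[OF mi] ai key by (intro integral_mono_AE) auto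
  finally show ?thesis unfolding A_def .
qed

section \<open>The Jacobi measure on the cube\<close>

locale jacobi_setting =
  fixes \<alpha> \<beta> :: "real^'n"
  assumes alpha: "\<And>i. \<alpha> $ i > - 1/2" and beta: "\<And>i. \<beta> $ i > - 1/2"
begin

abbreviation \<mu> where "\<mu> \<equiv> jacobi_measure \<alpha> \<beta>"
abbreviation jac where "jac \<equiv> multi_jacobi \<alpha> \<beta>"
abbreviation lam where "lam \<equiv> jacobi_eigenvalue \<alpha> \<beta>"
abbreviation jac1 where "jac1 i n \<equiv> jacobi_poly (\<alpha> $ i) (\<beta> $ i) n"

definition dens :: "real^'n \<Rightarrow> real" where
  "dens x = (\<Prod>i\<in>UNIV. jacobi_density (\<alpha> $ i) (\<beta> $ i) (x $ i))"

lemma params: "\<alpha> $ i > -1" "\<beta> $ i > -1" "\<alpha> $ i + \<beta> $ i > -1"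
  using alpha[of i] beta[of i] by auto

lemma mu_eq: "\<mu> = density lborel (\<lambda>x. ennreal (dens x))"
  by (simp add: jacobi_measure_def dens_def)

lemma dens_measurable [measurable]: "dens \<in> borel_measurable borel"
  unfolding dens_def by measurable

lemma dens_nonneg: "dens x \<ge> 0"
  unfolding dens_def by (intro prod_nonneg jacobi_density_nonneg params)

lemma sets_mu [measurable_cong]: "sets \<mu> = sets borel"
  by (simp add: mu_eq)

lemma space_mu [simp]: "space \<mu> = UNIV"
  by (simp add: mu_eq)

lemma integrable_mu_prod:
  fixes q :: "'n \<Rightarrow> real poly"
  shows "integrable \<mu> (\<lambda>x. \<Prod>i\<in>UNIV. poly (q i) (x $ i))"
    and "(\<integral>x. (\<Prod>i\<in>UNIV. poly (q i) (x $ i)) \<partial>\<mu>) =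
       (\<Prod>i\<in>UNIV. \<integral>t. poly (q i) t \<partial>jacobi_measure1 (\<alpha> $ i) (\<beta> $ i))"
proof -
  let ?g = "\<lambda>i t. jacobi_density (\<alpha> $ i) (\<beta> $ i) t * poly (q i) t"
  have m: "(\<lambda>x::real^'n. \<Prod>i\<in>UNIV. poly (q i) (x $ i)) \<in> borel_measurable borel" by measurable
  have e: "dens x * (\<Prod>i\<in>UNIV. poly (q i) (x $ i)) = (\<Prod>i\<in>UNIV. ?g i (x $ i))" for x
    by (simp add: dens_def prod.distrib)
  have g: "integrable lborel (?g i)" for i
    by (rule integrable_jacobi_density_times_poly[OF params(1,2)])
  show "integrable \<mu> (\<lambda>x. \<Prod>i\<in>UNIV. poly (q i) (x $ i))"
    unfolding mu_eq using integrable_lborel_vec_prod[of ?g, OF g] dens_nonneg m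
    by (subst integrable_density) (auto simp: e)
  have "(\<integral>x. (\<Prod>i\<in>UNIV. poly (q i) (x $ i)) \<partial>\<mu>) = (\<integral>x. (\<Prod>i\<in>UNIV. ?g i (x $ i)) \<partial>lborel)"
    unfolding mu_eq using dens_nonneg m by (subst integral_density) (auto simp: e)
  also have "\<dots> = (\<Prod>i\<in>UNIV. \<integral>t. ?g i t \<partial>lborel)"
    by (rule integral_lborel_vec_prod[OF g])
  finally show "(\<integral>x. (\<Prod>i\<in>UNIV. poly (q i) (x $ i)) \<partial>\<mu>) =
       (\<Prod>i\<in>UNIV. \<integral>t. poly (q i) t \<partial>jacobi_measure1 (\<alpha> $ i) (\<beta> $ i))"
    by (simp add: integral_jacobi_measure1[OF params(1,2)])
qed

sublocale finite_measure \<mu>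
proof
  have "integrable \<mu> (\<lambda>x. 1 :: real)"
    using integrable_mu_prod(1)[of "\<lambda>_. 1"] by simp
  then show "emeasure \<mu> (space \<mu>) \<noteq> \<infinity>"
    by (simp add: integrable_iff_bounded less_top[symmetric])
qed

lemma AE_cube: "AE x in \<mu>. x \<in> jacobi_cube"
proof -
  have "x \<in> jacobi_cube" if "dens x > 0" for x
  proof (rule ccontr)
    assume "x \<notin> jacobi_cube"
    then obtain i where "x $ i \<notin> {-1..1}" by (auto simp: jacobi_cube_def)
    then have "jacobi_density (\<alpha> $ i) (\<beta> $ i) (x $ i) = 0" by (simp add: jacobi_density_def)
    then have "dens x = 0" unfolding dens_def by (intro prod_zero) auto
    then show False using that by simp
  qed
  then show ?thesis unfolding mu_eq by (subst AE_density) auto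
qed

lemma cube_eq: "(jacobi_cube :: (real^'n) set) = cbox (\<chi> i. -1) (\<chi> i. 1)"
  by (auto simp: jacobi_cube_def cbox_def Basis_vec_def inner_axis)

lemma compact_cube: "compact (jacobi_cube :: (real^'n) set)"
  unfolding cube_eq by (rule compact_cbox)

lemma cube_borel [measurable]: "(jacobi_cube :: (real^'n) set) \<in> sets borel"
  using compact_cube by (intro borel_closed compact_imp_closed)

lemma zero_in_cube: "0 \<in> (jacobi_cube :: (real^'n) set)"
  by (simp add: jacobi_cube_def)

lemma jac_measurable [measurable]: "jac \<kappa> \<in> borel_measurable borel"
  unfolding multi_jacobi_def by measurable

lemma jac_orthonormal: "(\<integral>x. jac \<kappa> x * jac \<iota> x \<partial>\<mu>) = (if \<kappa> = \<iota> then 1 else 0)"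
proof -
  have "(\<integral>x. jac \<kappa> x * jac \<iota> x \<partial>\<mu>) = (\<integral>x. (\<Prod>i\<in>UNIV. poly (jac1 i (\<kappa> $ i) * jac1 i (\<iota> $ i)) (x $ i)) \<partial>\<mu>)"
    by (simp add: multi_jacobi_def prod.distrib)
  also have "\<dots> = (\<Prod>i\<in>UNIV. if \<kappa> $ i = \<iota> $ i then 1 else 0)"
  proof -
    have "poly (jac1 i m * jac1 i n) = (\<lambda>t. poly (jac1 i m) t * poly (jac1 i n) t)" for i m n
      by auto
    then show ?thesis
      unfolding integrable_mu_prod(2) by (simp add: jacobi_poly_orthonormal[OF params])
  qed
  also have "\<dots> = (if \<kappa> = \<iota> then 1 else 0)"
    by (auto simp: vec_eq_iff intro!: prod_zero)
  finally show ?thesis .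
qed

section \<open>Bounds for the multivariate polynomials\<close>

text \<open>
  A bound for the polynomials on the cube whose square is summable against every exponential of the
  total degree. It is fixed by choice because these properties, not its explicit form, carry the
  convergence of all series below.
\<close>

definition ubound :: "nat^'n \<Rightarrow> real" where
  "ubound = (SOME B. (\<forall>\<kappa>. \<forall>x\<in>jacobi_cube. \<bar>jac \<kappa> x\<bar> \<le> B \<kappa>) \<and> (\<forall>\<kappa>. B \<kappa> \<ge> 0) \<and>
     (\<forall>\<epsilon>>0. (\<lambda>\<kappa>. (B \<kappa>)\<^sup>2 * exp (- (\<Sum>i\<in>UNIV. real (\<kappa> $ i)) * \<epsilon>)) summable_on UNIV))"

text \<open>
  The product of the one-dimensional bounds. Its square times the exponential factorizes over the
  coordinates, so the sum over multi-indices reduces to one-dimensional series.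
\<close>

lemma ubound_exists: "\<exists>B. (\<forall>\<kappa>. \<forall>x\<in>jacobi_cube. \<bar>jac \<kappa> x\<bar> \<le> B \<kappa>) \<and> (\<forall>\<kappa>. B \<kappa> \<ge> 0) \<and>
     (\<forall>\<epsilon>>0. (\<lambda>\<kappa>. (B \<kappa>)\<^sup>2 * exp (- (\<Sum>i\<in>UNIV. real (\<kappa> $ i)) * \<epsilon>)) summable_on UNIV)"
proof -
  have "\<forall>i. \<exists>K m. K > 0 \<and> (\<forall>n. \<forall>x\<in>{-1..1}. \<bar>poly (jac1 i n) x\<bar> \<le> K * (real n + 1) ^ m)"
    using jacobi_poly_sup_bound[OF alpha beta] by blast
  then obtain K m where K: "\<And>i::'n. K i > 0"
    and b: "\<And>i n x. x \<in> {-1..1} \<Longrightarrow> \<bar>poly (jac1 i n) x\<bar> \<le> K i * (real n + 1) ^ m i"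
    by metis
  define B where "B = (\<lambda>\<kappa>::nat^'n. \<Prod>i\<in>UNIV. K i * (real (\<kappa> $ i) + 1) ^ m i)"
  have "\<bar>jac \<kappa> x\<bar> \<le> B \<kappa>" if "x \<in> jacobi_cube" for \<kappa> x
    unfolding multi_jacobi_def B_def abs_prod
    using that b by (intro prod_mono) (auto simp: jacobi_cube_def)
  moreover have "B \<kappa> \<ge> 0" for \<kappa>
    unfolding B_def using K by (intro prod_nonneg) (simp add: less_imp_le)
  moreover have "(\<lambda>\<kappa>. (B \<kappa>)\<^sup>2 * exp (- (\<Sum>i\<in>UNIV. real (\<kappa> $ i)) * \<epsilon>)) summable_on UNIV" if eps: "\<epsilon> > 0" for \<epsilon>
  proof -
    define G where "G = (\<lambda>i n. (K i)\<^sup>2 * exp \<epsilon> * ((real n + 1) ^ (2 * m i) * exp (- (real n + 1) * \<epsilon>)))"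
    have "(\<lambda>\<kappa>::nat^'n. \<Prod>i\<in>UNIV. G i (\<kappa> $ i)) summable_on UNIV"
    proof (rule summable_on_vec_prod)
      show "summable (G i)" for i
        unfolding G_def using summable_poly_exp[OF eps]
        by (intro summable_mult summable_on_imp_summable)
    qed (simp add: G_def)
    moreover have "(\<Prod>i\<in>UNIV. G i (\<kappa> $ i)) = (B \<kappa>)\<^sup>2 * exp (- (\<Sum>i\<in>UNIV. real (\<kappa> $ i)) * \<epsilon>)" for \<kappa>
    proof -
      have "G i n = (K i * (real n + 1) ^ m i)\<^sup>2 * exp (- real n * \<epsilon>)" for i n
      proof -
        have "exp \<epsilon> * exp (- (real n + 1) * \<epsilon>) = exp (- real n * \<epsilon>)" by (simp add: algebra_simps flip: exp_add)
        then show ?thesis by (simp add: G_def power_mult_distrib power_mult mult_ac)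
      qed
      then have "(\<Prod>i\<in>UNIV. G i (\<kappa> $ i)) = (B \<kappa>)\<^sup>2 * (\<Prod>i\<in>UNIV. exp (- real (\<kappa> $ i) * \<epsilon>))"
        by (simp add: B_def prod.distrib power_mult_distrib prod_power_distrib)
      also have "(\<Prod>i\<in>UNIV. exp (- real (\<kappa> $ i) * \<epsilon>)) = exp (- (\<Sum>i\<in>UNIV. real (\<kappa> $ i)) * \<epsilon>)"
        by (simp add: sum_distrib_right sum_negf flip: exp_sum)
      finally show ?thesis .
    qed
    ultimately show ?thesis by simp
  qed
  ultimately show ?thesis by blast
qed

lemma jac_le_ubound: "x \<in> jacobi_cube \<Longrightarrow> \<bar>jac \<kappa> x\<bar> \<le> ubound \<kappa>"
  and ubound_nonneg: "ubound \<kappa> \<ge> 0"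
  and ubound_summable: "\<epsilon> > 0 \<Longrightarrow> (\<lambda>\<kappa>. (ubound \<kappa>)\<^sup>2 * exp (- (\<Sum>i\<in>UNIV. real (\<kappa> $ i)) * \<epsilon>)) summable_on UNIV"
  using someI_ex[OF ubound_exists, folded ubound_def] by blast+

lemma eigenvalue_term: "real (\<kappa> $ i) * real (\<kappa> $ i) \<le> real (\<kappa> $ i) * (real (\<kappa> $ i) + \<alpha> $ i + \<beta> $ i + 1)"
  using params[of i] by (intro mult_left_mono) auto

lemma lam_ge: "(\<Sum>i\<in>UNIV. real (\<kappa> $ i)) \<le> lam \<kappa>"
  unfolding jacobi_eigenvalue_def
proof (rule sum_mono)
  fix i
  have "real (\<kappa> $ i) \<le> real (\<kappa> $ i) * real (\<kappa> $ i)"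
    by (cases "\<kappa> $ i") auto
  also note eigenvalue_term
  finally show "real (\<kappa> $ i) \<le> real (\<kappa> $ i) * (real (\<kappa> $ i) + \<alpha> $ i + \<beta> $ i + 1)" .
qed

lemma lam_nonneg: "lam \<kappa> \<ge> 0"
  using lam_ge[of \<kappa>] by (rule order_trans[rotated]) (simp add: sum_nonneg)

definition nu :: "nat^'n \<Rightarrow> real" where "nu \<kappa> = sqrt (lam \<kappa>)"

lemma nu_nonneg: "nu \<kappa> \<ge> 0" by (simp add: nu_def lam_nonneg)

text \<open>
  The square root of the eigenvalue dominates every single degree, hence their mean.
\<close>

lemma nu_ge: "(\<Sum>i\<in>UNIV. real (\<kappa> $ i)) \<le> real CARD('n) * nu \<kappa>"
proof -
  have "real (\<kappa> $ i) \<le> nu \<kappa>" for i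
  proof -
    have "(real (\<kappa> $ i))\<^sup>2 \<le> real (\<kappa> $ i) * (real (\<kappa> $ i) + \<alpha> $ i + \<beta> $ i + 1)"
      using eigenvalue_term by (simp add: power2_eq_square)
    also have "\<dots> \<le> lam \<kappa>" unfolding jacobi_eigenvalue_def
    proof (rule member_le_sum)
      show "0 \<le> real (\<kappa> $ j) * (real (\<kappa> $ j) + \<alpha> $ j + \<beta> $ j + 1)" for j
        using eigenvalue_term[of \<kappa> j] by (rule order_trans[rotated]) simp
    qed auto
    finally show ?thesis unfolding nu_def by (rule real_le_rsqrt)
  qed
  then show ?thesis using sum_mono[of UNIV "\<lambda>i. real (\<kappa> $ i)" "\<lambda>_. nu \<kappa>"] by simp
qed

lemma ubound_summable_lam:
  assumes eps: "\<epsilon> > 0"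
  shows "(\<lambda>\<kappa>. (ubound \<kappa>)\<^sup>2 * exp (- lam \<kappa> * \<epsilon>)) summable_on UNIV"
  by (rule summable_on_comparison_test[OF ubound_summable[OF eps]])
     (use lam_ge eps in \<open>auto intro!: mult_left_mono mult_right_mono\<close>)

lemma ubound_summable_nu:
  assumes eps: "\<epsilon> > 0"
  shows "(\<lambda>\<kappa>. (ubound \<kappa>)\<^sup>2 * exp (- nu \<kappa> * \<epsilon>)) summable_on UNIV"
proof (rule summable_on_comparison_test[OF ubound_summable[of "\<epsilon> / real CARD('n)"]])
  fix \<kappa> :: "nat^'n"
  have "(\<Sum>i\<in>UNIV. real (\<kappa> $ i)) * (\<epsilon> / real CARD('n)) \<le> (real CARD('n) * nu \<kappa>) * (\<epsilon> / real CARD('n))"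
    using eps by (intro mult_right_mono nu_ge) auto
  also have "\<dots> = nu \<kappa> * \<epsilon>" by simp
  finally show "(ubound \<kappa>)\<^sup>2 * exp (- nu \<kappa> * \<epsilon>) \<le> (ubound \<kappa>)\<^sup>2 * exp (- (\<Sum>i\<in>UNIV. real (\<kappa> $ i)) * (\<epsilon> / real CARD('n)))"
    by (intro mult_left_mono) auto
qed (use eps in auto)

text \<open>
  By \<open>jacobi_poly_growth\<close> the square grows like $e^{4\sqrt{lX}}$ with $X = |t-1|$. The
  arithmetic-geometric mean inequality gives $4\sqrt{lX} \le ls/2 + 8X/s$, so half of the decay of
  $e^{-ls}$ survives.
\<close>

lemma summable_poly_square_gauss:
  assumes s: "s > 0"
  shows "summable (\<lambda>n. (poly (jac1 i n) t)\<^sup>2 * exp (- (real n * (real n + \<alpha> $ i + \<beta> $ i + 1)) * s))"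
proof -
  define l where "l = (\<lambda>n. real n * (real n + \<alpha> $ i + \<beta> $ i + 1))"
  define X where "X = \<bar>t - 1\<bar>"
  have l_ge: "real n \<le> l n" for n
  proof -
    have "real n \<le> real n * real n" by (cases n) auto
    also have "\<dots> \<le> l n" unfolding l_def using params[of i] by (intro mult_left_mono) auto
    finally show ?thesis .
  qed
  obtain K m where K: "K > 0" and b: "\<And>n x. x \<in> {-1..1} \<Longrightarrow> \<bar>poly (jac1 i n) x\<bar> \<le> K * (real n + 1) ^ m"
    using jacobi_poly_sup_bound[OF alpha beta] by blast
  define C where "C = K\<^sup>2 * exp (8 * X / s + s / 2)"
  have "summable (\<lambda>n. C * ((real n + 1) ^ (2 * m) * exp (- (real n + 1) * (s / 2))))"
    using s by (intro summable_mult summable_on_imp_summable summable_poly_exp) simp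
  then show ?thesis
  proof (rule summable_comparison_test'[where N = 0])
    fix n
    have "sqrt ((l n * s / 2) * (8 * X / s)) \<le> (l n * s / 2 + 8 * X / s) / 2"
      using s l_ge[of n] by (intro arith_geo_mean_sqrt) (auto simp: X_def)
    moreover have "(l n * s / 2) * (8 * X / s) = 4 * (l n * X)" using s by simp
    ultimately have am: "4 * sqrt (l n * X) \<le> l n * s / 2 + 8 * X / s" by (simp add: real_sqrt_mult)
    have "\<bar>poly (jac1 i n) t\<bar> \<le> \<bar>poly (jac1 i n) 1\<bar> * exp (2 * sqrt (l n * X))"
      unfolding l_def X_def by (rule jacobi_poly_growth[OF alpha beta])
    also have "\<dots> \<le> (K * (real n + 1) ^ m) * exp (2 * sqrt (l n * X))"
      by (intro mult_right_mono b) auto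
    finally have "\<bar>poly (jac1 i n) t\<bar>\<^sup>2 \<le> ((K * (real n + 1) ^ m) * exp (2 * sqrt (l n * X)))\<^sup>2"
      by (intro power_mono) auto
    also have "\<dots> = K\<^sup>2 * (real n + 1) ^ (2 * m) * exp (4 * sqrt (l n * X))"
      by (simp add: power_mult_distrib power_mult mult.commute flip: exp_double)
    finally have "(poly (jac1 i n) t)\<^sup>2 * exp (- l n * s)
        \<le> K\<^sup>2 * (real n + 1) ^ (2 * m) * exp (4 * sqrt (l n * X)) * exp (- l n * s)"
      by (simp add: mult_right_mono)
    also have "\<dots> = K\<^sup>2 * (real n + 1) ^ (2 * m) * exp (4 * sqrt (l n * X) - l n * s)"
      by (simp add: exp_diff exp_minus field_simps)
    also have "\<dots> \<le> K\<^sup>2 * (real n + 1) ^ (2 * m) * exp (8 * X / s + s / 2 + - (real n + 1) * (s / 2))"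
    proof (intro mult_left_mono)
      have e1: "- (real n + 1) * (s / 2) = - (real n * (s / 2)) - s / 2" by (simp add: field_simps)
      have "real n * (s / 2) \<le> l n * (s / 2)" using l_ge s by (intro mult_right_mono) auto
      then show "exp (4 * sqrt (l n * X) - l n * s) \<le> exp (8 * X / s + s / 2 + - (real n + 1) * (s / 2))"
        unfolding exp_le_cancel_iff e1 using am by linarith
    qed auto
    also have "\<dots> = C * ((real n + 1) ^ (2 * m) * exp (- (real n + 1) * (s / 2)))"
      unfolding C_def exp_add by (simp only: mult_ac)
    finally show "norm ((poly (jac1 i n) t)\<^sup>2 * exp (- (real n * (real n + \<alpha> $ i + \<beta> $ i + 1)) * s))
        \<le> C * ((real n + 1) ^ (2 * m) * exp (- (real n + 1) * (s / 2)))"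
      by (simp add: l_def)
  qed
qed

text \<open>
  This holds for points on and off the cube, so that the series for the heat semigroup is valid at
  every point of the space. The product of the two bounds is split into a sum of squares: one square
  is controlled on the cube by \<open>ubound_summable\<close>, the other factorizes over the coordinates.
\<close>

lemma jac_growth_summable:
  assumes s: "s > 0"
  shows "(\<lambda>\<kappa>. ubound \<kappa> * (\<bar>jac \<kappa> x\<bar> * exp (- lam \<kappa> * s))) summable_on UNIV"
proof -
  define G where "G = (\<lambda>i n. (poly (jac1 i n) (x $ i))\<^sup>2 * exp (- (real n * (real n + \<alpha> $ i + \<beta> $ i + 1)) * s))"
  have "(\<lambda>\<kappa>::nat^'n. \<Prod>i\<in>UNIV. G i (\<kappa> $ i)) summable_on UNIV"
    unfolding G_def by (intro summable_on_vec_prod summable_poly_square_gauss s) simp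
  moreover have "(\<Prod>i\<in>UNIV. G i (\<kappa> $ i)) = (jac \<kappa> x)\<^sup>2 * exp (- lam \<kappa> * s)" for \<kappa>
  proof -
    have "exp (- lam \<kappa> * s) = (\<Prod>i\<in>UNIV. exp (- (real (\<kappa> $ i) * (real (\<kappa> $ i) + \<alpha> $ i + \<beta> $ i + 1)) * s))"
      by (simp add: jacobi_eigenvalue_def sum_distrib_right sum_negf flip: exp_sum)
    then show ?thesis
      by (simp add: G_def multi_jacobi_def prod.distrib prod_power_distrib)
  qed
  ultimately have S: "(\<lambda>\<kappa>. (ubound \<kappa>)\<^sup>2 * exp (- lam \<kappa> * s) + (jac \<kappa> x)\<^sup>2 * exp (- lam \<kappa> * s)) summable_on UNIV"
    by (intro summable_on_add ubound_summable_lam s) simp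
  show ?thesis
  proof (rule summable_on_comparison_test[OF S])
    fix \<kappa>
    have "ubound \<kappa> * \<bar>jac \<kappa> x\<bar> \<le> (ubound \<kappa>)\<^sup>2 + (jac \<kappa> x)\<^sup>2"
      using sum_squares_bound[of "ubound \<kappa>" "\<bar>jac \<kappa> x\<bar>"] mult_nonneg_nonneg[OF ubound_nonneg[of \<kappa>] abs_ge_zero[of "jac \<kappa> x"]]
      by simp
    then have "ubound \<kappa> * \<bar>jac \<kappa> x\<bar> * exp (- lam \<kappa> * s) \<le> ((ubound \<kappa>)\<^sup>2 + (jac \<kappa> x)\<^sup>2) * exp (- lam \<kappa> * s)"
      by (intro mult_right_mono) auto
    then show "ubound \<kappa> * (\<bar>jac \<kappa> x\<bar> * exp (- lam \<kappa> * s)) \<le> (ubound \<kappa>)\<^sup>2 * exp (- lam \<kappa> * s) + (jac \<kappa> x)\<^sup>2 * exp (- lam \<kappa> * s)"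
      by (simp add: algebra_simps)
  qed (simp add: ubound_nonneg)
qed

section \<open>Coefficients and the two semigroups\<close>

lemma times_bounded:
  fixes f g :: "real^'n \<Rightarrow> real"
  assumes f: "integrable \<mu> f" and [measurable]: "g \<in> borel_measurable borel"
    and g: "\<And>x. x \<in> jacobi_cube \<Longrightarrow> \<bar>g x\<bar> \<le> C"
  shows integrable_times_bounded: "integrable \<mu> (\<lambda>x. f x * g x)"
    and integral_times_bounded: "(\<integral>x. \<bar>f x * g x\<bar> \<partial>\<mu>) \<le> C * (\<integral>x. \<bar>f x\<bar> \<partial>\<mu>)"
proof -
  have [measurable]: "f \<in> borel_measurable borel"
    using borel_measurable_integrable[OF f] by (simp add: measurable_cong_sets[OF sets_mu refl])
  have C: "C \<ge> 0" using g[OF zero_in_cube] by (rule order_trans[OF abs_ge_zero])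
  have i: "integrable \<mu> (\<lambda>x. C * \<bar>f x\<bar>)" using f by simp
  have ae: "AE x in \<mu>. \<bar>f x * g x\<bar> \<le> C * \<bar>f x\<bar>"
    using AE_cube
  proof eventually_elim
    case (elim x)
    then have "\<bar>f x\<bar> * \<bar>g x\<bar> \<le> \<bar>f x\<bar> * C" by (intro mult_left_mono g) auto
    then show ?case by (simp add: abs_mult mult.commute)
  qed
  show int: "integrable \<mu> (\<lambda>x. f x * g x)"
    using ae C by (intro Bochner_Integration.integrable_bound[OF i]) auto
  have "(\<integral>x. \<bar>f x * g x\<bar> \<partial>\<mu>) \<le> (\<integral>x. C * \<bar>f x\<bar> \<partial>\<mu>)"
    using int i ae by (intro integral_mono_AE) auto
  then show "(\<integral>x. \<bar>f x * g x\<bar> \<partial>\<mu>) \<le> C * (\<integral>x. \<bar>f x\<bar> \<partial>\<mu>)" by simp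
qed

lemma integrable_bounded_on_cube:
  fixes g :: "real^'n \<Rightarrow> real"
  assumes [measurable]: "g \<in> borel_measurable borel"
    and g: "\<And>x. x \<in> jacobi_cube \<Longrightarrow> \<bar>g x\<bar> \<le> C"
  shows "integrable \<mu> g"
  using integrable_times_bounded[of "\<lambda>_. 1" g C] assms by simp

definition jcoeff :: "(real^'n \<Rightarrow> real) \<Rightarrow> nat^'n \<Rightarrow> real" where
  "jcoeff f \<kappa> = (\<integral>y. f y * jac \<kappa> y \<partial>\<mu>)"

lemma integrable_times_jac: "integrable \<mu> f \<Longrightarrow> integrable \<mu> (\<lambda>y. f y * jac \<kappa> y)"
  by (rule integrable_times_bounded[OF _ jac_measurable jac_le_ubound])

lemma jcoeff_le:
  assumes "integrable \<mu> f"
  shows "\<bar>jcoeff f \<kappa>\<bar> \<le> ubound \<kappa> * (\<integral>y. \<bar>f y\<bar> \<partial>\<mu>)"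
proof -
  have "\<bar>jcoeff f \<kappa>\<bar> \<le> (\<integral>y. \<bar>f y * jac \<kappa> y\<bar> \<partial>\<mu>)"
    unfolding jcoeff_def by (rule integral_abs_bound)
  also have "\<dots> \<le> ubound \<kappa> * (\<integral>y. \<bar>f y\<bar> \<partial>\<mu>)"
    by (rule integral_times_bounded[OF assms jac_measurable jac_le_ubound])
  finally show ?thesis .
qed

lemma jcoeff_add: "integrable \<mu> f \<Longrightarrow> integrable \<mu> g \<Longrightarrow> jcoeff (\<lambda>x. f x + g x) \<kappa> = jcoeff f \<kappa> + jcoeff g \<kappa>"
  unfolding jcoeff_def distrib_right by (intro Bochner_Integration.integral_add integrable_times_jac)

lemma jcoeff_diff: "integrable \<mu> f \<Longrightarrow> integrable \<mu> g \<Longrightarrow> jcoeff (\<lambda>x. f x - g x) \<kappa> = jcoeff f \<kappa> - jcoeff g \<kappa>"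
  unfolding jcoeff_def left_diff_distrib by (intro Bochner_Integration.integral_diff integrable_times_jac)

lemma coeff_product_bound:
  assumes f: "integrable \<mu> f" and x: "x \<in> jacobi_cube"
  shows "\<bar>jcoeff f \<kappa> * jac \<kappa> x\<bar> \<le> (\<integral>y. \<bar>f y\<bar> \<partial>\<mu>) * (ubound \<kappa>)\<^sup>2"
proof -
  have "\<bar>jcoeff f \<kappa>\<bar> * \<bar>jac \<kappa> x\<bar> \<le> (ubound \<kappa> * (\<integral>y. \<bar>f y\<bar> \<partial>\<mu>)) * ubound \<kappa>"
    by (intro mult_mono jcoeff_le f jac_le_ubound x) (auto simp: ubound_nonneg)
  then show ?thesis by (simp add: abs_mult power2_eq_square mult_ac)
qed

lemma summable_lam:
  assumes "\<And>\<kappa>. \<bar>a \<kappa>\<bar> \<le> C * (ubound \<kappa>)\<^sup>2" "t > 0"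
  shows "(\<lambda>\<kappa>. a \<kappa> * exp (- lam \<kappa> * t)) summable_on UNIV"
  by (rule summable_on_bounded[OF summable_on_cmult_right[OF ubound_summable_lam[OF assms(2)], of C]])
     (use assms(1) in \<open>simp add: abs_mult mult_right_mono flip: mult.assoc\<close>)

lemma summable_nu:
  assumes "\<And>\<kappa>. \<bar>a \<kappa>\<bar> \<le> C * (ubound \<kappa>)\<^sup>2" "t > 0"
  shows "(\<lambda>\<kappa>. a \<kappa> * exp (- nu \<kappa> * t)) summable_on UNIV"
  by (rule summable_on_bounded[OF summable_on_cmult_right[OF ubound_summable_nu[OF assms(2)], of C]])
     (use assms(1) in \<open>simp add: abs_mult mult_right_mono flip: mult.assoc\<close>)

text \<open>
  Fubini for the kernel series. The integration variable stays in the cube up to a null set, where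
  \<open>ubound\<close> applies; the point \<open>x\<close> is arbitrary, by \<open>jac_growth_summable\<close>.
\<close>

lemma jacobi_semigroup_series:
  assumes f: "integrable \<mu> f" and s: "s > 0"
  shows "jacobi_semigroup \<alpha> \<beta> s f x = (\<Sum>\<^sub>\<infinity>\<kappa>\<in>UNIV. jcoeff f \<kappa> * jac \<kappa> x * exp (- lam \<kappa> * s))"
proof -
  obtain e :: "nat \<Rightarrow> nat^'n" where e: "bij e" using bij_nat_vec by blast
  let ?c = "\<lambda>\<kappa>. jac \<kappa> x * exp (- lam \<kappa> * s)"
  let ?g = "\<lambda>\<kappa> y. f y * jac \<kappa> y * ?c \<kappa>"
  have abs_c: "\<bar>?c \<kappa>\<bar> = \<bar>jac \<kappa> x\<bar> * exp (- lam \<kappa> * s)" for \<kappa> by (simp add: abs_mult)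
  have "jacobi_semigroup \<alpha> \<beta> s f x = (\<integral>y. (\<Sum>\<^sub>\<infinity>\<kappa>\<in>UNIV. ?g \<kappa> y) \<partial>\<mu>)"
    using s unfolding jacobi_semigroup_def jacobi_kernel_def
    by (simp add: mult_ac flip: infsum_cmult_right')
  also have "\<dots> = (\<Sum>\<^sub>\<infinity>\<kappa>\<in>UNIV. \<integral>y. ?g \<kappa> y \<partial>\<mu>)"
  proof (rule integral_infsum(2)[OF e])
    show "integrable \<mu> (?g \<kappa>)" for \<kappa>
      using integrable_times_jac[OF f] by (rule integrable_mult_left)
    show "AE y in \<mu>. (\<lambda>\<kappa>. ?g \<kappa> y) summable_on UNIV"
      using AE_cube
    proof eventually_elim
      case (elim y)
      show ?case
      proof (rule summable_on_bounded[OF summable_on_cmult_right[OF jac_growth_summable[OF s, of x], of "\<bar>f y\<bar>"]])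
        show "\<bar>?g \<kappa> y\<bar> \<le> \<bar>f y\<bar> * (ubound \<kappa> * (\<bar>jac \<kappa> x\<bar> * exp (- lam \<kappa> * s)))" for \<kappa>
          unfolding abs_mult[of "f y * jac \<kappa> y"] abs_c unfolding abs_mult mult.assoc
          by (intro mult_left_mono mult_right_mono jac_le_ubound elim) auto
      qed
    qed
    show "(\<lambda>\<kappa>. \<integral>y. \<bar>?g \<kappa> y\<bar> \<partial>\<mu>) summable_on UNIV"
    proof (rule summable_on_bounded[OF summable_on_cmult_right[OF jac_growth_summable[OF s, of x], of "\<integral>y. \<bar>f y\<bar> \<partial>\<mu>"]])
      fix \<kappa>
      have "(\<integral>y. \<bar>?g \<kappa> y\<bar> \<partial>\<mu>) = (\<integral>y. \<bar>f y * jac \<kappa> y\<bar> \<partial>\<mu>) * \<bar>?c \<kappa>\<bar>"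
        by (subst abs_mult) (rule integral_mult_left_zero)
      also have "\<dots> \<le> (ubound \<kappa> * (\<integral>y. \<bar>f y\<bar> \<partial>\<mu>)) * \<bar>?c \<kappa>\<bar>"
        by (intro mult_right_mono integral_times_bounded[OF f jac_measurable jac_le_ubound]) auto
      finally show "\<bar>\<integral>y. \<bar>?g \<kappa> y\<bar> \<partial>\<mu>\<bar> \<le> (\<integral>y. \<bar>f y\<bar> \<partial>\<mu>) * (ubound \<kappa> * (\<bar>jac \<kappa> x\<bar> * exp (- lam \<kappa> * s)))"
        unfolding abs_c by (simp add: mult_ac)
    qed
  qed
  also have "\<dots> = (\<Sum>\<^sub>\<infinity>\<kappa>\<in>UNIV. jcoeff f \<kappa> * jac \<kappa> x * exp (- lam \<kappa> * s))"
    unfolding integral_mult_left_zero jcoeff_def by (simp only: mult.assoc)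
  finally show ?thesis .
qed

text \<open>
  The Poisson semigroup on the cube as a series, see \<open>poisson_series\<close>. In this form the semigroup
  law, the conservation of integrals and the smoothness in \<open>t\<close> are visible.
\<close>

definition pois :: "real \<Rightarrow> (real^'n \<Rightarrow> real) \<Rightarrow> real^'n \<Rightarrow> real" where
  "pois t f x = (\<Sum>\<^sub>\<infinity>\<kappa>\<in>UNIV. jcoeff f \<kappa> * jac \<kappa> x * exp (- nu \<kappa> * t))"

text \<open>
  The sum over the modes and the subordination integral are exchanged; each mode contributes
  $e^{-\nu t}$ by the subordination identity with $b = \nu t$.
\<close>

lemma poisson_series:
  assumes f: "integrable \<mu> f" and x: "x \<in> jacobi_cube" and t: "t > 0"
  shows poisson_integrable: "set_integrable lborel {0<..} (\<lambda>u. exp (- u) / sqrt u * jacobi_semigroup \<alpha> \<beta> (t\<^sup>2 / (4 * u)) f x)"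
    and poisson_eq_pois: "poisson_jacobi \<alpha> \<beta> t f x = pois t f x"
proof -
  obtain e :: "nat \<Rightarrow> nat^'n" where e: "bij e" using bij_nat_vec by blast
  define a where "a = (\<lambda>\<kappa>. jcoeff f \<kappa> * jac \<kappa> x)"
  define F where "F = (\<integral>y. \<bar>f y\<bar> \<partial>\<mu>)"
  have a: "\<bar>a \<kappa>\<bar> \<le> F * (ubound \<kappa>)\<^sup>2" for \<kappa>
    unfolding a_def F_def by (rule coeff_product_bound[OF f x])
  let ?w = "\<lambda>\<kappa> u. indicator {0<..} u *\<^sub>R (exp (- u) / sqrt u * exp (- ((nu \<kappa> * t)\<^sup>2 / (4 * u))))"
  have w: "integrable lborel (?w \<kappa>)" "(\<integral>u. ?w \<kappa> u \<partial>lborel) = sqrt pi * exp (- nu \<kappa> * t)" for \<kappa>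
    using subordination[of "nu \<kappa> * t"] nu_nonneg[of \<kappa>] t
    by (simp_all add: set_integrable_def set_lebesgue_integral_def)
  have ex: "(nu \<kappa> * t)\<^sup>2 / (4 * u) = lam \<kappa> * (t\<^sup>2 / (4 * u))" for \<kappa> u
    by (simp add: nu_def power_mult_distrib lam_nonneg)
  let ?g = "\<lambda>\<kappa> u. a \<kappa> * ?w \<kappa> u"
  have eq: "indicator {0<..} u *\<^sub>R (exp (- u) / sqrt u * jacobi_semigroup \<alpha> \<beta> (t\<^sup>2 / (4 * u)) f x)
      = (\<Sum>\<^sub>\<infinity>\<kappa>\<in>UNIV. ?g \<kappa> u)" for u
  proof (cases "u > 0")
    case True
    then have "t\<^sup>2 / (4 * u) > 0" using t by simp
    from jacobi_semigroup_series[OF f this] True show ?thesis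
      unfolding ex by (simp add: a_def mult_ac flip: infsum_cmult_right')
  qed simp
  have ints: "integrable lborel (?g \<kappa>)" for \<kappa>
    using w(1) by (rule integrable_mult_right)
  have ae: "(\<lambda>\<kappa>. ?g \<kappa> u) summable_on UNIV" for u
  proof (cases "u > 0")
    case True
    then have "t\<^sup>2 / (4 * u) > 0" using t by simp
    from summable_on_cmult_right[OF summable_lam[OF a this], of "exp (- u) / sqrt u"] True
    show ?thesis unfolding ex by (simp add: mult_ac)
  qed simp
  have abs: "\<bar>?g \<kappa> u\<bar> = \<bar>a \<kappa>\<bar> * ?w \<kappa> u" for \<kappa> u by (simp add: abs_mult indicator_def)
  have sm: "(\<lambda>\<kappa>. \<integral>u. \<bar>?g \<kappa> u\<bar> \<partial>lborel) summable_on UNIV"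
  proof -
    have "(\<lambda>\<kappa>. sqrt pi * (\<bar>a \<kappa>\<bar> * exp (- nu \<kappa> * t))) summable_on UNIV"
      using summable_nu[of "\<lambda>\<kappa>. \<bar>a \<kappa>\<bar>" F t] a t by (intro summable_on_cmult_right) auto
    moreover have "(\<integral>u. \<bar>?g \<kappa> u\<bar> \<partial>lborel) = sqrt pi * (\<bar>a \<kappa>\<bar> * exp (- nu \<kappa> * t))" for \<kappa>
      unfolding abs integral_mult_right_zero w(2) by (simp add: mult_ac)
    ultimately show ?thesis by (simp only:)
  qed
  note swap = integral_infsum[OF e ints always_eventually[OF allI[OF ae]] sm]
  show "set_integrable lborel {0<..} (\<lambda>u. exp (- u) / sqrt u * jacobi_semigroup \<alpha> \<beta> (t\<^sup>2 / (4 * u)) f x)"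
    unfolding set_integrable_def eq by (rule swap(1))
  have "poisson_jacobi \<alpha> \<beta> t f x = 1 / sqrt pi * (\<Sum>\<^sub>\<infinity>\<kappa>\<in>UNIV. \<integral>u. ?g \<kappa> u \<partial>lborel)"
    unfolding poisson_jacobi_def set_lebesgue_integral_def eq swap(2) ..
  also have "\<dots> = (\<Sum>\<^sub>\<infinity>\<kappa>\<in>UNIV. 1 / sqrt pi * (a \<kappa> * (sqrt pi * exp (- nu \<kappa> * t))))"
    unfolding integral_mult_right_zero w(2) by (rule infsum_cmult_right'[symmetric])
  also have "\<dots> = pois t f x" by (simp add: pois_def a_def mult_ac)
  finally show "poisson_jacobi \<alpha> \<beta> t f x = pois t f x" .
qed

lemma pois_measurable [measurable]: "pois t f \<in> borel_measurable borel"
proof -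
  obtain e :: "nat \<Rightarrow> nat^'n" where e: "bij e" using bij_nat_vec by blast
  show ?thesis unfolding pois_def[abs_def] by (rule borel_measurable_infsum[OF e]) measurable
qed

lemma summable_pois:
  assumes "integrable \<mu> f" "x \<in> jacobi_cube" "t > 0"
  shows "(\<lambda>\<kappa>. jcoeff f \<kappa> * jac \<kappa> x * exp (- nu \<kappa> * t)) summable_on UNIV"
  by (rule summable_nu[OF coeff_product_bound[OF assms(1,2)] assms(3)])

lemma pois_bound:
  assumes f: "integrable \<mu> f" and x: "x \<in> jacobi_cube" and t: "t > 0"
  shows "\<bar>pois t f x\<bar> \<le> (\<Sum>\<^sub>\<infinity>\<kappa>\<in>UNIV. (\<integral>y. \<bar>f y\<bar> \<partial>\<mu>) * ((ubound \<kappa>)\<^sup>2 * exp (- nu \<kappa> * t)))"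
proof -
  let ?u = "\<lambda>\<kappa>. jcoeff f \<kappa> * jac \<kappa> x * exp (- nu \<kappa> * t)"
  let ?v = "\<lambda>\<kappa>. (\<integral>y. \<bar>f y\<bar> \<partial>\<mu>) * ((ubound \<kappa>)\<^sup>2 * exp (- nu \<kappa> * t))"
  have v: "?v summable_on UNIV" by (intro summable_on_cmult_right ubound_summable_nu t)
  have le: "\<bar>?u \<kappa>\<bar> \<le> ?v \<kappa>" for \<kappa>
    using mult_right_mono[OF coeff_product_bound[OF f x, of \<kappa>], of "exp (- nu \<kappa> * t)"]
    by (simp add: abs_mult mult_ac)
  have le1: "?u \<kappa> \<le> ?v \<kappa>" and le2: "- ?v \<kappa> \<le> ?u \<kappa>" for \<kappa>
    using le[of \<kappa>] unfolding abs_le_iff by linarith+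
  have "pois t f x \<le> infsum ?v UNIV"
    unfolding pois_def by (intro infsum_mono summable_pois[OF f x t] v le1)
  moreover have "infsum (\<lambda>\<kappa>. - ?v \<kappa>) UNIV \<le> pois t f x"
    unfolding pois_def
    by (intro infsum_mono summable_pois[OF f x t] summable_on_uminus[THEN iffD2, OF v] le2)
  ultimately show ?thesis by (simp add: infsum_uminus abs_le_iff)
qed

lemma pois_integrable: "integrable \<mu> f \<Longrightarrow> t > 0 \<Longrightarrow> integrable \<mu> (pois t f)"
  by (rule integrable_bounded_on_cube[OF pois_measurable pois_bound])

text \<open>
  Orthonormality leaves one term of the series after integration against a Jacobi polynomial.
\<close>

lemma jcoeff_pois:
  assumes f: "integrable \<mu> f" and t: "t > 0"
  shows "jcoeff (pois t f) \<kappa> = exp (- nu \<kappa> * t) * jcoeff f \<kappa>"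
proof -
  obtain e :: "nat \<Rightarrow> nat^'n" where e: "bij e" using bij_nat_vec by blast
  let ?g = "\<lambda>\<iota> y. (jcoeff f \<iota> * exp (- nu \<iota> * t)) * (jac \<iota> y * jac \<kappa> y)"
  have jj: "integrable \<mu> (\<lambda>y. jac \<iota> y * jac \<kappa> y)" for \<iota>
    by (intro integrable_times_jac integrable_bounded_on_cube[OF jac_measurable jac_le_ubound])
  have "pois t f y * jac \<kappa> y = (\<Sum>\<^sub>\<infinity>\<iota>\<in>UNIV. ?g \<iota> y)" for y
    unfolding pois_def by (subst infsum_cmult_left'[symmetric]) (simp only: mult_ac)
  then have "jcoeff (pois t f) \<kappa> = (\<integral>y. (\<Sum>\<^sub>\<infinity>\<iota>\<in>UNIV. ?g \<iota> y) \<partial>\<mu>)"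
    by (simp only: jcoeff_def)
  also have "\<dots> = (\<Sum>\<^sub>\<infinity>\<iota>\<in>UNIV. \<integral>y. ?g \<iota> y \<partial>\<mu>)"
  proof (rule integral_infsum(2)[OF e])
    show "integrable \<mu> (?g \<iota>)" for \<iota> by (rule integrable_mult_right[OF jj])
    show "AE y in \<mu>. (\<lambda>\<iota>. ?g \<iota> y) summable_on UNIV"
      using AE_cube
    proof eventually_elim
      case (elim y)
      from summable_on_cmult_left[OF summable_pois[OF f elim t], of "jac \<kappa> y"]
      show ?case by (simp add: mult_ac)
    qed
    let ?m = "\<integral>y. \<bar>1::real\<bar> \<partial>\<mu>" and ?F = "\<integral>y. \<bar>f y\<bar> \<partial>\<mu>"
    show "(\<lambda>\<iota>. \<integral>y. \<bar>?g \<iota> y\<bar> \<partial>\<mu>) summable_on UNIV"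
    proof (rule summable_on_bounded[OF summable_on_cmult_right[OF ubound_summable_nu[OF t], of "?F * (?m * ubound \<kappa>)"]])
      fix \<iota>
      have "(\<integral>y. \<bar>?g \<iota> y\<bar> \<partial>\<mu>) = \<bar>jcoeff f \<iota> * exp (- nu \<iota> * t)\<bar> * (\<integral>y. \<bar>1 * (jac \<iota> y * jac \<kappa> y)\<bar> \<partial>\<mu>)"
        by (subst abs_mult) simp
      also have "\<dots> \<le> (ubound \<iota> * ?F * exp (- nu \<iota> * t)) * ((ubound \<iota> * ubound \<kappa>) * ?m)"
      proof (intro mult_mono integral_times_bounded)
        show "\<bar>jcoeff f \<iota> * exp (- nu \<iota> * t)\<bar> \<le> ubound \<iota> * ?F * exp (- nu \<iota> * t)"
          using jcoeff_le[OF f, of \<iota>] by (simp add: abs_mult)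
        show "\<bar>jac \<iota> x * jac \<kappa> x\<bar> \<le> ubound \<iota> * ubound \<kappa>" if "x \<in> jacobi_cube" for x
          unfolding abs_mult using that by (intro mult_mono jac_le_ubound) (auto simp: ubound_nonneg)
      qed (auto simp: ubound_nonneg intro!: mult_nonneg_nonneg)
      finally show "\<bar>\<integral>y. \<bar>?g \<iota> y\<bar> \<partial>\<mu>\<bar> \<le> ?F * (?m * ubound \<kappa>) * ((ubound \<iota>)\<^sup>2 * exp (- nu \<iota> * t))"
        by (simp add: power2_eq_square mult_ac)
    qed
  qed
  also have "\<dots> = (\<Sum>\<^sub>\<infinity>\<iota>\<in>{\<kappa>}. exp (- nu \<kappa> * t) * jcoeff f \<kappa>)"
    unfolding integral_mult_right_zero jac_orthonormal
    by (rule infsum_cong_neutral) auto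
  finally show ?thesis by simp
qed

lemma pois_pois:
  assumes "integrable \<mu> f" "t > 0"
  shows "pois s (pois t f) x = pois (s + t) f x"
proof -
  have "exp (- nu \<kappa> * (s + t)) = exp (- nu \<kappa> * t) * exp (- nu \<kappa> * s)" for \<kappa>
    by (simp add: algebra_simps flip: exp_add)
  note ex = this
  show ?thesis
    unfolding pois_def[of s "pois t f"] pois_def[of "s + t"] jcoeff_pois[OF assms] ex by (simp only: mult_ac)
qed

lemma pois_add:
  assumes "integrable \<mu> f" "integrable \<mu> g" "x \<in> jacobi_cube" "t > 0"
  shows "pois t (\<lambda>x. f x + g x) x = pois t f x + pois t g x"
  unfolding pois_def jcoeff_add[OF assms(1,2)] distrib_right
  by (intro infsum_add summable_pois assms)

lemma pois_diff:
  assumes "integrable \<mu> f" "integrable \<mu> g" "x \<in> jacobi_cube" "t > 0"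
  shows "pois t (\<lambda>x. f x - g x) x = pois t f x - pois t g x"
  using pois_add[OF Bochner_Integration.integrable_diff[OF assms(1,2)] assms(2-4)] by simp

section \<open>The constant mode\<close>

lemma nu_zero [simp]: "nu 0 = 0"
  by (simp add: nu_def jacobi_eigenvalue_def)

text \<open>
  The spectral gap: all modes but the constant one decay at a common exponential rate.
\<close>

lemma nu_ge_nonzero:
  assumes "\<kappa> \<noteq> 0"
  shows "nu \<kappa> \<ge> 1 / real CARD('n)"
proof -
  obtain i where "\<kappa> $ i \<noteq> 0" using assms by (auto simp: vec_eq_iff)
  then have "1 \<le> real (\<kappa> $ i)" by simp
  also have "\<dots> \<le> (\<Sum>i\<in>UNIV. real (\<kappa> $ i))" by (rule member_le_sum) auto
  also have "\<dots> \<le> real CARD('n) * nu \<kappa>" by (rule nu_ge)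
  finally show ?thesis by (simp add: field_simps)
qed

lemma nu_pos: "\<kappa> \<noteq> 0 \<Longrightarrow> nu \<kappa> > 0"
  using nu_ge_nonzero[of \<kappa>] by (smt (verit) of_nat_0_less_iff zero_less_card_finite divide_pos_pos)

lemma jac_zero_const: "\<exists>c. c \<noteq> 0 \<and> (\<forall>x. jac 0 x = c)"
proof -
  have "\<exists>c. c \<noteq> 0 \<and> jac1 i 0 = [:c:]" for i
    using degree_jacobi_poly[OF params, of i 0] by (metis degree_eq_zeroE pCons_0_0)
  then obtain c where c: "\<And>i. c i \<noteq> 0" "\<And>i. jac1 i 0 = [:c i:]" by metis
  then have "jac 0 x = (\<Prod>i\<in>UNIV. c i)" for x by (simp add: multi_jacobi_def)
  moreover have "(\<Prod>i\<in>UNIV. c i) \<noteq> 0" using c by simp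
  ultimately show ?thesis by blast
qed

lemma jcoeff_zero_iff: "(\<integral>y. f y \<partial>\<mu>) = 0 \<longleftrightarrow> jcoeff f 0 = 0"
  using jac_zero_const by (auto simp: jcoeff_def)

lemma integral_pois:
  assumes "integrable \<mu> f" "t > 0"
  shows "(\<integral>x. pois t f x \<partial>\<mu>) = (\<integral>x. f x \<partial>\<mu>)"
proof -
  obtain c where c: "c \<noteq> 0" "\<And>x. jac 0 x = c" using jac_zero_const by auto
  have "jcoeff g 0 = (\<integral>x. g x \<partial>\<mu>) * c" for g by (simp add: jcoeff_def c)
  with jcoeff_pois[OF assms, of 0] c show ?thesis by simp
qed

lemma pois_const:
  assumes "t > 0"
  shows "pois t (\<lambda>_. a) x = a"
proof -
  obtain c where c: "c \<noteq> 0" "\<And>x. jac 0 x = c" using jac_zero_const by auto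
  have "jcoeff (\<lambda>_. a) \<kappa> = (if \<kappa> = 0 then a / c else 0)" for \<kappa>
  proof -
    have "jcoeff (\<lambda>_. a) \<kappa> = (\<integral>y. a / c * (jac 0 y * jac \<kappa> y) \<partial>\<mu>)" using c by (simp add: jcoeff_def)
    then show ?thesis unfolding integral_mult_right_zero jac_orthonormal by auto
  qed
  then have "pois t (\<lambda>_. a) x = (\<Sum>\<^sub>\<infinity>\<kappa>\<in>{0::nat^'n}. a)"
    unfolding pois_def by (intro infsum_cong_neutral) (auto simp: c)
  then show ?thesis by simp
qed

text \<open>
  Mean zero removes the constant mode. By the spectral gap the rest of the series at time \<open>t\<close> is at
  most $e^{-c(t-1)}$ times the absolutely convergent series at time 1.
\<close>

lemma pois_tendsto_zero:
  assumes f: "integrable \<mu> f" and x: "x \<in> jacobi_cube" and z: "(\<integral>y. f y \<partial>\<mu>) = 0"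
  shows "((\<lambda>t. pois t f x) \<longlongrightarrow> 0) at_top"
proof -
  define a where "a = (\<lambda>\<kappa>. jcoeff f \<kappa> * jac \<kappa> x)"
  define c where "c = 1 / real CARD('n)"
  have c: "c > 0" by (simp add: c_def)
  have sa: "(\<lambda>\<kappa>. \<bar>a \<kappa>\<bar> * exp (- nu \<kappa> * 1)) summable_on UNIV"
    unfolding a_def using coeff_product_bound[OF f x] by (intro summable_nu) auto
  define S where "S = (\<Sum>\<^sub>\<infinity>\<kappa>\<in>UNIV. \<bar>a \<kappa>\<bar> * exp (- nu \<kappa> * 1))"
  have "\<bar>pois t f x\<bar> \<le> exp (- c * (t - 1)) * S" if t: "t \<ge> 1" for t
  proof -
    have st: "(\<lambda>\<kappa>. a \<kappa> * exp (- nu \<kappa> * t)) summable_on UNIV"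
      using summable_pois[OF f x, of t] t by (simp add: a_def)
    have sta: "(\<lambda>\<kappa>. \<bar>a \<kappa> * exp (- nu \<kappa> * t)\<bar>) summable_on UNIV"
      using st unfolding summable_on_iff_abs_summable_on_real[of "\<lambda>\<kappa>. a \<kappa> * exp (- nu \<kappa> * t)"] real_norm_def .
    have pa: "pois t f x = (\<Sum>\<^sub>\<infinity>\<kappa>\<in>UNIV. a \<kappa> * exp (- nu \<kappa> * t))"
      by (simp add: pois_def a_def)
    have le: "\<bar>a \<kappa> * exp (- nu \<kappa> * t)\<bar> \<le> exp (- c * (t - 1)) * (\<bar>a \<kappa>\<bar> * exp (- nu \<kappa> * 1))" for \<kappa>
    proof (cases "\<kappa> = 0")
      case True
      then show ?thesis using z by (simp add: a_def jcoeff_zero_iff)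
    next
      case False
      have "nu \<kappa> * t \<ge> c * (t - 1) + nu \<kappa> * 1"
        using mult_right_mono[OF nu_ge_nonzero[OF False], of "t - 1"] t by (simp add: c_def algebra_simps)
      then have "exp (- nu \<kappa> * t) \<le> exp (- c * (t - 1)) * exp (- nu \<kappa> * 1)" by (simp flip: exp_add)
      then have "\<bar>a \<kappa>\<bar> * exp (- nu \<kappa> * t) \<le> \<bar>a \<kappa>\<bar> * (exp (- c * (t - 1)) * exp (- nu \<kappa> * 1))"
        by (rule mult_left_mono) simp
      then show ?thesis by (simp add: abs_mult mult_ac)
    qed
    have "\<bar>pois t f x\<bar> \<le> (\<Sum>\<^sub>\<infinity>\<kappa>\<in>UNIV. \<bar>a \<kappa> * exp (- nu \<kappa> * t)\<bar>)"
      unfolding pa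
      using norm_infsum_bound[of "\<lambda>\<kappa>. a \<kappa> * exp (- nu \<kappa> * t)" UNIV] sta
      unfolding real_norm_def by blast
    also have "\<dots> \<le> (\<Sum>\<^sub>\<infinity>\<kappa>\<in>UNIV. exp (- c * (t - 1)) * (\<bar>a \<kappa>\<bar> * exp (- nu \<kappa> * 1)))"
      by (intro infsum_mono summable_on_cmult_right sa sta le)
    also have "\<dots> = exp (- c * (t - 1)) * S" unfolding S_def by (rule infsum_cmult_right')
    finally show ?thesis .
  qed
  then have "\<forall>\<^sub>F t in at_top. norm (pois t f x) \<le> exp (- c * (t - 1)) * S"
    by (auto intro: eventually_mono[OF eventually_ge_at_top[of 1]])
  moreover have "((\<lambda>t. exp (- c * (t - 1)) * S) \<longlongrightarrow> 0) at_top"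
    using c by real_asymp
  ultimately show ?thesis by (rule Lim_null_comparison)
qed

section \<open>Polynomials as finite expansions\<close>

text \<open>
  Finite linear combinations of multivariate Jacobi polynomials, generated one term at a time so that
  closure under products can be proved by induction.
\<close>

inductive jspan :: "(real^'n \<Rightarrow> real) \<Rightarrow> bool" where
  zero: "jspan (\<lambda>x. 0)"
| step: "jspan f \<Longrightarrow> jspan (\<lambda>x. c * jac \<kappa> x + f x)"

lemma jspan_add: "jspan f \<Longrightarrow> jspan g \<Longrightarrow> jspan (\<lambda>x. f x + g x)"
proof (induction rule: jspan.induct)
  case (step f c \<kappa>)
  from jspan.step[OF step.IH[OF step.prems], of c \<kappa>] show ?case by (simp add: add.assoc)
qed simp

lemma jspan_cmult: "jspan f \<Longrightarrow> jspan (\<lambda>x. a * f x)"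
proof (induction rule: jspan.induct)
  case (step f c \<kappa>)
  from jspan.step[OF step.IH, of "a * c" \<kappa>] show ?case by (simp add: algebra_simps)
qed (simp add: jspan.zero)

lemma jspan_jac: "jspan (\<lambda>x. c * jac \<kappa> x)"
proof -
  have "jspan (\<lambda>x. c * jac \<kappa> x + 0)" by (rule jspan.step[OF jspan.zero])
  then show ?thesis by simp
qed

lemma jspan_sum: "finite A \<Longrightarrow> (\<And>i. i \<in> A \<Longrightarrow> jspan (F i)) \<Longrightarrow> jspan (\<lambda>x. \<Sum>i\<in>A. F i x)"
proof (induction A rule: finite_induct)
  case (insert a A)
  have "jspan (\<lambda>x. F a x + (\<Sum>i\<in>A. F i x))" using insert by (intro jspan_add) auto
  then show ?case using insert.hyps by simp
qed (simp add: jspan.zero)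

text \<open>
  The orthonormal polynomial of degree \<open>n\<close> has degree exactly \<open>n\<close>, so the leading terms can be
  removed one after the other.
\<close>

lemma poly_expansion:
  "degree q \<le> N \<Longrightarrow> \<exists>c. q = (\<Sum>n\<le>N. smult (c n) (jac1 i n))"
proof (induction N arbitrary: q)
  case 0
  obtain a where a: "q = [:a:]" using 0 by (auto elim: degree_eq_zeroE)
  obtain b where b: "jac1 i 0 = [:b:]" "b \<noteq> 0"
    using degree_jacobi_poly[OF params, of i 0] by (metis degree_eq_zeroE pCons_0_0)
  have "q = smult (a / b) (jac1 i 0)" using a b by simp
  then show ?case by (intro exI[of _ "\<lambda>_. a / b"]) simp
next
  case (Suc N)
  let ?p = "jac1 i (Suc N)"
  have l: "coeff ?p (Suc N) \<noteq> 0"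
    using degree_jacobi_poly[OF params, of i "Suc N"] by (metis leading_coeff_0_iff)
  define a where "a = coeff q (Suc N) / coeff ?p (Suc N)"
  define r where "r = q - smult a ?p"
  have "degree r \<le> N"
  proof (rule degree_le, safe)
    fix k assume k: "N < k"
    show "coeff r k = 0"
    proof (cases "k = Suc N")
      case True
      then show ?thesis using l by (simp add: r_def a_def)
    next
      case False
      then have "Suc N < k" using k by simp
      then show ?thesis using Suc.prems degree_jacobi_poly(1)[OF params, of i "Suc N"]
        by (simp add: r_def coeff_eq_0)
    qed
  qed
  then obtain c where c: "r = (\<Sum>n\<le>N. smult (c n) (jac1 i n))" using Suc.IH by blast
  have "q = (\<Sum>n\<le>Suc N. smult ((c(Suc N := a)) n) (jac1 i n))"
    using c by (simp add: r_def algebra_simps)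
  then show ?case by blast
qed

lemma jspan_prod: "jspan (\<lambda>x. \<Prod>i\<in>UNIV. poly (q i) (x $ i))"
proof -
  define N where "N = Max (range (\<lambda>i. degree (q i)))"
  have "degree (q i) \<le> N" for i unfolding N_def by (intro Max_ge) auto
  then have "\<forall>i. \<exists>c. q i = (\<Sum>n\<le>N. smult (c n) (jac1 i n))" using poly_expansion by blast
  then obtain c where c: "\<And>i. q i = (\<Sum>n\<le>N. smult (c i n) (jac1 i n))" by metis
  have "(\<Prod>i\<in>UNIV. poly (q i) (x $ i)) = (\<Sum>\<kappa>\<in>{\<kappa>. \<forall>i. \<kappa> $ i \<le> N}. (\<Prod>i\<in>UNIV. c i (\<kappa> $ i)) * jac \<kappa> x)" for x
  proof -
    have "(\<Prod>i\<in>UNIV. poly (q i) (x $ i)) = (\<Prod>i\<in>UNIV. \<Sum>n\<le>N. c i n * poly (jac1 i n) (x $ i))"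
      by (subst c) (simp add: poly_sum)
    also have "\<dots> = (\<Sum>\<kappa>\<in>{\<kappa>. \<forall>i. \<kappa> $ i \<le> N}. \<Prod>i\<in>UNIV. c i (\<kappa> $ i) * poly (jac1 i (\<kappa> $ i)) (x $ i))"
      by (rule sum_vec_box[symmetric])
    finally show ?thesis by (simp add: prod.distrib multi_jacobi_def)
  qed
  then show ?thesis by (simp only:) (intro jspan_sum finite_vec_box jspan_jac)
qed

lemma jspan_mult_jac: "jspan f \<Longrightarrow> jspan (\<lambda>x. f x * jac \<iota> x)"
proof (induction rule: jspan.induct)
  case (step f c \<kappa>)
  have "jspan (\<lambda>x. c * (jac \<kappa> x * jac \<iota> x))"
    using jspan_cmult[OF jspan_prod[of "\<lambda>i. jac1 i (\<kappa> $ i) * jac1 i (\<iota> $ i)"], of c]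
    by (simp add: multi_jacobi_def prod.distrib)
  from jspan_add[OF this step.IH] show ?case by (simp add: algebra_simps)
qed (simp add: jspan.zero)

lemma jspan_mult: "jspan g \<Longrightarrow> jspan f \<Longrightarrow> jspan (\<lambda>x. f x * g x)"
proof (induction rule: jspan.induct)
  case (step g c \<kappa>)
  have "jspan (\<lambda>x. c * (f x * jac \<kappa> x))" by (intro jspan_cmult jspan_mult_jac step.prems)
  from jspan_add[OF this step.IH[OF step.prems]] show ?case by (simp add: algebra_simps)
qed (simp add: jspan.zero)

lemma jspan_const: "jspan (\<lambda>x. c)"
proof -
  have "jspan (\<lambda>x. c * (\<Prod>i\<in>UNIV. poly 1 (x $ i)))" by (rule jspan_cmult[OF jspan_prod])
  then show ?thesis by simp
qed

lemma jspan_component: "jspan (\<lambda>x. x $ i)"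
proof -
  have "(\<Prod>j\<in>UNIV. poly (if j = i then [:0, 1:] else 1) (x $ j)) = x $ i" for x :: "real^'n"
  proof -
    have "(\<Prod>j\<in>UNIV. poly (if j = i then [:0, 1:] else 1) (x $ j)) = (\<Prod>j\<in>UNIV. if j = i then x $ j else 1)"
      by (intro prod.cong) auto
    then show ?thesis by simp
  qed
  then show ?thesis using jspan_prod[of "\<lambda>j. if j = i then [:0, 1:] else 1"] by simp
qed

text \<open>
  A product of one-variable polynomials in the separate coordinates expands coordinatewise. As
  products of Jacobi polynomials, coordinates and constants are of this kind, the span is an algebra
  that contains all linear functionals.
\<close>

lemma jspan_polynomial: "real_polynomial_function f \<Longrightarrow> jspan f"
proof (induction rule: real_polynomial_function.induct)
  case (linear f)
  interpret bounded_linear f by (rule linear)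
  have "f x = (\<Sum>i\<in>UNIV. f (axis i 1) * (x $ i))" for x
  proof -
    have "x = (\<Sum>i\<in>UNIV. x $ i *\<^sub>R axis i 1)"
      by (simp add: vec_eq_iff axis_def if_distrib cong: if_cong)
    then have "f x = f (\<Sum>i\<in>UNIV. x $ i *\<^sub>R axis i 1)" by (rule arg_cong)
    then show ?thesis by (simp add: sum scaleR mult.commute)
  qed
  then have eq: "f = (\<lambda>x. \<Sum>i\<in>UNIV. f (axis i 1) * (x $ i))" by (rule ext)
  have "jspan (\<lambda>x. \<Sum>i\<in>UNIV. f (axis i 1) * (x $ i))"
    by (intro jspan_sum jspan_cmult jspan_component finite)
  then show ?case using eq by metis
next
  case (const c)
  show ?case by (rule jspan_const)
next
  case (add f g)
  show ?case by (rule jspan_add[OF add.IH])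
next
  case (mult f g)
  show ?case by (rule jspan_mult[OF mult.IH(2,1)])
qed

lemma integrable_jac: "integrable \<mu> (jac \<kappa>)"
  by (rule integrable_bounded_on_cube[OF jac_measurable jac_le_ubound])

lemma jspan_integrable: "jspan f \<Longrightarrow> integrable \<mu> f"
proof (induction rule: jspan.induct)
  case (step f c \<kappa>)
  show ?case by (rule Bochner_Integration.integrable_add[OF integrable_mult_right[OF integrable_jac] step.IH])
qed simp

lemma jcoeff_jac: "jcoeff (\<lambda>x. c * jac \<kappa> x) \<iota> = (if \<kappa> = \<iota> then c else 0)"
  unfolding jcoeff_def mult.assoc integral_mult_right_zero jac_orthonormal by simp

text \<open>
  Carrying the coefficients through the induction identifies them with the integrals \<open>jcoeff\<close>.
\<close>

lemma jspan_expansion: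
  "jspan f \<Longrightarrow> \<exists>K. finite K \<and> (\<forall>\<kappa>. \<kappa> \<notin> K \<longrightarrow> jcoeff f \<kappa> = 0) \<and> (\<forall>x. f x = (\<Sum>\<kappa>\<in>K. jcoeff f \<kappa> * jac \<kappa> x))"
proof (induction rule: jspan.induct)
  case zero
  then show ?case by (intro exI[of _ "{}"]) (simp add: jcoeff_def)
next
  case (step f c \<kappa>)
  then obtain K where K: "finite K" "\<And>\<iota>. \<iota> \<notin> K \<Longrightarrow> jcoeff f \<iota> = 0" "\<And>x. f x = (\<Sum>\<iota>\<in>K. jcoeff f \<iota> * jac \<iota> x)"
    by blast
  let ?g = "\<lambda>x. c * jac \<kappa> x + f x"
  have cfg: "jcoeff ?g \<iota> = (if \<kappa> = \<iota> then c else 0) + jcoeff f \<iota>" for \<iota>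
    by (simp add: jcoeff_add integrable_jac jspan_integrable step.hyps jcoeff_jac)
  have "?g x = (\<Sum>\<iota>\<in>insert \<kappa> K. jcoeff ?g \<iota> * jac \<iota> x)" for x
  proof -
    have "(\<Sum>\<iota>\<in>insert \<kappa> K. jcoeff ?g \<iota> * jac \<iota> x) =
        (\<Sum>\<iota>\<in>insert \<kappa> K. if \<kappa> = \<iota> then c * jac \<iota> x else 0) + (\<Sum>\<iota>\<in>insert \<kappa> K. jcoeff f \<iota> * jac \<iota> x)"
      unfolding cfg sum.distrib[symmetric] by (intro sum.cong) (auto simp: algebra_simps)
    also have "(\<Sum>\<iota>\<in>insert \<kappa> K. if \<kappa> = \<iota> then c * jac \<iota> x else 0) = c * jac \<kappa> x"
      using K(1) by simp
    also have "(\<Sum>\<iota>\<in>insert \<kappa> K. jcoeff f \<iota> * jac \<iota> x) = (\<Sum>\<iota>\<in>K. jcoeff f \<iota> * jac \<iota> x)"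
      using K by (intro sum.mono_neutral_right) auto
    finally show ?thesis using K(3) by simp
  qed
  moreover have "\<forall>\<iota>. \<iota> \<notin> insert \<kappa> K \<longrightarrow> jcoeff ?g \<iota> = 0" using K(2) by (simp add: cfg)
  moreover have "finite (insert \<kappa> K)" using K(1) by simp
  ultimately show ?case by blast
qed

section \<open>The minimum principle and the heat semigroup\<close>

lemma continuous_jac: "continuous_on S (jac \<kappa>)"
  unfolding multi_jacobi_def[abs_def] by (intro continuous_intros)

text \<open>
  Freezing all coordinates but one gives a one-variable polynomial with a minimum at the remaining
  coordinate of \<open>x\<close>, on which the one-variable operator acts by its eigenvalues. Summed over the
  coordinates, this is the generator applied to the expansion, up to sign.
\<close>

lemma generator_at_minimum:
  assumes K: "finite K" and x: "x \<in> jacobi_cube"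
    and min: "\<And>y. y \<in> jacobi_cube \<Longrightarrow> (\<Sum>\<kappa>\<in>K. c \<kappa> * jac \<kappa> x) \<le> (\<Sum>\<kappa>\<in>K. c \<kappa> * jac \<kappa> y)"
  shows "(\<Sum>\<kappa>\<in>K. c \<kappa> * lam \<kappa> * jac \<kappa> x) \<le> 0"
proof -
  define l where "l = (\<lambda>i n. real n * (real n + \<alpha> $ i + \<beta> $ i + 1))"
  have one: "(\<Sum>\<kappa>\<in>K. c \<kappa> * l i (\<kappa> $ i) * jac \<kappa> x) \<le> 0" for i
  proof -
    define D where "D = (\<lambda>\<kappa>. \<Prod>j\<in>UNIV - {i}. poly (jac1 j (\<kappa> $ j)) (x $ j))"
    define q where "q = (\<Sum>\<kappa>\<in>K. smult (c \<kappa> * D \<kappa>) (jac1 i (\<kappa> $ i)))"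
    have jx: "jac \<kappa> (\<chi> j. if j = i then r else x $ j) = D \<kappa> * poly (jac1 i (\<kappa> $ i)) r" for \<kappa> r
    proof -
      have "jac \<kappa> (\<chi> j. if j = i then r else x $ j) = poly (jac1 i (\<kappa> $ i)) r *
         (\<Prod>j\<in>UNIV - {i}. poly (jac1 j (\<kappa> $ j)) (if j = i then r else x $ j))"
        unfolding multi_jacobi_def by (subst prod.remove[of _ i]) auto
      also have "(\<Prod>j\<in>UNIV - {i}. poly (jac1 j (\<kappa> $ j)) (if j = i then r else x $ j)) = D \<kappa>"
        unfolding D_def by (intro prod.cong) auto
      finally show ?thesis by simp
    qed
    have q: "poly q r = (\<Sum>\<kappa>\<in>K. c \<kappa> * jac \<kappa> (\<chi> j. if j = i then r else x $ j))" for r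
      unfolding q_def poly_sum jx by (simp add: mult_ac)
    have xx: "(\<chi> j. if j = i then x $ i else x $ j) = x" by (simp add: vec_eq_iff)
    have "poly (jacobi_op (\<alpha> $ i) (\<beta> $ i) q) (x $ i) \<ge> 0"
    proof (rule jacobi_op_at_minimum[OF params(1,2)])
      show "x $ i \<in> {-1..1}" using x by (simp add: jacobi_cube_def)
      fix s :: real assume s: "s \<in> {-1..1}"
      show "poly q (x $ i) \<le> poly q s"
        unfolding q xx using s x by (intro min) (auto simp: jacobi_cube_def)
    qed
    moreover have "poly (jacobi_op (\<alpha> $ i) (\<beta> $ i) q) (x $ i) = - (\<Sum>\<kappa>\<in>K. c \<kappa> * l i (\<kappa> $ i) * jac \<kappa> x)"
    proof -
      have "poly (jacobi_op (\<alpha> $ i) (\<beta> $ i) q) (x $ i) =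
          (\<Sum>\<kappa>\<in>K. - (c \<kappa> * l i (\<kappa> $ i) * (D \<kappa> * poly (jac1 i (\<kappa> $ i)) (x $ i))))"
        unfolding q_def jacobi_op_sum jacobi_op_smult jacobi_poly_eigen[OF params] poly_sum
        by (simp add: l_def mult_ac)
      also have "\<dots> = - (\<Sum>\<kappa>\<in>K. c \<kappa> * l i (\<kappa> $ i) * jac \<kappa> x)"
        unfolding jx[symmetric] xx by (rule sum_negf)
      finally show ?thesis .
    qed
    ultimately show ?thesis by simp
  qed
  have "(\<Sum>\<kappa>\<in>K. c \<kappa> * lam \<kappa> * jac \<kappa> x) = (\<Sum>\<kappa>\<in>K. \<Sum>i\<in>UNIV. c \<kappa> * l i (\<kappa> $ i) * jac \<kappa> x)"
    by (simp add: jacobi_eigenvalue_def l_def sum_distrib_left sum_distrib_right)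
  also have "\<dots> = (\<Sum>i\<in>UNIV. \<Sum>\<kappa>\<in>K. c \<kappa> * l i (\<kappa> $ i) * jac \<kappa> x)" by (rule sum.swap)
  also have "\<dots> \<le> 0" using one by (rule sum_nonpos)
  finally show ?thesis .
qed

text \<open>
  If $u - \epsilon L u = v$ with $v \ge 0$, then at a minimum \<open>x\<close> of \<open>u\<close> over the cube
  $L u(x) \ge 0$, whence $u \ge u(x) \ge v(x) \ge 0$.
\<close>

lemma resolvent_nonneg:
  assumes K: "finite K" and eps: "\<epsilon> \<ge> 0"
    and nn: "\<And>y. y \<in> jacobi_cube \<Longrightarrow> (\<Sum>\<kappa>\<in>K. d \<kappa> * jac \<kappa> y) \<ge> 0" and y: "y \<in> jacobi_cube"
  shows "(\<Sum>\<kappa>\<in>K. d \<kappa> / (1 + \<epsilon> * lam \<kappa>) * jac \<kappa> y) \<ge> 0"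
proof -
  define c where "c = (\<lambda>\<kappa>. d \<kappa> / (1 + \<epsilon> * lam \<kappa>))"
  define u where "u = (\<lambda>y. \<Sum>\<kappa>\<in>K. c \<kappa> * jac \<kappa> y)"
  have pos: "1 + \<epsilon> * lam \<kappa> > 0" for \<kappa> using eps lam_nonneg[of \<kappa>] by (simp add: add_pos_nonneg)
  have "continuous_on jacobi_cube u" unfolding u_def by (intro continuous_intros continuous_jac)
  then obtain x where x: "x \<in> jacobi_cube" "\<And>y. y \<in> jacobi_cube \<Longrightarrow> u x \<le> u y"
    using continuous_attains_inf[OF compact_cube] zero_in_cube by blast
  have "(\<Sum>\<kappa>\<in>K. c \<kappa> * lam \<kappa> * jac \<kappa> x) \<le> 0"
    by (rule generator_at_minimum[OF K x(1)]) (use x(2) in \<open>simp add: u_def\<close>)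
  moreover have "(\<Sum>\<kappa>\<in>K. d \<kappa> * jac \<kappa> x) = u x + \<epsilon> * (\<Sum>\<kappa>\<in>K. c \<kappa> * lam \<kappa> * jac \<kappa> x)"
    unfolding u_def sum_distrib_left sum.distrib[symmetric]
  proof (rule sum.cong[OF refl])
    fix \<kappa>
    have "d \<kappa> = c \<kappa> * (1 + \<epsilon> * lam \<kappa>)" using pos[of \<kappa>] by (simp add: c_def)
    then show "d \<kappa> * jac \<kappa> x = c \<kappa> * jac \<kappa> x + \<epsilon> * (c \<kappa> * lam \<kappa> * jac \<kappa> x)" by (simp add: algebra_simps)
  qed
  ultimately have "u x \<ge> 0" using nn[OF x(1)] eps by (smt (verit) mult_nonneg_nonpos)
  then have "u y \<ge> 0" using x(2)[OF y] by simp
  then show ?thesis by (simp add: u_def c_def)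
qed

text \<open>
  The exponential formula: $e^{tL}$ is the limit of the iterated resolvents $(1 - tL/m)^{-m}$.
\<close>

lemma heat_finite_nonneg:
  assumes K: "finite K" and t: "t \<ge> 0"
    and nn: "\<And>y. y \<in> jacobi_cube \<Longrightarrow> (\<Sum>\<kappa>\<in>K. d \<kappa> * jac \<kappa> y) \<ge> 0" and y: "y \<in> jacobi_cube"
  shows "(\<Sum>\<kappa>\<in>K. d \<kappa> * jac \<kappa> y * exp (- lam \<kappa> * t)) \<ge> 0"
proof -
  have it: "(\<Sum>\<kappa>\<in>K. d \<kappa> / (1 + \<epsilon> * lam \<kappa>) ^ m * jac \<kappa> y) \<ge> 0"
    if "\<epsilon> \<ge> 0" "y \<in> jacobi_cube" for \<epsilon> m y
    using that(2)
  proof (induction m arbitrary: y)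
    case (Suc m)
    from resolvent_nonneg[OF K that(1) Suc.IH Suc.prems] show ?case by (simp add: mult_ac)
  qed (simp add: nn)
  have "(\<lambda>m. \<Sum>\<kappa>\<in>K. d \<kappa> / (1 + t / real m * lam \<kappa>) ^ m * jac \<kappa> y)
     \<longlonglongrightarrow> (\<Sum>\<kappa>\<in>K. d \<kappa> / exp (lam \<kappa> * t) * jac \<kappa> y)"
  proof (intro tendsto_intros)
    show "(\<lambda>m. (1 + t / real m * lam \<kappa>) ^ m) \<longlonglongrightarrow> exp (lam \<kappa> * t)" for \<kappa>
      using tendsto_exp_limit_sequentially[of "lam \<kappa> * t"] by (simp add: mult.commute)
  qed simp
  then have "(\<Sum>\<kappa>\<in>K. d \<kappa> / exp (lam \<kappa> * t) * jac \<kappa> y) \<ge> 0"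
    by (rule LIMSEQ_le_const) (intro exI[of _ 0] allI impI it y, use t in simp)
  then show ?thesis by (simp add: exp_minus field_simps)
qed

section \<open>Positivity for integrable functions\<close>

text \<open>
  A continuous \<open>L\<^sup>1\<close> approximant \<open>h\<close> is replaced by a polynomial that is uniformly close to
  \<open>h + \<delta>\<close> on the cube. It lies above \<open>h\<close> there, so it is nonnegative if \<open>h\<close> is, and for
  nonnegative \<open>f\<close> the positive part of an approximant is no worse than the approximant itself.
\<close>

lemma poly_L1_dense:
  assumes f: "integrable \<mu> f" and e: "\<epsilon> > 0"
  shows "\<exists>q. real_polynomial_function q \<and> (\<integral>x. \<bar>f x - q x\<bar> \<partial>\<mu>) < \<epsilon>"
    and "AE x in \<mu>. f x \<ge> 0 \<Longrightarrow> \<exists>q. real_polynomial_function q \<and> (\<forall>x\<in>jacobi_cube. q x \<ge> 0) \<and> (\<integral>x. \<bar>f x - q x\<bar> \<partial>\<mu>) < \<epsilon>"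
proof -
  define \<delta> where "\<delta> = \<epsilon> / (4 * (measure \<mu> UNIV + 1))"
  have mpos: "measure \<mu> UNIV \<ge> 0" by simp
  then have mp: "measure \<mu> UNIV + 1 > 0" by linarith
  then have d: "\<delta> > 0" unfolding \<delta>_def using e by simp
  have "\<delta> * (4 * (measure \<mu> UNIV + 1)) = \<epsilon>" unfolding \<delta>_def using mp by simp
  then have dm: "2 * \<delta> * measure \<mu> UNIV < \<epsilon> / 2"
    using d by (simp add: algebra_simps)
  obtain g where g: "continuous_on UNIV g" "integrable \<mu> g" "(\<integral>x. \<bar>f x - g x\<bar> \<partial>\<mu>) < \<epsilon> / 2"
    using continuous_L1_dense[OF finite_measure_axioms sets_mu f, of "\<epsilon> / 2"] e by auto
  have approx: "\<exists>q. real_polynomial_function q \<and> (\<forall>x\<in>jacobi_cube. h x \<le> q x) \<and> (\<integral>x. \<bar>f x - q x\<bar> \<partial>\<mu>) < \<epsilon>"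
    if h: "continuous_on UNIV h" "integrable \<mu> h" "(\<integral>x. \<bar>f x - h x\<bar> \<partial>\<mu>) < \<epsilon> / 2" for h
  proof -
    have "continuous_on jacobi_cube (\<lambda>x. h x + \<delta>)"
      using continuous_on_subset[OF h(1)] by (intro continuous_intros) auto
    from Stone_Weierstrass_real_polynomial_function[OF compact_cube this d]
    obtain q where q: "real_polynomial_function q" "\<And>x. x \<in> jacobi_cube \<Longrightarrow> \<bar>h x + \<delta> - q x\<bar> < \<delta>" by auto
    have qi: "integrable \<mu> q" using q(1) by (intro jspan_integrable jspan_polynomial)
    have q1: "h x \<le> q x" and q2: "\<bar>h x - q x\<bar> \<le> 2 * \<delta>" if "x \<in> jacobi_cube" for x
      using q(2)[OF that] by linarith+
    have "(\<integral>x. \<bar>h x - q x\<bar> \<partial>\<mu>) \<le> (\<integral>x. 2 * \<delta> \<partial>\<mu>)"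
      using h(2) qi AE_cube q2 by (intro integral_mono_AE) (auto elim: eventually_mono)
    also have "\<dots> < \<epsilon> / 2" using dm by (simp add: mult_ac)
    finally have hq: "(\<integral>x. \<bar>h x - q x\<bar> \<partial>\<mu>) < \<epsilon> / 2" .
    have "(\<integral>x. \<bar>f x - q x\<bar> \<partial>\<mu>) \<le> (\<integral>x. \<bar>f x - h x\<bar> + \<bar>h x - q x\<bar> \<partial>\<mu>)"
      using f h(2) qi by (intro integral_mono) auto
    also have "\<dots> = (\<integral>x. \<bar>f x - h x\<bar> \<partial>\<mu>) + (\<integral>x. \<bar>h x - q x\<bar> \<partial>\<mu>)"
      using f h(2) qi by simp
    also have "\<dots> < \<epsilon>" using h(3) hq by linarith
    finally show ?thesis using q(1) q1 by blast
  qed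
  show "\<exists>q. real_polynomial_function q \<and> (\<integral>x. \<bar>f x - q x\<bar> \<partial>\<mu>) < \<epsilon>"
    using approx[OF g] by blast
  assume nn: "AE x in \<mu>. f x \<ge> 0"
  let ?h = "\<lambda>x. max 0 (g x)"
  have "(\<integral>x. \<bar>f x - ?h x\<bar> \<partial>\<mu>) \<le> (\<integral>x. \<bar>f x - g x\<bar> \<partial>\<mu>)"
    using nn by (intro integral_mono_AE) (use f g(2) in \<open>auto elim!: eventually_mono\<close>)
  then have h3: "(\<integral>x. \<bar>f x - ?h x\<bar> \<partial>\<mu>) < \<epsilon> / 2" using g(3) by linarith
  have "\<exists>q. real_polynomial_function q \<and> (\<forall>x\<in>jacobi_cube. ?h x \<le> q x) \<and> (\<integral>x. \<bar>f x - q x\<bar> \<partial>\<mu>) < \<epsilon>"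
    by (rule approx[OF _ _ h3]) (use g in \<open>auto intro!: continuous_intros\<close>)
  then show "\<exists>q. real_polynomial_function q \<and> (\<forall>x\<in>jacobi_cube. q x \<ge> 0) \<and> (\<integral>x. \<bar>f x - q x\<bar> \<partial>\<mu>) < \<epsilon>"
    by (metis max.bounded_iff)
qed

definition heat :: "real \<Rightarrow> (real^'n \<Rightarrow> real) \<Rightarrow> real^'n \<Rightarrow> real" where
  "heat s f x = (\<Sum>\<^sub>\<infinity>\<kappa>\<in>UNIV. jcoeff f \<kappa> * jac \<kappa> x * exp (- lam \<kappa> * s))"

lemma heat_lipschitz:
  assumes s: "s > 0" and x: "x \<in> jacobi_cube"
  shows "\<exists>C\<ge>0. \<forall>f g. integrable \<mu> f \<longrightarrow> integrable \<mu> g \<longrightarrow>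
     heat s g x \<le> heat s f x + C * (\<integral>y. \<bar>f y - g y\<bar> \<partial>\<mu>)"
proof -
  define C where "C = (\<Sum>\<^sub>\<infinity>\<kappa>\<in>UNIV. (ubound \<kappa>)\<^sup>2 * exp (- lam \<kappa> * s))"
  have "C \<ge> 0" unfolding C_def by (intro infsum_nonneg) simp
  moreover have "heat s g x \<le> heat s f x + C * (\<integral>y. \<bar>f y - g y\<bar> \<partial>\<mu>)"
    if f: "integrable \<mu> f" and g: "integrable \<mu> g" for f g
  proof -
    let ?F = "\<integral>y. \<bar>f y - g y\<bar> \<partial>\<mu>" and ?e = "\<lambda>\<kappa>. exp (- lam \<kappa> * s)"
    have fg: "integrable \<mu> (\<lambda>y. f y - g y)" using f g by simp
    have sf: "(\<lambda>\<kappa>. jcoeff f \<kappa> * jac \<kappa> x * ?e \<kappa>) summable_on UNIV"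
      by (rule summable_lam[OF coeff_product_bound[OF f x] s])
    have sg: "(\<lambda>\<kappa>. jcoeff g \<kappa> * jac \<kappa> x * ?e \<kappa>) summable_on UNIV"
      by (rule summable_lam[OF coeff_product_bound[OF g x] s])
    have sb: "(\<lambda>\<kappa>. ((ubound \<kappa>)\<^sup>2 * ?e \<kappa>) * ?F) summable_on UNIV"
      by (intro summable_on_cmult_left ubound_summable_lam s)
    have "heat s g x \<le> (\<Sum>\<^sub>\<infinity>\<kappa>\<in>UNIV. jcoeff f \<kappa> * jac \<kappa> x * ?e \<kappa> + ((ubound \<kappa>)\<^sup>2 * ?e \<kappa>) * ?F)"
      unfolding heat_def
    proof (intro infsum_mono sg summable_on_add sf sb)
      fix \<kappa>
      have "- ((jcoeff f \<kappa> - jcoeff g \<kappa>) * jac \<kappa> x) \<le> ?F * (ubound \<kappa>)\<^sup>2"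
        using coeff_product_bound[OF fg x, of \<kappa>] unfolding jcoeff_diff[OF f g] by linarith
      then have "- ((jcoeff f \<kappa> - jcoeff g \<kappa>) * jac \<kappa> x) * ?e \<kappa> \<le> ?F * (ubound \<kappa>)\<^sup>2 * ?e \<kappa>"
        by (intro mult_right_mono) auto
      then show "jcoeff g \<kappa> * jac \<kappa> x * ?e \<kappa> \<le> jcoeff f \<kappa> * jac \<kappa> x * ?e \<kappa> + (ubound \<kappa>)\<^sup>2 * ?e \<kappa> * ?F"
        by (simp add: algebra_simps)
    qed
    also have "\<dots> = heat s f x + C * ?F"
      unfolding heat_def C_def by (subst infsum_add[OF sf sb]) (simp add: infsum_cmult_left')
    finally show ?thesis .
  qed
  ultimately show ?thesis by blast
qed

text \<open>
  On the cube \<open>f\<close> is an \<open>L\<^sup>1\<close> limit of nonnegative polynomials, for which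
  \<open>heat_finite_nonneg\<close> applies, and for fixed \<open>s\<close> and \<open>x\<close> the value of the heat semigroup is
  Lipschitz in the \<open>L\<^sup>1\<close> norm.
\<close>

lemma heat_nonneg:
  assumes f: "integrable \<mu> f" and nn: "AE x in \<mu>. f x \<ge> 0" and x: "x \<in> jacobi_cube" and s: "s > 0"
  shows "heat s f x \<ge> 0"
proof -
  obtain C where C: "C \<ge> 0" "\<And>f g. integrable \<mu> f \<Longrightarrow> integrable \<mu> g \<Longrightarrow>
     heat s g x \<le> heat s f x + C * (\<integral>y. \<bar>f y - g y\<bar> \<partial>\<mu>)"
    using heat_lipschitz[OF s x] by blast
  show ?thesis
  proof (rule field_le_epsilon)
    fix e :: real assume e: "e > 0"
    then have e1: "e / (C + 1) > 0" using C(1) by simp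
    obtain q where q: "real_polynomial_function q"
      "\<And>x. x \<in> jacobi_cube \<Longrightarrow> q x \<ge> 0" "(\<integral>y. \<bar>f y - q y\<bar> \<partial>\<mu>) < e / (C + 1)"
      using poly_L1_dense(2)[OF f e1 nn] by metis
    have js: "jspan q" by (rule jspan_polynomial[OF q(1)])
    obtain K where K: "finite K" "\<And>\<kappa>. \<kappa> \<notin> K \<Longrightarrow> jcoeff q \<kappa> = 0" "\<And>x. q x = (\<Sum>\<kappa>\<in>K. jcoeff q \<kappa> * jac \<kappa> x)"
      using jspan_expansion[OF js] by blast
    have "heat s q x = (\<Sum>\<kappa>\<in>K. jcoeff q \<kappa> * jac \<kappa> x * exp (- lam \<kappa> * s))"
      unfolding heat_def infsum_finite[OF K(1), symmetric]
      using K(2) by (intro infsum_cong_neutral) auto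
    also have "\<dots> \<ge> 0"
      using heat_finite_nonneg[OF K(1) _ _ x, of s "jcoeff q"] s q(2) K(3) by simp
    finally have "0 \<le> heat s q x" .
    also have "\<dots> \<le> heat s f x + C * (\<integral>y. \<bar>f y - q y\<bar> \<partial>\<mu>)"
      by (rule C(2)[OF f jspan_integrable[OF js]])
    also have "C * (\<integral>y. \<bar>f y - q y\<bar> \<partial>\<mu>) \<le> C * (e / (C + 1))"
      using C(1) q(3) by (intro mult_left_mono) auto
    also have "C * (e / (C + 1)) \<le> e" using C(1) e by (simp add: field_simps)
    finally show "0 \<le> heat s f x + e" by simp
  qed
qed

section \<open>Monotonicity of the Poisson semigroup\<close>

text \<open>
  The substitution $u = t^2 v$ moves the parameter \<open>t\<close> out of the heat semigroup and into the
  explicit factor $e^{-t^2 v}$.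
\<close>

lemma pois_rescaled:
  assumes f: "integrable \<mu> f" and x: "x \<in> jacobi_cube" and t: "t > 0"
  defines "J \<equiv> \<lambda>t v. indicator {0<..} v * (exp (- (t\<^sup>2 * v)) / sqrt v * heat (1 / (4 * v)) f x)"
  shows "integrable lborel (J t)" and "pois t f x = t / sqrt pi * (\<integral>v. J t v \<partial>lborel)"
proof -
  define h where "h = (\<lambda>u. indicator {0<..} u *\<^sub>R (exp (- u) / sqrt u * jacobi_semigroup \<alpha> \<beta> (t\<^sup>2 / (4 * u)) f x))"
  have hi: "integrable lborel h"
    using poisson_integrable[OF f x t] unfolding set_integrable_def h_def .
  have t2: "t\<^sup>2 \<noteq> 0" "t\<^sup>2 > 0" using t by auto
  have hJ: "h (0 + t\<^sup>2 * v) = 1 / t * J t v" for v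
  proof (cases "v > 0")
    case True
    then have "t\<^sup>2 / (4 * (t\<^sup>2 * v)) = 1 / (4 * v)" "sqrt (t\<^sup>2 * v) = t * sqrt v"
      using t by (simp_all add: real_sqrt_mult)
    then show ?thesis
      using True t jacobi_semigroup_series[OF f, of "1 / (4 * v)"] by (simp add: h_def J_def heat_def)
  next
    case False
    then have "\<not> 0 < t\<^sup>2 * v" using t2 by (simp add: zero_less_mult_iff)
    then show ?thesis using False by (simp add: h_def J_def)
  qed
  have "integrable lborel (\<lambda>v. h (0 + t\<^sup>2 * v))" by (rule lborel_integrable_real_affine[OF hi t2(1)])
  then have "integrable lborel (\<lambda>v. t * (1 / t * J t v))" unfolding hJ by (rule integrable_mult_right)
  then show "integrable lborel (J t)" using t by simp
  have "pois t f x = 1 / sqrt pi * (\<integral>u. h u \<partial>lborel)"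
    unfolding poisson_eq_pois[OF f x t, symmetric] poisson_jacobi_def set_lebesgue_integral_def h_def ..
  also have "(\<integral>u. h u \<partial>lborel) = t\<^sup>2 * (\<integral>v. h (0 + t\<^sup>2 * v) \<partial>lborel)"
    using lborel_integral_real_affine[OF t2(1), of h 0] by simp
  also have "(\<integral>v. h (0 + t\<^sup>2 * v) \<partial>lborel) = 1 / t * (\<integral>v. J t v \<partial>lborel)"
    unfolding hJ by (rule integral_mult_right_zero)
  finally show "pois t f x = t / sqrt pi * (\<integral>v. J t v \<partial>lborel)"
    using t by (simp add: power2_eq_square)
qed

lemma pois_nonneg:
  assumes f: "integrable \<mu> f" and nn: "AE x in \<mu>. f x \<ge> 0" and x: "x \<in> jacobi_cube" and t: "t > 0"
  shows "pois t f x \<ge> 0"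
proof -
  have "heat (1 / (4 * v)) f x \<ge> 0" if "v > 0" for v
    using heat_nonneg[OF f nn x] that by simp
  then have "0 \<le> indicator {0<..} v * (exp (- (t\<^sup>2 * v)) / sqrt v * heat (1 / (4 * v)) f x)" for v
    by (cases "v > 0") auto
  then have "0 \<le> (\<integral>v. indicator {0<..} v * (exp (- (t\<^sup>2 * v)) / sqrt v * heat (1 / (4 * v)) f x) \<partial>lborel)"
    by (rule Bochner_Integration.integral_nonneg)
  from mult_nonneg_nonneg[OF _ this, of "t / sqrt pi"] show ?thesis
    unfolding pois_rescaled(2)[OF f x t] using t by simp
qed

text \<open>
  By \<open>pois_rescaled\<close>, $P_t f / t$ is an integral of $e^{-t^2 v}$ against a nonnegative function.
  So the value at one time bounds the values at all earlier times from below, and averages over time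
  dominate single values.
\<close>

lemma pois_quotient_decreasing:
  assumes f: "integrable \<mu> f" and nn: "AE x in \<mu>. f x \<ge> 0" and x: "x \<in> jacobi_cube"
    and r: "0 < r" "r \<le> t"
  shows "r * pois t f x \<le> t * pois r f x"
proof -
  let ?J = "\<lambda>t v. indicator {0<..} v * (exp (- (t\<^sup>2 * v)) / sqrt v * heat (1 / (4 * v)) f x)"
  have t: "t > 0" using r by simp
  have "(\<integral>v. ?J t v \<partial>lborel) \<le> (\<integral>v. ?J r v \<partial>lborel)"
  proof (rule integral_mono[OF pois_rescaled(1)[OF f x t] pois_rescaled(1)[OF f x r(1)]])
    fix v :: real
    show "?J t v \<le> ?J r v"
    proof (cases "v > 0")
      case True
      have "r\<^sup>2 * v \<le> t\<^sup>2 * v" using True r by (intro mult_right_mono power_mono) auto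
      then have "exp (- (t\<^sup>2 * v)) / sqrt v * heat (1 / (4 * v)) f x \<le> exp (- (r\<^sup>2 * v)) / sqrt v * heat (1 / (4 * v)) f x"
        using True heat_nonneg[OF f nn x, of "1 / (4 * v)"]
        by (intro mult_right_mono divide_right_mono) auto
      then show ?thesis using True by simp
    qed simp
  qed
  then have "r * t / sqrt pi * (\<integral>v. ?J t v \<partial>lborel) \<le> r * t / sqrt pi * (\<integral>v. ?J r v \<partial>lborel)"
    using r t by (intro mult_left_mono) auto
  then show ?thesis
    unfolding pois_rescaled(2)[OF f x t] pois_rescaled(2)[OF f x r(1)] by (simp add: mult_ac)
qed

lemma pois_abs_le:
  assumes f: "integrable \<mu> f" and x: "x \<in> jacobi_cube" and t: "t > 0"
  shows "\<bar>pois t f x\<bar> \<le> pois t (\<lambda>x. \<bar>f x\<bar>) x"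
proof -
  have a: "integrable \<mu> (\<lambda>x. \<bar>f x\<bar>)" using f by simp
  have "pois t (\<lambda>x. \<bar>f x\<bar> - f x) x \<ge> 0" "pois t (\<lambda>x. \<bar>f x\<bar> + f x) x \<ge> 0"
    using f by (intro pois_nonneg x t; auto)+
  then show ?thesis
    unfolding pois_diff[OF a f x t] pois_add[OF a f x t] by linarith
qed

section \<open>The maximal inequality and almost everywhere convergence\<close>

text \<open>
  \<open>maximal_ergodic\<close> is applied to the operator $P_h$ and $g = P_h f - v$, so that
  $S_n = \sum_{k=1}^{n} P_{kh} f - nv$. By \<open>pois_quotient_decreasing\<close>,
  $P_{kh} f \ge (k/n)\,P_{nh} f$, so the sum is at least $\frac{n+1}{2} P_{nh} f$ and $S_n > 0$ as
  soon as $P_{nh} f > 2v$.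
\<close>

lemma discrete_weak_type:
  fixes h v :: real and N :: nat
  assumes f: "integrable \<mu> f" and nn: "AE x in \<mu>. f x \<ge> 0" and h: "h > 0" and l: "v > 0"
  defines "B \<equiv> {x\<in>jacobi_cube. \<exists>n\<in>{1..N}. pois (real n * h) f x > 2 * v}"
  shows "B \<in> sets \<mu>" and "v * measure \<mu> B \<le> (\<integral>x. f x \<partial>\<mu>)"
proof -
  have "B = jacobi_cube \<inter> (\<Union>n\<in>{1..N}. {x. pois (real n * h) f x > 2 * v})" by (auto simp: B_def)
  also have "\<dots> \<in> sets borel" by measurable
  finally have Bm: "B \<in> sets borel" .
  then show "B \<in> sets \<mu>" by (simp add: sets_mu)
  define S where "S = (\<lambda>n x. (\<Sum>k<n. pois (real (Suc k) * h) f x) - real n * v)"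
  define g where "g = (\<lambda>x. pois h f x - v)"
  have pi: "integrable \<mu> (pois (real (Suc k) * h) f)" for k
    using h by (intro pois_integrable f) simp
  have gi: "integrable \<mu> g" unfolding g_def using pois_integrable[OF f h] by simp
  have Si: "integrable \<mu> (S n)" for n unfolding S_def
    by (intro Bochner_Integration.integrable_diff Bochner_Integration.integrable_sum pi) simp
  have step: "S (Suc n) x = g x + pois h (S n) x" if x: "x \<in> jacobi_cube" for n x
  proof (induction n)
    case 0
    have "S 0 = (\<lambda>_. 0)" by (simp add: S_def)
    then show ?case using pois_const[OF h, of 0] by (simp add: S_def g_def)
  next
    case (Suc n)
    let ?p = "pois (real (Suc n) * h) f"
    have "S (Suc n) = (\<lambda>x. S n x + (?p x - v))" by (simp add: S_def fun_eq_iff algebra_simps)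
    then have "pois h (S (Suc n)) x = pois h (S n) x + (pois h ?p x - pois h (\<lambda>_. v) x)"
      using pi Si x h by (simp add: pois_add pois_diff)
    also have "pois h ?p x = pois (h + real (Suc n) * h) f x"
      using h by (intro pois_pois f) simp
    also have "pois h (\<lambda>_. v) x = v" by (rule pois_const[OF h])
    also have "h + real (Suc n) * h = real (Suc (Suc n)) * h" by (simp add: algebra_simps)
    finally have "g x + pois h (S (Suc n)) x = S (Suc n) x + (pois (real (Suc (Suc n)) * h) f x - v)"
      using Suc by simp
    then show ?case by (simp add: S_def algebra_simps)
  qed
  define A where "A = {x. \<exists>n\<le>N. 0 < S n x}"
  have hopf: "0 \<le> (\<integral>x. indicator A x * g x \<partial>\<mu>)"
    unfolding A_def
  proof (rule maximal_ergodic[where E = "pois h"])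
    show "integrable \<mu> (pois h f)" if "integrable \<mu> f" for f by (rule pois_integrable[OF that h])
    show "AE x in \<mu>. pois h (\<lambda>x. f x - g x) x = pois h f x - pois h g x"
      if "integrable \<mu> f" "integrable \<mu> g" for f g
      using AE_cube by eventually_elim (rule pois_diff[OF that _ h])
    show "AE x in \<mu>. pois h f x \<ge> 0" if "integrable \<mu> f" "AE x in \<mu>. f x \<ge> 0" for f
      using AE_cube by eventually_elim (rule pois_nonneg[OF that _ h])
    show "(\<integral>x. pois h f x \<partial>\<mu>) \<le> (\<integral>x. f x \<partial>\<mu>)" if "integrable \<mu> f" for f
      using integral_pois[OF that h] by simp
    show "AE x in \<mu>. S (Suc n) x = g x + pois h (S n) x" for n
      using AE_cube by eventually_elim (rule step)
    show "S 0 x = 0" for x by (simp add: S_def)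
  qed (use gi Si in auto)
  have [measurable]: "A \<in> sets borel"
  proof -
    have "S n \<in> borel_measurable borel" for n unfolding S_def by measurable
    then have "(\<Union>n\<in>{..N}. {x. 0 < S n x}) \<in> sets borel" by measurable
    moreover have "A = (\<Union>n\<in>{..N}. {x. 0 < S n x})" by (auto simp: A_def)
    ultimately show ?thesis by simp
  qed
  have i1: "integrable \<mu> (\<lambda>x. indicator A x * pois h f x)"
    by (rule Bochner_Integration.integrable_bound[OF pois_integrable[OF f h]]) (auto simp: indicator_def)
  have i2: "integrable \<mu> (\<lambda>x. indicator A x * v)"
    by (intro integrable_mult_left integrable_real_indicator) (simp_all add: sets_mu emeasure_eq_measure)
  have "(\<integral>x. indicator A x * g x \<partial>\<mu>) = (\<integral>x. indicator A x * pois h f x \<partial>\<mu>) - (\<integral>x. indicator A x * v \<partial>\<mu>)"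
    unfolding g_def right_diff_distrib using i1 i2 by (rule Bochner_Integration.integral_diff)
  moreover have "(\<integral>x. indicator A x * v \<partial>\<mu>) = v * measure \<mu> A" by (simp add: sets_mu)
  moreover have "(\<integral>x. indicator A x * pois h f x \<partial>\<mu>) \<le> (\<integral>x. pois h f x \<partial>\<mu>)"
  proof (rule integral_mono_AE[OF i1 pois_integrable[OF f h]])
    show "AE x in \<mu>. indicator A x * pois h f x \<le> pois h f x"
      using AE_cube by eventually_elim (use pois_nonneg[OF f nn _ h] in \<open>auto simp: indicator_def\<close>)
  qed
  ultimately have lA: "v * measure \<mu> A \<le> (\<integral>x. f x \<partial>\<mu>)"
    using hopf integral_pois[OF f h] by linarith
  have "B \<subseteq> A"
  proof
    fix x assume "x \<in> B"
    then obtain n where x: "x \<in> jacobi_cube" and n: "1 \<le> n" "n \<le> N" and P: "pois (real n * h) f x > 2 * v"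
      by (auto simp: B_def)
    let ?P = "pois (real n * h) f x"
    have "real (Suc k) / real n * ?P \<le> pois (real (Suc k) * h) f x" if "k < n" for k
    proof -
      have "real (Suc k) * h * ?P \<le> real n * h * pois (real (Suc k) * h) f x"
        using that h by (intro pois_quotient_decreasing[OF f nn x]) auto
      then have "h * (real (Suc k) * ?P) \<le> h * (real n * pois (real (Suc k) * h) f x)" by (simp only: mult_ac)
      then have "real (Suc k) * ?P \<le> real n * pois (real (Suc k) * h) f x" using h by simp
      then show ?thesis using n by (simp add: field_simps)
    qed
    then have "(\<Sum>k<n. real (Suc k) / real n * ?P) \<le> (\<Sum>k<n. pois (real (Suc k) * h) f x)"
      by (intro sum_mono) auto
    moreover have "(\<Sum>k<n. real (Suc k) / real n * ?P) = (real n + 1) / 2 * ?P"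
    proof -
      have "(\<Sum>k<n. real (Suc k)) = real n * (real n + 1) / 2"
        by (induction n) (auto simp: field_simps)
      moreover have "(\<Sum>k<n. real (Suc k) / real n * ?P) = (\<Sum>k<n. real (Suc k)) / real n * ?P"
        by (simp only: sum_distrib_right sum_divide_distrib)
      ultimately show ?thesis using n by (simp only:) simp
    qed
    moreover have "(real n + 1) / 2 * ?P > (real n + 1) / 2 * (2 * v)"
      using P by (intro mult_strict_left_mono) auto
    ultimately have "S n x > 0" using l unfolding S_def by (simp add: algebra_simps)
    then show "x \<in> A" using n unfolding A_def by auto
  qed
  then have "measure \<mu> B \<le> measure \<mu> A" by (intro finite_measure_mono) (auto simp: sets_mu)
  then have "v * measure \<mu> B \<le> v * measure \<mu> A" using l by simp
  with lA show "v * measure \<mu> B \<le> (\<integral>x. f x \<partial>\<mu>)" by linarith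
qed

text \<open>
  The sets for the grids of mesh $2^{-m}$ increase with \<open>m\<close>, so their union obeys the bound that
  they share. Every \<open>t\<close> exceeds some grid time by at most a factor 2, which costs a factor 2 in the
  value by \<open>pois_quotient_decreasing\<close>.
\<close>

lemma maximal_weak_type:
  assumes f: "integrable \<mu> f" and nn: "AE x in \<mu>. f x \<ge> 0" and l: "v > 0"
  shows "\<exists>U\<in>sets \<mu>. v * measure \<mu> U \<le> (\<integral>x. f x \<partial>\<mu>) \<and>
     (\<forall>x\<in>jacobi_cube. x \<notin> U \<longrightarrow> (\<forall>t. 0 < t \<longrightarrow> t \<le> 1 \<longrightarrow> pois t f x \<le> 4 * v))"
proof -
  define B where "B = (\<lambda>m::nat. {x\<in>jacobi_cube. \<exists>n\<in>{1..2 ^ m}. pois (real n * (1 / 2 ^ m)) f x > 2 * v})"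
  have Bs: "B m \<in> sets \<mu>" and Bl: "v * measure \<mu> (B m) \<le> (\<integral>x. f x \<partial>\<mu>)" for m
    unfolding B_def by (rule discrete_weak_type[OF f nn _ l]; simp)+
  have inc: "incseq B"
  proof (rule incseq_SucI, rule subsetI)
    fix m x assume "x \<in> B m"
    then obtain n where "x \<in> jacobi_cube" "n \<in> {1..2 ^ m}" "pois (real n * (1 / 2 ^ m)) f x > 2 * v"
      by (auto simp: B_def)
    then show "x \<in> B (Suc m)" unfolding B_def by (auto intro!: bexI[of _ "2 * n"])
  qed
  define U where "U = (\<Union>m. B m)"
  have "U \<in> sets \<mu>" using Bs by (auto simp: U_def)
  moreover have "v * measure \<mu> U \<le> (\<integral>x. f x \<partial>\<mu>)"
  proof (rule LIMSEQ_le_const2)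
    show "(\<lambda>m. v * measure \<mu> (B m)) \<longlonglongrightarrow> v * measure \<mu> U"
      unfolding U_def using Bs inc by (intro tendsto_mult_left finite_Lim_measure_incseq) auto
  qed (use Bl in auto)
  moreover have "pois t f x \<le> 4 * v" if x: "x \<in> jacobi_cube" "x \<notin> U" and t: "0 < t" "t \<le> 1" for x t
  proof (rule ccontr)
    assume c: "\<not> ?thesis"
    obtain m where m: "(1 / 2) ^ m < t" using real_arch_pow_inv[OF t(1), of "1 / 2"] by auto
    \<comment> \<open>the last grid time up to \<open>t\<close>; it is positive, hence larger than $t/2$\<close>
    define n where "n = nat \<lfloor>t * 2 ^ m\<rfloor>"
    have y: "t * 2 ^ m > 1" using m by (simp add: power_one_over field_simps)
    then have n: "real n \<le> t * 2 ^ m" "t * 2 ^ m < real n + 1" "1 \<le> n"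
      unfolding n_def by (auto simp: le_nat_iff)
    have "t * 2 ^ m \<le> 1 * 2 ^ m" using t(2) by (intro mult_right_mono) auto
    then have "real n \<le> 1 * 2 ^ m" by (rule order_trans[OF n(1)])
    then have "real n \<le> real (2 ^ m)" by simp
    then have n2: "n \<le> 2 ^ m" by (simp only: of_nat_le_iff)
    define r where "r = real n * (1 / 2 ^ m)"
    have r: "0 < r" "r \<le> t" "t \<le> 2 * r" using n by (auto simp: r_def field_simps)
    have Pr: "pois r f x \<ge> 0" by (rule pois_nonneg[OF f nn x(1) r(1)])
    have "r * pois t f x \<le> t * pois r f x" by (rule pois_quotient_decreasing[OF f nn x(1) r(1,2)])
    also have "\<dots> \<le> (2 * r) * pois r f x" using r Pr by (intro mult_right_mono) auto
    finally have "r * pois t f x \<le> r * (2 * pois r f x)" by (simp add: mult_ac)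
    then have "pois t f x \<le> 2 * pois r f x" using r(1) by simp
    then have "pois r f x > 2 * v" using c by linarith
    then have "x \<in> B m" using n n2 x(1) unfolding B_def r_def by auto
    then show False using x(2) by (auto simp: U_def)
  qed
  ultimately show ?thesis by blast
qed

lemma pois_jspan:
  assumes js: "jspan q"
  shows "((\<lambda>t. pois t q x) \<longlongrightarrow> q x) (at_right 0)"
proof -
  obtain K where K: "finite K" "\<And>\<kappa>. \<kappa> \<notin> K \<Longrightarrow> jcoeff q \<kappa> = 0" "\<And>x. q x = (\<Sum>\<kappa>\<in>K. jcoeff q \<kappa> * jac \<kappa> x)"
    using jspan_expansion[OF js] by blast
  have p: "pois t q x = (\<Sum>\<kappa>\<in>K. jcoeff q \<kappa> * jac \<kappa> x * exp (- nu \<kappa> * t))" for t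
    unfolding pois_def infsum_finite[OF K(1), symmetric]
    using K(2) by (intro infsum_cong_neutral) auto
  have "((\<lambda>t. \<Sum>\<kappa>\<in>K. jcoeff q \<kappa> * jac \<kappa> x * exp (- nu \<kappa> * t)) \<longlongrightarrow> (\<Sum>\<kappa>\<in>K. jcoeff q \<kappa> * jac \<kappa> x * exp (- nu \<kappa> * 0))) (at_right 0)"
    by (intro tendsto_intros)
  then show ?thesis unfolding p using K(3) by simp
qed

text \<open>
  Approximate \<open>f\<close> in \<open>L\<^sup>1\<close> by a polynomial \<open>q\<close>. Convergence is clear for \<open>q\<close>, and outside a
  set of small measure the maximal inequality controls $P_t (f - q)$ for all \<open>t\<close> at once. The
  exceptional sets for a sequence of approximations have a null set as intersection.
\<close>

lemma eventually_close:
  assumes f: "integrable \<mu> f" and d: "\<delta> > 0"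
  shows "AE x in \<mu>. \<forall>\<^sub>F t in at_right 0. \<bar>pois t f x - f x\<bar> < \<delta>"
proof -
  let ?good = "\<lambda>x. \<forall>\<^sub>F t in at_right 0. \<bar>pois t f x - f x\<bar> < \<delta>"
  have "\<exists>U\<in>sets \<mu>. measure \<mu> U \<le> \<eta> \<and> (\<forall>x\<in>jacobi_cube. x \<notin> U \<longrightarrow> ?good x)" if eta: "\<eta> > 0" for \<eta>
  proof -
    \<comment> \<open>20 = 16 + 4: the weak type bounds at the levels $\delta/16$ and $\delta/4$\<close>
    have "\<eta> * \<delta> / 20 > 0" using eta d by simp
    from poly_L1_dense(1)[OF f this] obtain q where q: "real_polynomial_function q"
      "(\<integral>x. \<bar>f x - q x\<bar> \<partial>\<mu>) < \<eta> * \<delta> / 20" by blast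
    have js: "jspan q" by (rule jspan_polynomial[OF q(1)])
    have qi: "integrable \<mu> q" by (rule jspan_integrable[OF js])
    define g where "g = (\<lambda>x. \<bar>f x - q x\<bar>)"
    have gi: "integrable \<mu> g" unfolding g_def using f qi by simp
    have g0: "AE x in \<mu>. g x \<ge> 0" by (simp add: g_def)
    have "\<delta> / 16 > 0" using d by simp
    from maximal_weak_type[OF gi g0 this] obtain U1 where U1: "U1 \<in> sets \<mu>"
      "\<delta> / 16 * measure \<mu> U1 \<le> (\<integral>x. g x \<partial>\<mu>)"
      "\<And>x t. x \<in> jacobi_cube \<Longrightarrow> x \<notin> U1 \<Longrightarrow> 0 < t \<Longrightarrow> t \<le> 1 \<Longrightarrow> pois t g x \<le> 4 * (\<delta> / 16)" by blast
    define U2 where "U2 = {x\<in>space \<mu>. g x \<ge> \<delta> / 4}"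
    have U2: "U2 \<in> sets \<mu>" unfolding U2_def using gi by measurable
    have "measure \<mu> U2 \<le> (\<integral>x. g x \<partial>\<mu>) / (\<delta> / 4)"
      unfolding U2_def using d by (intro integral_Markov_inequality_measure[OF gi, where A = "{}"]) (auto simp: g_def)
    then have "\<delta> / 4 * measure \<mu> U2 \<le> (\<integral>x. g x \<partial>\<mu>)" using d by (simp add: field_simps)
    then have "\<delta> * measure \<mu> U1 + \<delta> * measure \<mu> U2 \<le> 20 * (\<integral>x. g x \<partial>\<mu>)" using U1(2) by linarith
    also have "\<dots> \<le> \<delta> * \<eta>" using q(2) by (simp add: g_def mult_ac)
    finally have "measure \<mu> U1 + measure \<mu> U2 \<le> \<eta>" using d by (simp flip: distrib_left)
    then have m: "measure \<mu> (U1 \<union> U2) \<le> \<eta>" using measure_Un_le[OF U1(1) U2] by linarith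
    have "?good x" if x: "x \<in> jacobi_cube" "x \<notin> U1 \<union> U2" for x
    proof -
      have "\<forall>\<^sub>F t in at_right 0. dist (pois t q x) (q x) < \<delta> / 4"
        using tendstoD[OF pois_jspan[OF js, of x], of "\<delta> / 4"] d by simp
      moreover have "\<forall>\<^sub>F t in at_right 0. t \<in> {0<..<1::real}"
        by (rule eventually_at_right_real) simp
      ultimately show ?thesis
      proof eventually_elim
        case (elim t)
        then have t: "0 < t" "t \<le> 1" by auto
        have "\<bar>pois t f x - pois t q x\<bar> = \<bar>pois t (\<lambda>x. f x - q x) x\<bar>"
          by (simp add: pois_diff[OF f qi x(1) t(1)])
        also have "\<dots> \<le> pois t g x"
          unfolding g_def using f qi by (intro pois_abs_le x(1) t) simp
        also have "\<dots> \<le> 4 * (\<delta> / 16)" using U1(3) x t by auto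
        finally have "\<bar>pois t f x - pois t q x\<bar> \<le> \<delta> / 4" by simp
        moreover have "\<bar>f x - q x\<bar> < \<delta> / 4" using x(2) by (auto simp: U2_def g_def)
        ultimately show ?case using elim(1) d unfolding dist_real_def by linarith
      qed
    qed
    then show ?thesis using m U1(1) U2 by (intro bexI[of _ "U1 \<union> U2"]) auto
  qed
  then have "\<forall>k::nat. \<exists>U. U \<in> sets \<mu> \<and> measure \<mu> U \<le> 1 / real (Suc k) \<and> (\<forall>x\<in>jacobi_cube. x \<notin> U \<longrightarrow> ?good x)"
    by (metis of_nat_0_less_iff zero_less_Suc zero_less_divide_1_iff)
  then obtain U where U: "\<And>k. U k \<in> sets \<mu>" "\<And>k. measure \<mu> (U k) \<le> 1 / real (Suc k)"
    "\<And>k x. x \<in> jacobi_cube \<Longrightarrow> x \<notin> U k \<Longrightarrow> ?good x" by metis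
  define V where "V = (\<Inter>k. U k)"
  have V: "V \<in> sets \<mu>" unfolding V_def using U(1) by auto
  have "measure \<mu> V \<le> 1 / real (Suc k)" for k
  proof -
    have "measure \<mu> V \<le> measure \<mu> (U k)" using U(1) by (intro finite_measure_mono) (auto simp: V_def)
    then show ?thesis using U(2)[of k] by linarith
  qed
  then have "measure \<mu> V \<le> 0"
    by (intro LIMSEQ_le_const[OF LIMSEQ_inverse_real_of_nat]) (auto simp: inverse_eq_divide)
  then have "emeasure \<mu> V = 0" by (simp add: emeasure_eq_measure measure_le_0_iff)
  then have "AE x in \<mu>. x \<notin> V" using V by (intro AE_not_in null_setsI)
  with AE_cube show ?thesis by eventually_elim (use U(3) in \<open>auto simp: V_def\<close>)
qed

lemma pois_tendsto_AE:
  assumes f: "integrable \<mu> f"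
  shows "AE x in \<mu>. ((\<lambda>t. pois t f x) \<longlongrightarrow> f x) (at_right 0)"
proof -
  have "AE x in \<mu>. \<forall>k::nat. \<forall>\<^sub>F t in at_right 0. \<bar>pois t f x - f x\<bar> < inverse (real (Suc k))"
    unfolding AE_all_countable using eventually_close[OF f] by simp
  then show ?thesis
  proof eventually_elim
    case (elim x)
    show ?case
    proof (rule tendstoI)
      fix e :: real assume "e > 0"
      then obtain k where k: "inverse (real (Suc k)) < e" using reals_Archimedean by blast
      have "\<forall>\<^sub>F t in at_right 0. \<bar>pois t f x - f x\<bar> < inverse (real (Suc k))" using elim by blast
      then show "\<forall>\<^sub>F t in at_right 0. dist (pois t f x) (f x) < e"
        by eventually_elim (use k in \<open>simp add: dist_real_def\<close>)
    qed
  qed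
qed

section \<open>The reproducing formula for integrable functions\<close>

definition pois_deriv :: "real \<Rightarrow> (real^'n \<Rightarrow> real) \<Rightarrow> real^'n \<Rightarrow> real" where
  "pois_deriv t f x = (\<Sum>\<^sub>\<infinity>\<kappa>\<in>UNIV. - nu \<kappa> * (jcoeff f \<kappa> * jac \<kappa> x) * exp (- nu \<kappa> * t))"

lemma pois_derivatives:
  assumes f: "integrable \<mu> f" and x: "x \<in> jacobi_cube" and t: "t > 0"
  shows "((\<lambda>t. pois t f x) has_real_derivative pois_deriv t f x) (at t)"
    and "isCont (\<lambda>t. pois_deriv t f x) t"
proof -
  obtain e :: "nat \<Rightarrow> nat^'n" where e: "bij e" using bij_nat_vec by blast
  note s = summable_pois[OF f x]
  show "((\<lambda>t. pois t f x) has_real_derivative pois_deriv t f x) (at t)"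
    unfolding pois_def pois_deriv_def by (rule dirichlet_series_has_derivative[OF e nu_nonneg s t])
  have "((\<lambda>t. pois_deriv t f x) has_real_derivative
      (\<Sum>\<^sub>\<infinity>\<kappa>\<in>UNIV. - nu \<kappa> * (- nu \<kappa> * (jcoeff f \<kappa> * jac \<kappa> x)) * exp (- nu \<kappa> * t))) (at t)"
    unfolding pois_deriv_def
    by (rule dirichlet_series_has_derivative[OF e nu_nonneg dirichlet_series_coeff_derivative[OF nu_nonneg s] t])
  then show "isCont (\<lambda>t. pois_deriv t f x) t" by (rule DERIV_isCont)
qed

lemma Q_jacobi_eq:
  assumes f: "integrable \<mu> f" and x: "x \<in> jacobi_cube" and t: "t > 0"
  shows "Q_jacobi \<alpha> \<beta> t f x = - t * pois_deriv t f x"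
proof -
  have "\<forall>\<^sub>F s in nhds t. s \<in> {0<..}" using t by (intro eventually_nhds_in_open) auto
  then have "\<forall>\<^sub>F s in nhds t. poisson_jacobi \<alpha> \<beta> s f x = pois s f x"
    by eventually_elim (simp add: poisson_eq_pois[OF f x])
  then have "deriv (\<lambda>s. poisson_jacobi \<alpha> \<beta> s f x) t = deriv (\<lambda>s. pois s f x) t"
    by (rule deriv_cong_ev) simp
  then show ?thesis
    unfolding Q_jacobi_def using DERIV_imp_deriv[OF pois_derivatives(1)[OF f x t]] by simp
qed

text \<open>
  $Q_t f / t$ is the continuous function $-\partial_t P_t f$, so its integral over $[a, b]$ is
  $P_a f - P_b f$; the limits at 0 and at infinity are the hypothesis and \<open>pois_tendsto_zero\<close>.
\<close>

lemma Q_jacobi_improper_integral: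
  assumes f: "integrable \<mu> f" and x: "x \<in> jacobi_cube" and z: "(\<integral>y. f y \<partial>\<mu>) = 0"
    and lim: "((\<lambda>t. pois t f x) \<longlongrightarrow> f x) (at_right 0)"
  shows "has_improper_integral (\<lambda>t. Q_jacobi \<alpha> \<beta> t f x / t) (f x)"
proof -
  let ?q = "\<lambda>t. Q_jacobi \<alpha> \<beta> t f x / t"
  have q: "?q t = - pois_deriv t f x" if "t > 0" for t
    using Q_jacobi_eq[OF f x that] that by simp
  have FTC: "set_integrable lborel {a..b} ?q \<and> (LBINT t:{a..b}. ?q t) = pois a f x - pois b f x"
    if ab: "0 < a" "a < b" for a b
  proof -
    have c: "continuous_on {a..b} (\<lambda>t. - pois_deriv t f x)"
      using ab pois_derivatives(2)[OF f x]
      by (intro continuous_at_imp_continuous_on ballI continuous_minus) auto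
    have ind: "indicator {a..b} t *\<^sub>R ?q t = indicator {a..b} t *\<^sub>R (- pois_deriv t f x)" for t
      using q[of t] ab by (simp add: indicator_def)
    have d: "((\<lambda>t. - pois t f x) has_vector_derivative - pois_deriv t f x) (at t within {a..b})"
      if "a \<le> t" "t \<le> b" for t
      using DERIV_minus[OF pois_derivatives(1)[OF f x, of t]] that ab
      by (simp add: has_real_derivative_iff_has_vector_derivative has_vector_derivative_at_within)
    have hb: "has_bochner_integral lborel (\<lambda>t. indicator {a..b} t *\<^sub>R (- pois_deriv t f x)) (- pois b f x - (- pois a f x))"
      by (rule has_bochner_integral_FTC_Icc[OF less_imp_le[OF ab(2)] d c])
    then show ?thesis
      unfolding set_integrable_def set_lebesgue_integral_def ind by (simp add: has_bochner_integral_iff)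
  qed
  have "((\<lambda>(a, b). LBINT t:{a..b}. ?q t) \<longlongrightarrow> f x) (at_right 0 \<times>\<^sub>F at_top)"
  proof (rule Lim_transform_eventually)
    have "((\<lambda>p. pois (fst p) f x - pois (snd p) f x) \<longlongrightarrow> f x - 0) (at_right 0 \<times>\<^sub>F at_top)"
      by (intro tendsto_diff filterlim_compose[OF lim filterlim_fst]
          filterlim_compose[OF pois_tendsto_zero[OF f x z] filterlim_snd])
    then show "((\<lambda>p. pois (fst p) f x - pois (snd p) f x) \<longlongrightarrow> f x) (at_right 0 \<times>\<^sub>F at_top)" by simp
    have "\<forall>\<^sub>F p in at_right 0 \<times>\<^sub>F at_top. fst p \<in> {0<..<1::real}"
      by (rule eventually_compose_filterlim[OF eventually_at_right_real filterlim_fst]) simp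
    moreover have "\<forall>\<^sub>F p in at_right (0::real) \<times>\<^sub>F at_top. (1::real) < snd p"
      by (rule eventually_compose_filterlim[OF eventually_gt_at_top filterlim_snd])
    ultimately have "\<forall>\<^sub>F p in at_right 0 \<times>\<^sub>F at_top. fst p \<in> {0<..<1::real} \<and> (1::real) < snd p"
      by (rule eventually_conj)
    then show "\<forall>\<^sub>F p in at_right 0 \<times>\<^sub>F at_top. pois (fst p) f x - pois (snd p) f x = (case p of (a, b) \<Rightarrow> LBINT t:{a..b}. ?q t)"
      by eventually_elim (use FTC in \<open>auto simp: split_beta\<close>)
  qed
  then show ?thesis unfolding has_improper_integral_def using FTC by blast
qed

section \<open>The double reproducing formula for polynomials\<close>

lemma jcoeff_finite_sum:
  assumes L: "finite L"
  shows "jcoeff (\<lambda>x. \<Sum>\<kappa>\<in>L. c \<kappa> * jac \<kappa> x) \<iota> = (if \<iota> \<in> L then c \<iota> else 0)"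
proof -
  have "jcoeff (\<lambda>x. \<Sum>\<kappa>\<in>L. c \<kappa> * jac \<kappa> x) \<iota> = (\<integral>x. (\<Sum>\<kappa>\<in>L. c \<kappa> * (jac \<kappa> x * jac \<iota> x)) \<partial>\<mu>)"
    by (simp add: jcoeff_def sum_distrib_right mult.assoc)
  also have "\<dots> = (\<Sum>\<kappa>\<in>L. \<integral>x. c \<kappa> * (jac \<kappa> x * jac \<iota> x) \<partial>\<mu>)"
    by (intro Bochner_Integration.integral_sum integrable_mult_right integrable_times_jac integrable_jac)
  also have "\<dots> = (if \<iota> \<in> L then c \<iota> else 0)"
    unfolding integral_mult_right_zero jac_orthonormal using L by (simp add: if_distrib cong: if_cong)
  finally show ?thesis .
qed

text \<open>
  The formula holds at every point of the space. This makes $Q_s f$ a polynomial on the whole space,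
  in particular a measurable function to which $Q_t$ can be applied again.
\<close>

lemma poisson_finite_sum:
  assumes L: "finite L" and t: "t > 0"
  shows "poisson_jacobi \<alpha> \<beta> t (\<lambda>x. \<Sum>\<kappa>\<in>L. c \<kappa> * jac \<kappa> x) x = (\<Sum>\<kappa>\<in>L. (c \<kappa> * jac \<kappa> x) * exp (- nu \<kappa> * t))"
proof -
  let ?f = "\<lambda>x. \<Sum>\<kappa>\<in>L. c \<kappa> * jac \<kappa> x"
  have fi: "integrable \<mu> ?f" by (intro Bochner_Integration.integrable_sum integrable_mult_right integrable_jac)
  let ?w = "\<lambda>\<kappa> u. exp (- u) / sqrt u * exp (- ((nu \<kappa> * t)\<^sup>2 / (4 * u)))"
  have ex: "(nu \<kappa> * t)\<^sup>2 / (4 * u) = lam \<kappa> * (t\<^sup>2 / (4 * u))" for \<kappa> u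
    by (simp add: nu_def power_mult_distrib lam_nonneg)
  have "exp (- u) / sqrt u * jacobi_semigroup \<alpha> \<beta> (t\<^sup>2 / (4 * u)) ?f x
      = (\<Sum>\<kappa>\<in>L. (c \<kappa> * jac \<kappa> x) * ?w \<kappa> u)" if u: "u > 0" for u
  proof -
    have pos: "t\<^sup>2 / (4 * u) > 0" using u t by simp
    have "jacobi_semigroup \<alpha> \<beta> (t\<^sup>2 / (4 * u)) ?f x =
       (\<Sum>\<^sub>\<infinity>\<kappa>\<in>UNIV. (if \<kappa> \<in> L then c \<kappa> else 0) * jac \<kappa> x * exp (- lam \<kappa> * (t\<^sup>2 / (4 * u))))"
      by (subst jacobi_semigroup_series[OF fi pos]) (simp only: jcoeff_finite_sum[OF L])
    also have "\<dots> = (\<Sum>\<^sub>\<infinity>\<kappa>\<in>L. c \<kappa> * jac \<kappa> x * exp (- lam \<kappa> * (t\<^sup>2 / (4 * u))))"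
      by (rule infsum_cong_neutral) auto
    also have "\<dots> = (\<Sum>\<kappa>\<in>L. c \<kappa> * jac \<kappa> x * exp (- lam \<kappa> * (t\<^sup>2 / (4 * u))))"
      by (rule infsum_finite[OF L])
    finally show ?thesis unfolding ex by (simp add: sum_distrib_left mult_ac)
  qed
  then have "(LBINT u:{0<..}. exp (- u) / sqrt u * jacobi_semigroup \<alpha> \<beta> (t\<^sup>2 / (4 * u)) ?f x)
      = (LBINT u:{0<..}. (\<Sum>\<kappa>\<in>L. (c \<kappa> * jac \<kappa> x) * ?w \<kappa> u))"
    by (intro set_lebesgue_integral_cong) auto
  also have "\<dots> = (\<Sum>\<kappa>\<in>L. (c \<kappa> * jac \<kappa> x) * (sqrt pi * exp (- (nu \<kappa> * t))))"
    using subordination[of "nu _ * t"] nu_nonneg t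
    by (subst set_integral_finite_sum(2)[OF L]) auto
  finally show ?thesis
    unfolding poisson_jacobi_def by (simp add: sum_distrib_left mult_ac)
qed

lemma Q_finite_sum:
  assumes L: "finite L" and t: "t > 0"
  shows "Q_jacobi \<alpha> \<beta> t (\<lambda>x. \<Sum>\<kappa>\<in>L. c \<kappa> * jac \<kappa> x) =
    (\<lambda>x. \<Sum>\<kappa>\<in>L. (c \<kappa> * (t * nu \<kappa> * exp (- nu \<kappa> * t))) * jac \<kappa> x)"
proof
  fix x
  have "deriv (\<lambda>s. poisson_jacobi \<alpha> \<beta> s (\<lambda>x. \<Sum>\<kappa>\<in>L. c \<kappa> * jac \<kappa> x) x) t =
     (\<Sum>\<kappa>\<in>L. (- nu \<kappa> * (c \<kappa> * jac \<kappa> x)) * exp (- nu \<kappa> * t))"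
    by (rule deriv_exp_sum[OF poisson_finite_sum[OF L] t])
  then show "Q_jacobi \<alpha> \<beta> t (\<lambda>x. \<Sum>\<kappa>\<in>L. c \<kappa> * jac \<kappa> x) x =
     (\<Sum>\<kappa>\<in>L. (c \<kappa> * (t * nu \<kappa> * exp (- nu \<kappa> * t))) * jac \<kappa> x)"
    by (simp add: Q_jacobi_def sum_distrib_left sum_negf mult_ac)
qed

lemma mean_zero_polynomial_expansion:
  assumes f: "real_polynomial_function f" and z: "(\<integral>y. f y \<partial>\<mu>) = 0"
  shows "\<exists>L c. finite L \<and> 0 \<notin> L \<and> f = (\<lambda>x. \<Sum>\<kappa>\<in>L. c \<kappa> * jac \<kappa> x)"
proof -
  obtain K where K: "finite K" "\<And>\<kappa>. \<kappa> \<notin> K \<Longrightarrow> jcoeff f \<kappa> = 0" "\<And>x. f x = (\<Sum>\<kappa>\<in>K. jcoeff f \<kappa> * jac \<kappa> x)"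
    using jspan_expansion[OF jspan_polynomial[OF f]] by blast
  have c0: "jcoeff f 0 = 0" using z jcoeff_zero_iff by blast
  have "(\<Sum>\<kappa>\<in>K. jcoeff f \<kappa> * jac \<kappa> x) = (\<Sum>\<kappa>\<in>K - {0}. jcoeff f \<kappa> * jac \<kappa> x)" for x
    using K(1) c0 by (intro sum.mono_neutral_right) auto
  then have "f = (\<lambda>x. \<Sum>\<kappa>\<in>K - {0}. jcoeff f \<kappa> * jac \<kappa> x)"
    using K(3) by (intro ext) metis
  moreover have "finite (K - {0})" "0 \<notin> K - {0}" using K(1) by auto
  ultimately show ?thesis by blast
qed

text \<open>
  On a mode with $\nu > 0$ the integrand is
  $\nu^2 \cdot t^{-\gamma} e^{-\nu t} \cdot s^{\gamma} e^{-\nu s}$. The integrals contribute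
  $\Gamma(1+\gamma)\,\nu^{-1-\gamma}$ and $\Gamma(1-\gamma)\,\nu^{\gamma-1}$, in which all powers of
  $\nu$ cancel, and $u\,\nu^2 e^{-\nu u}$ integrates to one.
\<close>

lemma polynomial_reproducing_formula:
  assumes f: "real_polynomial_function f" and z: "(\<integral>y. f y \<partial>\<mu>) = 0" and g: "0 < \<gamma>" "\<gamma> < 1"
  shows "(\<forall>t>0. set_integrable lborel {0<..} (reproducing_integrand \<alpha> \<beta> \<gamma> f x t)) \<and>
     set_integrable lborel {0<..} (\<lambda>t. LBINT s:{0<..}. reproducing_integrand \<alpha> \<beta> \<gamma> f x t s) \<and>
     f x = C_const \<gamma> * (LBINT t:{0<..}. (LBINT s:{0<..}. reproducing_integrand \<alpha> \<beta> \<gamma> f x t s)) \<and>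
     set_integrable lborel {0<..} (\<lambda>u. u * (deriv ^^ 2) (\<lambda>v. poisson_jacobi \<alpha> \<beta> v f x) u) \<and>
     C_const \<gamma> * (LBINT t:{0<..}. (LBINT s:{0<..}. reproducing_integrand \<alpha> \<beta> \<gamma> f x t s)) =
       (LBINT u:{0<..}. u * (deriv ^^ 2) (\<lambda>v. poisson_jacobi \<alpha> \<beta> v f x) u)"
proof -
  obtain L c where L: "finite L" "0 \<notin> L" and fe: "f = (\<lambda>x. \<Sum>\<kappa>\<in>L. c \<kappa> * jac \<kappa> x)"
    using mean_zero_polynomial_expansion[OF f z] by blast
  define a where "a = (\<lambda>\<kappa>. c \<kappa> * jac \<kappa> x)"
  have fx: "f x = (\<Sum>\<kappa>\<in>L. a \<kappa>)" by (simp add: fe a_def)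
  have nu: "nu \<kappa> > 0" if "\<kappa> \<in> L" for \<kappa> using that L(2) by (intro nu_pos) auto
  let ?G = "\<lambda>p \<nu> s. s powr p * exp (- \<nu> * s)"
  let ?R = "reproducing_integrand \<alpha> \<beta> \<gamma> f x"
  define b where "b = (\<lambda>\<kappa> t. a \<kappa> * (nu \<kappa>)\<^sup>2 * ?G (- \<gamma>) (nu \<kappa>) t)"
  have R: "?R t s = (\<Sum>\<kappa>\<in>L. b \<kappa> t * ?G \<gamma> (nu \<kappa>) s)" if "t > 0" "s > 0" for t s
  proof -
    have "Q_jacobi \<alpha> \<beta> t (Q_jacobi \<alpha> \<beta> s f) x =
       (\<Sum>\<kappa>\<in>L. a \<kappa> * (nu \<kappa>)\<^sup>2 * exp (- nu \<kappa> * s) * exp (- nu \<kappa> * t)) * s * t"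
      unfolding fe Q_finite_sum[OF L(1) that(2)] Q_finite_sum[OF L(1) that(1)]
      by (simp add: a_def sum_distrib_left power2_eq_square mult_ac)
    then have "?R t s = t powr (- \<gamma>) * s powr \<gamma> * (\<Sum>\<kappa>\<in>L. a \<kappa> * (nu \<kappa>)\<^sup>2 * exp (- nu \<kappa> * s) * exp (- nu \<kappa> * t))"
      using that by (simp add: reproducing_integrand_def)
    then show ?thesis by (simp add: b_def sum_distrib_left mult_ac)
  qed
  have Gs: "set_integrable lborel {0<..} (?G \<gamma> (nu \<kappa>))"
    "(LBINT s:{0<..}. ?G \<gamma> (nu \<kappa>) s) = Gamma (\<gamma> + 1) / nu \<kappa> powr (\<gamma> + 1)" if "\<kappa> \<in> L" for \<kappa>
    by (rule gamma_integrable_scaled gamma_integral_scaled_eq; use g nu[OF that] in simp)+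
  have g1: "- \<gamma> > - 1" "- \<gamma> + 1 = 1 - \<gamma>" using g by simp_all
  have Gt: "set_integrable lborel {0<..} (?G (- \<gamma>) (nu \<kappa>))"
    "(LBINT s:{0<..}. ?G (- \<gamma>) (nu \<kappa>) s) = Gamma (1 - \<gamma>) / nu \<kappa> powr (1 - \<gamma>)" if "\<kappa> \<in> L" for \<kappa>
    using gamma_integral_scaled[OF g1(1) nu[OF that]] unfolding g1(2) .
  have Gu: "set_integrable lborel {0<..} (?G 1 (nu \<kappa>))"
    "(LBINT s:{0<..}. ?G 1 (nu \<kappa>) s) = 1 / (nu \<kappa>)\<^sup>2" if "\<kappa> \<in> L" for \<kappa>
  proof -
    have "Gamma (1 + 1 :: real) = 1" "nu \<kappa> powr (1 + 1) = (nu \<kappa>)\<^sup>2"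
      using nu[OF that] by (simp_all add: Gamma_numeral powr_numeral)
    then show "set_integrable lborel {0<..} (?G 1 (nu \<kappa>))"
        "(LBINT s:{0<..}. ?G 1 (nu \<kappa>) s) = 1 / (nu \<kappa>)\<^sup>2"
      using gamma_integral_scaled[of 1, OF _ nu[OF that]] by (simp_all only:)
  qed
  have inner_int: "set_integrable lborel {0<..} (?R t)" if t: "t > 0" for t
    using set_integral_finite_sum(1)[OF L(1) Gs(1), where b = "\<lambda>\<kappa>. b \<kappa> t"] R[OF t]
    by (subst set_integrable_cong[OF refl refl]) auto
  have inner: "(LBINT s:{0<..}. ?R t s) =
      (\<Sum>\<kappa>\<in>L. (a \<kappa> * (nu \<kappa>)\<^sup>2 * (Gamma (\<gamma> + 1) / nu \<kappa> powr (\<gamma> + 1))) * ?G (- \<gamma>) (nu \<kappa>) t)" if t: "t > 0" for t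
  proof -
    have "(LBINT s:{0<..}. ?R t s) = (LBINT s:{0<..}. (\<Sum>\<kappa>\<in>L. b \<kappa> t * ?G \<gamma> (nu \<kappa>) s))"
      using R[OF t] by (intro set_lebesgue_integral_cong) auto
    also have "\<dots> = (\<Sum>\<kappa>\<in>L. b \<kappa> t * (LBINT s:{0<..}. ?G \<gamma> (nu \<kappa>) s))"
      by (rule set_integral_finite_sum(2)[OF L(1) Gs(1)])
    also have "\<dots> = (\<Sum>\<kappa>\<in>L. b \<kappa> t * (Gamma (\<gamma> + 1) / nu \<kappa> powr (\<gamma> + 1)))"
      by (intro sum.cong refl) (simp only: Gs(2))
    finally show ?thesis by (simp add: b_def mult_ac)
  qed
  let ?A = "\<lambda>\<kappa>. a \<kappa> * (nu \<kappa>)\<^sup>2 * (Gamma (\<gamma> + 1) / nu \<kappa> powr (\<gamma> + 1))"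
  have outer_int: "set_integrable lborel {0<..} (\<lambda>t. LBINT s:{0<..}. ?R t s)"
    using set_integral_finite_sum(1)[OF L(1) Gt(1), where b = ?A] inner
    by (subst set_integrable_cong[OF refl refl]) auto
  have "(LBINT t:{0<..}. (LBINT s:{0<..}. ?R t s)) = (LBINT t:{0<..}. (\<Sum>\<kappa>\<in>L. ?A \<kappa> * ?G (- \<gamma>) (nu \<kappa>) t))"
    using inner by (intro set_lebesgue_integral_cong) auto
  also have "\<dots> = (\<Sum>\<kappa>\<in>L. ?A \<kappa> * (LBINT t:{0<..}. ?G (- \<gamma>) (nu \<kappa>) t))"
    by (rule set_integral_finite_sum(2)[OF L(1) Gt(1)])
  also have "\<dots> = (\<Sum>\<kappa>\<in>L. (Gamma (1 - \<gamma>) * Gamma (1 + \<gamma>)) * a \<kappa>)"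
  proof (rule sum.cong[OF refl])
    fix \<kappa> assume k: "\<kappa> \<in> L"
    have "nu \<kappa> powr (\<gamma> + 1) * nu \<kappa> powr (1 - \<gamma>) = (nu \<kappa>)\<^sup>2"
      using nu[OF k] by (simp flip: powr_add add: powr_numeral)
    then show "?A \<kappa> * (LBINT t:{0<..}. ?G (- \<gamma>) (nu \<kappa>) t) = (Gamma (1 - \<gamma>) * Gamma (1 + \<gamma>)) * a \<kappa>"
      unfolding Gt(2)[OF k] using nu[OF k] by (simp add: field_simps)
  qed
  also have "\<dots> = (Gamma (1 - \<gamma>) * Gamma (1 + \<gamma>)) * f x" by (simp add: fx sum_distrib_left)
  finally have outer: "C_const \<gamma> * (LBINT t:{0<..}. (LBINT s:{0<..}. ?R t s)) = f x"
    using C_const_eq[OF g] by (simp flip: mult.assoc)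
  have P: "poisson_jacobi \<alpha> \<beta> v f x = (\<Sum>\<kappa>\<in>L. a \<kappa> * exp (- nu \<kappa> * v))" if "v > 0" for v
    unfolding fe poisson_finite_sum[OF L(1) that] a_def ..
  have P1: "deriv (\<lambda>v. poisson_jacobi \<alpha> \<beta> v f x) v = (\<Sum>\<kappa>\<in>L. (- nu \<kappa> * a \<kappa>) * exp (- nu \<kappa> * v))" if "v > 0" for v
    by (rule deriv_exp_sum[OF P that])
  have P2: "(deriv ^^ 2) (\<lambda>v. poisson_jacobi \<alpha> \<beta> v f x) u = (\<Sum>\<kappa>\<in>L. (- nu \<kappa> * (- nu \<kappa> * a \<kappa>)) * exp (- nu \<kappa> * u))" if "u > 0" for u
    using deriv_exp_sum[OF P1 that] by (simp add: numeral_2_eq_2)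
  have U: "u * (deriv ^^ 2) (\<lambda>v. poisson_jacobi \<alpha> \<beta> v f x) u = (\<Sum>\<kappa>\<in>L. (a \<kappa> * (nu \<kappa>)\<^sup>2) * ?G 1 (nu \<kappa>) u)" if "u > 0" for u
    unfolding P2[OF that] using that by (simp add: sum_distrib_left power2_eq_square mult_ac)
  have u_int: "set_integrable lborel {0<..} (\<lambda>u. u * (deriv ^^ 2) (\<lambda>v. poisson_jacobi \<alpha> \<beta> v f x) u)"
  proof -
    have U': "u * (deriv ^^ 2) (\<lambda>v. poisson_jacobi \<alpha> \<beta> v f x) u = (\<Sum>\<kappa>\<in>L. (a \<kappa> * (nu \<kappa>)\<^sup>2) * ?G 1 (nu \<kappa>) u)"
      if "u \<in> {0<..}" for u by (rule U) (use that in simp)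
    have "set_integrable lborel {0<..} (\<lambda>u. u * (deriv ^^ 2) (\<lambda>v. poisson_jacobi \<alpha> \<beta> v f x) u) \<longleftrightarrow>
        set_integrable lborel {0<..} (\<lambda>u. \<Sum>\<kappa>\<in>L. (a \<kappa> * (nu \<kappa>)\<^sup>2) * ?G 1 (nu \<kappa>) u)"
      by (rule set_integrable_cong[OF refl refl U'])
    moreover have "set_integrable lborel {0<..} (\<lambda>u. \<Sum>\<kappa>\<in>L. (a \<kappa> * (nu \<kappa>)\<^sup>2) * ?G 1 (nu \<kappa>) u)"
      by (rule set_integral_finite_sum(1)[OF L(1) Gu(1)])
    ultimately show ?thesis by blast
  qed
  have "(LBINT u:{0<..}. u * (deriv ^^ 2) (\<lambda>v. poisson_jacobi \<alpha> \<beta> v f x) u)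
      = (LBINT u:{0<..}. (\<Sum>\<kappa>\<in>L. (a \<kappa> * (nu \<kappa>)\<^sup>2) * ?G 1 (nu \<kappa>) u))"
    by (intro set_lebesgue_integral_cong allI impI U) (simp_all only: greaterThan_iff, simp)
  also have "\<dots> = (\<Sum>\<kappa>\<in>L. (a \<kappa> * (nu \<kappa>)\<^sup>2) * (LBINT u:{0<..}. ?G 1 (nu \<kappa>) u))"
    by (rule set_integral_finite_sum(2)[OF L(1) Gu(1)])
  also have "\<dots> = (\<Sum>\<kappa>\<in>L. a \<kappa>)"
  proof (rule sum.cong[OF refl])
    fix \<kappa> assume k: "\<kappa> \<in> L"
    show "(a \<kappa> * (nu \<kappa>)\<^sup>2) * (LBINT u:{0<..}. ?G 1 (nu \<kappa>) u) = a \<kappa>"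
      unfolding Gu(2)[OF k] using nu[OF k] by simp
  qed
  finally have "(LBINT u:{0<..}. u * (deriv ^^ 2) (\<lambda>v. poisson_jacobi \<alpha> \<beta> v f x) u) = f x"
    by (simp add: fx)
  then show ?thesis using inner_int outer_int outer u_int by simp
qed

end

theorem theorem3p9:
  fixes \<alpha> \<beta> :: "real ^ 'n"
  assumes "\<And>i. \<alpha> $ i > - 1 / 2" and "\<And>i. \<beta> $ i > - 1 / 2"
  shows
    "(\<forall>f :: real ^ 'n \<Rightarrow> real.
        integrable (jacobi_measure \<alpha> \<beta>) f \<longrightarrow>
        (\<integral>y. f y \<partial>jacobi_measure \<alpha> \<beta>) = 0 \<longrightarrow>
        (AE x in jacobi_measure \<alpha> \<beta>.
           has_improper_integral (\<lambda>t. Q_jacobi \<alpha> \<beta> t f x / t) (f x))) \<and>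
     (\<forall>(f :: real ^ 'n \<Rightarrow> real) (\<gamma> :: real).
        real_polynomial_function f \<longrightarrow>
        (\<integral>y. f y \<partial>jacobi_measure \<alpha> \<beta>) = 0 \<longrightarrow>
        0 < \<gamma> \<longrightarrow> \<gamma> < 1 \<longrightarrow>
        (\<forall>x\<in>jacobi_cube.
           (\<forall>t>0. set_integrable lborel {0<..} (reproducing_integrand \<alpha> \<beta> \<gamma> f x t)) \<and>
           set_integrable lborel {0<..}
             (\<lambda>t. LBINT s:{0<..}. reproducing_integrand \<alpha> \<beta> \<gamma> f x t s) \<and>
           f x = C_const \<gamma> *
             (LBINT t:{0<..}. (LBINT s:{0<..}. reproducing_integrand \<alpha> \<beta> \<gamma> f x t s)) \<and>
           set_integrable lborel {0<..}
             (\<lambda>u. u * (deriv ^^ 2) (\<lambda>v. poisson_jacobi \<alpha> \<beta> v f x) u) \<and>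
           C_const \<gamma> *
             (LBINT t:{0<..}. (LBINT s:{0<..}. reproducing_integrand \<alpha> \<beta> \<gamma> f x t s)) =
             (LBINT u:{0<..}. u * (deriv ^^ 2) (\<lambda>v. poisson_jacobi \<alpha> \<beta> v f x) u)))"
proof -
  interpret jacobi_setting \<alpha> \<beta>
    using assms by unfold_locales auto
  show ?thesis
  proof (intro conjI allI impI)
    fix f :: "real ^ 'n \<Rightarrow> real"
    assume f: "integrable (jacobi_measure \<alpha> \<beta>) f" and z: "(\<integral>y. f y \<partial>jacobi_measure \<alpha> \<beta>) = 0"
    show "AE x in jacobi_measure \<alpha> \<beta>. has_improper_integral (\<lambda>t. Q_jacobi \<alpha> \<beta> t f x / t) (f x)"
      using AE_cube pois_tendsto_AE[OF f]
      by eventually_elim (rule Q_jacobi_improper_integral[OF f _ z])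
  qed (intro ballI polynomial_reproducing_formula)
qed

end
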